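(* Let $1<\beta<2$, $\mu>0$, $T>0$, $I=(a,b)$. Let $U(x,t)$ be the solution to $${}_{C}D_{0,t}^{\beta}U(x,t)=\mu\,\partial_x^2U(x,t)+f(x,t),\quad (x,t)\in I\times(0,T],$$ with $U(x,0)=\phi_0(x)$, $\partial_tU(x,0)=\psi_0(x)$ for $x\in I$ and $U(a,t)=U_a(t)$, $U(b,t)=U_b(t)$ for $t\in(0,T]$, and assume $U\in C^2(C^4(I);[0,T])$. Let $u_j^n$ ($j=0,1,\dots,N$, $n=0,1,\dots,n_T$) be the solutions to the finite difference scheme $$\sum_{k=0}^n\alpha_{n-k}(u_j^{k}-\varphi_j^k)=\mu\tau^{\beta}\sum_{k=0}^n\theta_{n-k}\left(\delta^2_xu_j^k-\delta^2_x\varphi_j^k\right)+\mu\sum_{k=0}^n\alpha_{n-k}\delta_x^2\Phi^k_j+\sum_{k=0}^n\alpha_{n-k}F^k_j$$ ($1\le j\le N-1$, $1\le n\le n_T$), with $u_0^k=U_a(t_k)$, $u_N^k=U_b(t_k)$ ($0\le k\le n_T$) and $u_j^0=\phi_0(x_j)$, where $\alpha_k=(-1)^k\binom{\beta}{k}$ and $\theta_k=2^{-\beta}(-1)^k\alpha_k$. Then there exists a positive constant $C$ independent of $n$, $\tau$ and $h$ such that $$\|e^n\|\le C(\tau^2+h^2),$$ where $e^n=(e_0^n,e_1^n,\dots,e_N^n)^T$, $e_j^n=U(x_j,t_n)-u_j^n$, and $\|e^n\|=\sqrt{h\sum_{j=0}^{N-1}(e_j^n)^2}$.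
   Context: ${}_{C}D_{0,t}^{\beta}U(x,t)=\frac{1}{\Gamma(2-\beta)}\int_0^t(t-s)^{1-\beta}\partial_s^2U(x,s)\,ds$ is the Caputo derivative and $D^{-\beta}_{0,t}g(t)=\frac{1}{\Gamma(\beta)}\int_0^t(t-s)^{\beta-1}g(s)\,ds$ the fractional integral. The grid is $\tau=T/n_T$, $t_n=n\tau$ ($0\le n\le n_T$), $h=(b-a)/N$, $x_j=a+jh$ ($0\le j\le N$), with $n_T,N$ positive integers, and $\delta_x^2v_j=(v_{j+1}-2v_j+v_{j-1})/h^2$. Further, $$\varphi_j^k=\phi_0(x_j)+\psi_0(x_j)t_k,\quad \Phi_j^k=\frac{\phi_0(x_j)t_k^{\beta}}{\Gamma(\beta+1)}+\frac{\psi_0(x_j)t_k^{\beta+1}}{\Gamma(\beta+2)},\quad F_j^k=\left[D^{-\beta}_{0,t}f(x_j,t)\right]_{t=t_k}.$$ $C^2(C^4(I);[0,T])$ denotes the functions that are twice continuously differentiable in $t\in[0,T]$ with values in the space of $C^4$ functions of $x$ (normed by the maximum of the suprema of the derivatives of order at most $4$, with values and derivatives extended continuously to the endpoints of $I$). *)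

theory Defs
  imports "HOL-Analysis.Analysis"
begin

text \<open>In the two fractional operators the integrands are evaluated at the endpoints only on a null
  set: the convention \<^term>\<open>0 powr c = 0\<close> and the values of the two-sided derivative at
  \<^term>\<open>s = 0\<close> and \<^term>\<open>s = t\<close> do not affect the integrals.\<close>

definition caputo :: "real \<Rightarrow> (real \<Rightarrow> real) \<Rightarrow> real \<Rightarrow> real" where
  "caputo \<beta> g t =
     1 / Gamma (2 - \<beta>) * integral {0..t} (\<lambda>s. (t - s) powr (1 - \<beta>) * (deriv ^^ 2) g s)"

definition frac_integral :: "real \<Rightarrow> (real \<Rightarrow> real) \<Rightarrow> real \<Rightarrow> real" where
  "frac_integral \<beta> g t =
     1 / Gamma \<beta> * integral {0..t} (\<lambda>s. (t - s) powr (\<beta> - 1) * g s)"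

text \<open>Functions of class C^m on the open interval whose derivatives of order at
  most m extend continuously to the endpoints; the values of v at the endpoints are
  those of its extension. Derivatives are only evaluated in the open interval.\<close>

definition Cm_space :: "nat \<Rightarrow> real \<Rightarrow> real \<Rightarrow> (real \<Rightarrow> real) set" where
  "Cm_space m a b = {v. continuous_on {a..b} v
     \<and> (\<forall>i<m. \<forall>x\<in>{a<..<b}. (deriv ^^ i) v differentiable (at x))
     \<and> (\<forall>i\<le>m. \<exists>w. continuous_on {a..b} w \<and> (\<forall>x\<in>{a<..<b}. w x = (deriv ^^ i) v x))}"

definition Cm_norm :: "nat \<Rightarrow> real \<Rightarrow> real \<Rightarrow> (real \<Rightarrow> real) \<Rightarrow> real" where
  "Cm_norm m a b v = Max ((\<lambda>i. SUP x\<in>{a<..<b}. \<bar>(deriv ^^ i) v x\<bar>) ` {..m})"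

text \<open>\<^term>\<open>l\<close> times continuously differentiable maps from \<^term>\<open>{0..T}\<close> into the normed space
  \<^term>\<open>Cm_space m a b\<close>: \<^term>\<open>V k\<close> is the \<^term>\<open>k\<close>-th time derivative of \<^term>\<open>\<lambda>t x. U x t\<close>, taken
  in the norm of that space (one-sided at \<^term>\<open>0\<close> and \<^term>\<open>T\<close>).\<close>

definition Cl_Cm_space :: "nat \<Rightarrow> nat \<Rightarrow> real \<Rightarrow> real \<Rightarrow> real \<Rightarrow> (real \<Rightarrow> real \<Rightarrow> real) set" where
  "Cl_Cm_space l m a b T = {U. \<exists>V :: nat \<Rightarrow> real \<Rightarrow> real \<Rightarrow> real.
     V 0 = (\<lambda>t x. U x t)
     \<and> (\<forall>k\<le>l. \<forall>t\<in>{0..T}. V k t \<in> Cm_space m a b)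
     \<and> (\<forall>k<l. \<forall>t\<in>{0..T}.
          ((\<lambda>s. Cm_norm m a b (\<lambda>x. (V k s x - V k t x) / (s - t) - V (Suc k) t x)) \<longlongrightarrow> 0)
            (at t within {0..T}))
     \<and> (\<forall>k\<le>l. \<forall>t\<in>{0..T}.
          ((\<lambda>s. Cm_norm m a b (\<lambda>x. V k s x - V k t x)) \<longlongrightarrow> 0) (at t within {0..T}))}"

definition alpha_coeff :: "real \<Rightarrow> nat \<Rightarrow> real" where
  "alpha_coeff \<beta> k = (- 1) ^ k * (\<beta> gchoose k)"

definition theta_coeff :: "real \<Rightarrow> nat \<Rightarrow> real" where
  "theta_coeff \<beta> k = 2 powr (- \<beta>) * (- 1) ^ k * alpha_coeff \<beta> k"

text \<open>Only used at interior indices \<^term>\<open>j \<ge> 1\<close>, so that \<^term>\<open>j - 1\<close> is not truncated.\<close>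

definition second_diff :: "real \<Rightarrow> (nat \<Rightarrow> real) \<Rightarrow> nat \<Rightarrow> real" where
  "second_diff h v j = (v (j + 1) - 2 * v j + v (j - 1)) / h\<^sup>2"

definition varphi_val :: "(real \<Rightarrow> real) \<Rightarrow> (real \<Rightarrow> real) \<Rightarrow> real \<Rightarrow> real \<Rightarrow> real" where
  "varphi_val \<phi>0 \<psi>0 x t = \<phi>0 x + \<psi>0 x * t"

definition Phi_val ::
  "real \<Rightarrow> (real \<Rightarrow> real) \<Rightarrow> (real \<Rightarrow> real) \<Rightarrow> real \<Rightarrow> real \<Rightarrow> real" where
  "Phi_val \<beta> \<phi>0 \<psi>0 x t =
     \<phi>0 x * t powr \<beta> / Gamma (\<beta> + 1) + \<psi>0 x * t powr (\<beta> + 1) / Gamma (\<beta> + 2)"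

text \<open>\<^term>\<open>u j n\<close> approximates the solution at \<^term>\<open>x\<^sub>j = a + j * h\<close> and
  \<^term>\<open>t\<^sub>n = n * \<tau>\<close>.\<close>

definition fd_scheme ::
  "real \<Rightarrow> real \<Rightarrow> real \<Rightarrow> (real \<Rightarrow> real) \<Rightarrow> (real \<Rightarrow> real) \<Rightarrow> (real \<Rightarrow> real) \<Rightarrow> (real \<Rightarrow> real)
    \<Rightarrow> (real \<Rightarrow> real \<Rightarrow> real) \<Rightarrow> nat \<Rightarrow> nat \<Rightarrow> real \<Rightarrow> real \<Rightarrow> (nat \<Rightarrow> nat \<Rightarrow> real) \<Rightarrow> bool" where
  "fd_scheme \<beta> \<mu> a \<phi>0 \<psi>0 Ua Ub f nT N \<tau> h u \<longleftrightarrow>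
     (let x = (\<lambda>j::nat. a + real j * h);
          t = (\<lambda>k::nat. real k * \<tau>);
          \<alpha> = alpha_coeff \<beta>;
          \<theta> = theta_coeff \<beta>;
          \<phi> = (\<lambda>j k. varphi_val \<phi>0 \<psi>0 (x j) (t k));
          \<Phi> = (\<lambda>j k. Phi_val \<beta> \<phi>0 \<psi>0 (x j) (t k));
          F = (\<lambda>j k. frac_integral \<beta> (f (x j)) (t k))
      in (\<forall>j n. 1 \<le> j \<and> j \<le> N - 1 \<and> 1 \<le> n \<and> n \<le> nT \<longrightarrow>
            (\<Sum>k=0..n. \<alpha> (n - k) * (u j k - \<phi> j k)) =
              \<mu> * \<tau> powr \<beta> * (\<Sum>k=0..n. \<theta> (n - k) *
                 (second_diff h (\<lambda>i. u i k) j - second_diff h (\<lambda>i. \<phi> i k) j))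
              + \<mu> * (\<Sum>k=0..n. \<alpha> (n - k) * second_diff h (\<lambda>i. \<Phi> i k) j)
              + (\<Sum>k=0..n. \<alpha> (n - k) * F j k))
         \<and> (\<forall>k\<le>nT. u 0 k = Ua (t k) \<and> u N k = Ub (t k))
         \<and> (\<forall>j\<le>N. u j 0 = \<phi>0 (x j)))"

definition grid_norm :: "real \<Rightarrow> nat \<Rightarrow> (nat \<Rightarrow> real) \<Rightarrow> real" where
  "grid_norm h N e = sqrt (h * (\<Sum>j=0..<N. (e j)\<^sup>2))"

end

theory Submission
  imports Defs "HOL-Real_Asymp.Real_Asymp"
begin

text \<open>
  Why the estimate holds. Read every time sequence as a formal power series in X and put g = \<beta> - 1,
  which lies strictly between 0 and 1. Convolution with the \<alpha>'s is multiplication by (1 - X)^\<beta>,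
  convolution with the \<theta>'s is multiplication by 2^(-\<beta>) (1 + X)^\<beta>. Applying the fractional
  integral of order \<beta> to the equation gives, for p = U - \<phi>, the identity
  p = \<mu> J^\<beta> p_xx + \<mu> \<Phi>_xx + F, whose samples on the grid are compared with the scheme.
  Subtracting the two and multiplying by (1 - X)^(1 - \<beta>) yields for the error e
    (1 - X) e = \<mu> (\<tau>/2)^\<beta> G (1 + X) \<delta>^2 e + S,   G = ((1 + X)/(1 - X))^g.
  This step is what makes an energy argument possible: the left-hand side is now an ordinary time
  increment, and the remaining power g is less than one.

  Stability. The function ((1 + z)/(1 - z))^g has nonnegative real part in the unit disc, so
  convolution with its coefficients is a positive quadratic form (trapez_positive_type). Testing the
  equation with e^n + e^(n-1) and summing by parts in space removes the term with G, and the norm of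
  e^n is at most twice the sum of the norms of the S^k (energy_stability).

  Consistency. Hence it suffices that S is of size \<tau> (\<tau>^2 + h^2). The replacement of second derivatives
  in space by difference quotients contributes h^2, and an increment in time or the bound
  n^g for the sum of the absolute values of the coefficients of G supplies the factor \<tau>. The
  remaining part compares an increment of J^\<beta> y, for y = p_xx, with quadrature; since
  J^\<beta> = J^1 J^g it splits into the error of the ordinary trapezoidal rule for J^g y and the error
  of the fractional trapezoidal rule of order g (fractional_trapezoid_increment_error). The latter
  is of second order because y and y' vanish at time 0: up to \<tau>^2, the function y is its piecewise
  linear interpolant, J^g of which is the convolution of the second differences of y with
  (m + 1)^(g+1) / \<Gamma>(g + 2). The quadrature rule is a convolution of the same second differences with the
  coefficients of 2^(-g) (1 + X)^g (1 - X)^(-g-2), and the two kernels differ by a sequence with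
  partial sums of order n^g (main_part_asymptotic, half_one_plus_pow_remainder).
\<close>

section \<open>Binomial series in 1 - X\<close>

definition one_minus_pow :: "'a::field_char_0 \<Rightarrow> 'a fps" where
  "one_minus_pow c = Abs_fps (\<lambda>n. (- 1) ^ n * (c gchoose n))"

lemma one_minus_pow_nth: "fps_nth (one_minus_pow c) n = (- 1) ^ n * (c gchoose n)"
  by (simp add: one_minus_pow_def)

lemma one_minus_pow_add: "one_minus_pow (c + d) = one_minus_pow c * one_minus_pow d"
proof (rule fps_ext)
  fix n
  have "fps_nth (fps_binomial (c + d)) n = fps_nth (fps_binomial c * fps_binomial d) n"
    by (simp add: fps_binomial_add_mult)
  then have "(c + d) gchoose n = (\<Sum>i=0..n. (c gchoose i) * (d gchoose (n - i)))"
    by (simp add: fps_mult_nth)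
  moreover have "fps_nth (one_minus_pow c * one_minus_pow d) n =
      (\<Sum>i=0..n. (- 1) ^ n * ((c gchoose i) * (d gchoose (n - i))))"
    unfolding fps_mult_nth one_minus_pow_nth
  proof (rule sum.cong[OF refl])
    fix i assume "i \<in> {0..n}"
    then have "(- 1 :: 'a) ^ n = (- 1) ^ i * (- 1) ^ (n - i)" by (simp flip: power_add)
    then show "(- 1) ^ i * (c gchoose i) * ((- 1) ^ (n - i) * (d gchoose (n - i))) =
        (- 1) ^ n * ((c gchoose i) * (d gchoose (n - i)))" by (simp add: mult_ac)
  qed
  ultimately show "fps_nth (one_minus_pow (c + d)) n = fps_nth (one_minus_pow c * one_minus_pow d) n"
    by (simp add: one_minus_pow_nth sum_distrib_left)
qed

lemma one_minus_pow_0: "one_minus_pow 0 = 1"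
  by (rule fps_ext) (simp add: one_minus_pow_nth gbinomial_0_left)

lemma one_minus_pow_1: "one_minus_pow 1 = 1 - fps_X"
proof (rule fps_ext)
  fix n
  have "fps_nth (fps_binomial (1::'a)) n = fps_nth (1 + fps_X) n" by (simp only: fps_binomial_1)
  then have "(1::'a) gchoose n = (if n = 0 then 1 else 0) + (if n = 1 then 1 else 0)"
    by (simp add: fps_X_nth)
  then show "fps_nth (one_minus_pow (1::'a)) n = fps_nth (1 - fps_X) n"
    by (auto simp: one_minus_pow_nth fps_X_nth)
qed

lemma one_minus_pow_neg_nth: "fps_nth (one_minus_pow (- g)) n = pochhammer g n / fact n"
proof -
  have "(- 1) ^ n * ((- 1) ^ n * x) = x" for x :: 'a
    by (simp add: mult.assoc[symmetric] power_mult_distrib[symmetric])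
  then show ?thesis by (simp add: one_minus_pow_nth gbinomial_pochhammer)
qed

lemma one_minus_pow_neg_pos: "0 < g \<Longrightarrow> 0 < fps_nth (one_minus_pow (- g :: real)) n"
  by (simp add: one_minus_pow_neg_nth pochhammer_pos)

text \<open>Summation divides by 1 - X and so lowers the exponent by one. Sums of weights are
  therefore weights of a neighbouring order, known in closed form.\<close>

lemma one_minus_pow_partial_sums:
  "(\<Sum>k\<le>n. fps_nth (one_minus_pow c) k) = fps_nth (one_minus_pow (c - 1)) n"
proof -
  have "one_minus_pow (c - 1) = one_minus_pow c * one_minus_pow (- 1)"
    using one_minus_pow_add[of c "- 1"] by simp
  moreover have "fps_nth (one_minus_pow (- 1 :: 'a)) k = 1" for k
    by (simp add: one_minus_pow_neg_nth pochhammer_fact[symmetric])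
  ultimately show ?thesis by (simp add: fps_mult_nth atLeast0AtMost)
qed

lemma one_minus_pow_raise:
  fixes g :: real
  assumes "g \<noteq> 0"
  shows "fps_nth (one_minus_pow (- (g + 1))) n = fps_nth (one_minus_pow (- g)) n * (real n + g) / g"
proof -
  have "g * pochhammer (g + 1) n = pochhammer g n * (g + real n)"
    using pochhammer_rec[of g n] pochhammer_Suc[of g n] by simp
  then show ?thesis unfolding one_minus_pow_neg_nth using assms by (simp add: field_simps)
qed

text \<open>The series ((1 + X)/(1 - X))^g. Its coefficients, multiplied by (\<tau>/2)^g, are
  the weights of the fractional trapezoidal rule with step \<tau> for the integral of order
  g.\<close>

definition trapez_fps :: "real \<Rightarrow> real fps" where
  "trapez_fps g = fps_binomial g * one_minus_pow (- g)"

section \<open>Convolutions of positive type\<close>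

lemma roots_of_unity_orthogonality:
  fixes n l Q :: nat
  assumes "n < Q" "l < Q"
  shows "(\<Sum>q<Q. cis (2 * pi * real q / real Q) ^ n * cnj (cis (2 * pi * real q / real Q)) ^ l) =
    (if n = l then of_nat Q else 0)"
proof -
  define w where "w = cis (2 * pi * (real n - real l) / real Q)"
  have Q: "Q > 0" using assms by simp
  have summand: "cis (2 * pi * real q / real Q) ^ n * cnj (cis (2 * pi * real q / real Q)) ^ l = w ^ q" for q
    by (simp add: w_def Complex.DeMoivre cis_cnj cis_mult algebra_simps diff_divide_distrib)
  show ?thesis
  proof (cases "n = l")
    case True
    then show ?thesis unfolding summand by (simp add: w_def)
  next
    case False
    have "w ^ Q = cis (2 * pi * (real n - real l))"
      using Q by (simp add: w_def Complex.DeMoivre)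
    also have "\<dots> = 1"
      using cis_multiple_2pi[of "real n - real l"] by simp
    finally have wQ: "w ^ Q = 1" .
    have "w \<noteq> 1"
    proof
      assume "w = 1"
      then have "cos (2 * pi * (real n - real l) / real Q) = 1"
        by (metis w_def cis.simps(1) one_complex.simps(1))
      then obtain i :: int where i: "2 * pi * (real n - real l) / real Q = real_of_int i * 2 * pi"
        using cos_one_2pi_int by blast
      then have "real n - real l = i * real Q"
      proof -
        have "2 * pi * (real n - real l) = 2 * pi * (i * real Q)"
          using i Q by (simp add: divide_eq_eq mult_ac)
        then show ?thesis by simp
      qed
      then have "real_of_int (int n - int l) = real_of_int (i * int Q)" by simp
      then have e: "int n - int l = i * int Q" by linarith
      then have "int Q dvd int n - int l" by simp
      moreover have "\<bar>int n - int l\<bar> < int Q" using assms by linarith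
      ultimately show False using False by (metis dvd_imp_le_int eq_iff_diff_eq_0 of_nat_eq_iff abs_of_nat linorder_not_less)
    qed
    then show ?thesis unfolding summand using False wQ by (simp add: geometric_sum)
  qed
qed

text \<open>The Caratheodory-Toeplitz argument. For a polynomial V with coefficients v, the mean
  of g(z) |V(z)|^2 over the circle of radius r is the quadratic form with the weights r^(2l),
  and its real part is nonnegative. Means over roots of unity keep everything a finite sum, at
  the price of truncating g.\<close>

lemma positive_type_of_Re_nonneg:
  fixes g v :: "nat \<Rightarrow> real"
  assumes summ: "\<And>z. norm z < 1 \<Longrightarrow> summable (\<lambda>n. complex_of_real (g n) * z ^ n)"
    and Re: "\<And>z. norm z < 1 \<Longrightarrow> 0 \<le> Re (\<Sum>n. complex_of_real (g n) * z ^ n)"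
  shows "0 \<le> (\<Sum>l\<le>m. v l * (\<Sum>k\<le>l. g (l - k) * v k))"
proof -
  define S where "S r = (\<Sum>l\<le>m. r ^ (2 * l) * (v l * (\<Sum>k\<le>l. g (l - k) * v k)))" for r :: real
  have main: "- e * (\<Sum>k\<le>m. \<bar>v k\<bar>)\<^sup>2 \<le> S r" if r: "0 < r" "r < 1" and e: "0 < e" for r e
  proof -
    have "summable (\<lambda>n. norm (complex_of_real (g n) * of_real r ^ n))"
      using powser_insidea[of "\<lambda>n. complex_of_real (g n)" "of_real ((r + 1) / 2)" "of_real r"]
        summ[of "of_real ((r + 1) / 2)"] r by simp
    then have sn: "summable (\<lambda>n. \<bar>g n\<bar> * r ^ n)"
      using r by (simp add: norm_mult norm_power)
    obtain L0 where L0: "\<And>L. L \<ge> L0 \<Longrightarrow> norm (\<Sum>i. \<bar>g (i + L)\<bar> * r ^ (i + L)) < e"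
      using suminf_exist_split[OF e sn] by blast
    (* Beyond L the series contributes at most e on the circle; all coefficients that enter the
       form have index at most m < L. *)
    define L where "L = max L0 (m + 1)"
    define GL where "GL z = (\<Sum>n<L. complex_of_real (g n) * z ^ n)" for z
    define V where "V z = (\<Sum>k\<le>m. complex_of_real (v k) * z ^ k)" for z
    have ReGL: "- e \<le> Re (GL z)" if z: "norm z = r" for z
    proof -
      have z1: "norm z < 1" using z r by simp
      have tail: "summable (\<lambda>i. norm (complex_of_real (g (i + L)) * z ^ (i + L)))"
        using summable_ignore_initial_segment[OF sn, of L] z by (simp add: norm_mult norm_power)
      have "(\<Sum>n. complex_of_real (g n) * z ^ n) =
          (\<Sum>i. complex_of_real (g (i + L)) * z ^ (i + L)) + GL z"
        unfolding GL_def using suminf_split_initial_segment[OF summ[OF z1], of L] by simp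
      moreover have "norm (\<Sum>i. complex_of_real (g (i + L)) * z ^ (i + L)) \<le>
          (\<Sum>i. norm (complex_of_real (g (i + L)) * z ^ (i + L)))"
        by (rule summable_norm[OF tail])
      moreover have "\<dots> = (\<Sum>i. \<bar>g (i + L)\<bar> * r ^ (i + L))"
        using z by (simp add: norm_mult norm_power)
      moreover have "\<dots> < e"
        using L0[of L] by (simp add: L_def)
      ultimately show ?thesis
        using Re[OF z1] abs_Re_le_cmod[of "\<Sum>i. complex_of_real (g (i + L)) * z ^ (i + L)"]
        by simp
    qed
    have Vb: "norm (V z) \<le> (\<Sum>k\<le>m. \<bar>v k\<bar>)" if z: "norm z = r" for z
    proof -
      have "norm (V z) \<le> (\<Sum>k\<le>m. norm (complex_of_real (v k) * z ^ k))"
        unfolding V_def by (rule norm_sum)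
      also have "\<dots> \<le> (\<Sum>k\<le>m. \<bar>v k\<bar>)"
        using z r by (intro sum_mono) (auto simp: norm_mult norm_power intro!: mult_left_le power_le_one)
      finally show ?thesis .
    qed
    (* Q exceeds all exponents n + k and l below, so the Q-th roots of unity separate them. *)
    define Q where "Q = L + m + 1"
    have Q: "Q > 0" by (simp add: Q_def)
    define w where "w q = cis (2 * pi * real q / real Q)" for q
    let ?z = "\<lambda>q. complex_of_real r * w q"
    have nz: "norm (?z q) = r" for q using r by (simp add: norm_mult w_def)
    have "(\<Sum>q<Q. GL (?z q) * (V (?z q) * cnj (V (?z q)))) =
       (\<Sum>q<Q. \<Sum>n<L. \<Sum>k\<le>m. \<Sum>l\<le>m. complex_of_real (g n * v k * v l * r ^ (n + k + l)) *
          (w q ^ (n + k) * cnj (w q) ^ l))"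
    proof (rule sum.cong[OF refl])
      fix q
      have "V (?z q) * cnj (V (?z q)) =
          (\<Sum>k\<le>m. \<Sum>l\<le>m. (v k * ?z q ^ k) * (v l * cnj (?z q) ^ l))"
        by (simp add: V_def sum_product)
      then show "GL (?z q) * (V (?z q) * cnj (V (?z q))) =
          (\<Sum>n<L. \<Sum>k\<le>m. \<Sum>l\<le>m. complex_of_real (g n * v k * v l * r ^ (n + k + l)) *
            (w q ^ (n + k) * cnj (w q) ^ l))"
        unfolding GL_def sum_distrib_right
        by (simp add: sum_distrib_left power_mult_distrib power_add mult_ac)
    qed
    also have "\<dots> = (\<Sum>n<L. \<Sum>k\<le>m. \<Sum>l\<le>m. complex_of_real (g n * v k * v l * r ^ (n + k + l)) *
          (\<Sum>q<Q. w q ^ (n + k) * cnj (w q) ^ l))"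
      by (simp add: sum.swap[of _ _ "{..<Q}"] sum_distrib_left)
    also have "\<dots> = (\<Sum>n<L. \<Sum>k\<le>m. \<Sum>l\<le>m. complex_of_real (g n * v k * v l * r ^ (n + k + l)) *
          (if n + k = l then of_nat Q else 0))"
      unfolding w_def
      by (intro sum.cong refl arg_cong2[of _ _ _ _ "(*)"] roots_of_unity_orthogonality) (auto simp: Q_def)
    also have "\<dots> = (\<Sum>l\<le>m. \<Sum>k\<le>m. \<Sum>n<L. complex_of_real (g n * v k * v l * r ^ (n + k + l)) *
          (if n + k = l then of_nat Q else 0))"
      by (subst sum.swap, subst (2) sum.swap, subst sum.swap) (rule refl)
    also have "\<dots> = (\<Sum>l\<le>m. \<Sum>k\<le>m. if k \<le> l then complex_of_real (g (l - k) * v k * v l * r ^ (2 * l)) * of_nat Q else 0)"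
    proof (intro sum.cong refl)
      fix l k assume lk: "l \<in> {..m}" "k \<in> {..m}"
      show "(\<Sum>n<L. complex_of_real (g n * v k * v l * r ^ (n + k + l)) * (if n + k = l then of_nat Q else 0))
        = (if k \<le> l then complex_of_real (g (l - k) * v k * v l * r ^ (2 * l)) * of_nat Q else 0)"
      proof (cases "k \<le> l")
        case True
        have "(\<Sum>n<L. complex_of_real (g n * v k * v l * r ^ (n + k + l)) * (if n + k = l then of_nat Q else 0))
          = (\<Sum>n<L. if n = l - k then complex_of_real (g n * v k * v l * r ^ (n + k + l)) * of_nat Q else 0)"
          using True by (intro sum.cong) auto
        also have "\<dots> = complex_of_real (g (l - k) * v k * v l * r ^ (2 * l)) * of_nat Q"
          using True lk by (simp add: L_def mult_2)
        finally show ?thesis using True by simp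
      qed auto
    qed
    also have "\<dots> = (\<Sum>l\<le>m. \<Sum>k\<le>l. complex_of_real (g (l - k) * v k * v l * r ^ (2 * l)) * of_nat Q)"
    proof (rule sum.cong[OF refl])
      fix l assume l: "l \<in> {..m}"
      have "{..m} \<inter> {k. k \<le> l} = {..l}" using l by auto
      then show "(\<Sum>k\<le>m. if k \<le> l then complex_of_real (g (l - k) * v k * v l * r ^ (2 * l)) * of_nat Q else 0)
        = (\<Sum>k\<le>l. complex_of_real (g (l - k) * v k * v l * r ^ (2 * l)) * of_nat Q)"
        by (simp add: sum.If_cases)
    qed
    also have "\<dots> = of_nat Q * complex_of_real (S r)"
      by (simp add: S_def sum_distrib_left mult_ac)
    finally have eq: "(\<Sum>q<Q. GL (?z q) * (V (?z q) * cnj (V (?z q)))) = of_nat Q * complex_of_real (S r)" .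
    have "real Q * S r = Re (\<Sum>q<Q. GL (?z q) * (V (?z q) * cnj (V (?z q))))"
      unfolding eq by simp
    also have "\<dots> = (\<Sum>q<Q. Re (GL (?z q)) * (norm (V (?z q)))\<^sup>2)"
      unfolding Re_sum complex_norm_square[symmetric] by simp
    also have "\<dots> \<ge> (\<Sum>q<Q. - e * (\<Sum>k\<le>m. \<bar>v k\<bar>)\<^sup>2)"
    proof (intro sum_mono)
      fix q
      have "(norm (V (?z q)))\<^sup>2 \<le> (\<Sum>k\<le>m. \<bar>v k\<bar>)\<^sup>2"
        using Vb[OF nz] by (intro power_mono) auto
      then have "- e * (\<Sum>k\<le>m. \<bar>v k\<bar>)\<^sup>2 \<le> - e * (norm (V (?z q)))\<^sup>2" using e by simp
      also have "\<dots> \<le> Re (GL (?z q)) * (norm (V (?z q)))\<^sup>2"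
        using ReGL[OF nz] by (intro mult_right_mono) auto
      finally show "- e * (\<Sum>k\<le>m. \<bar>v k\<bar>)\<^sup>2 \<le> Re (GL (?z q)) * (norm (V (?z q)))\<^sup>2" .
    qed
    finally have "real Q * (- e * (\<Sum>k\<le>m. \<bar>v k\<bar>)\<^sup>2) \<le> real Q * S r" by simp
    moreover have "0 < real Q" using Q by simp
    ultimately show ?thesis by (rule mult_left_le_imp_le)
  qed
  have Spos: "0 \<le> S r" if r: "0 < r" "r < 1" for r
  proof (rule field_le_epsilon)
    fix d :: real assume d: "0 < d"
    define A where "A = (\<Sum>k\<le>m. \<bar>v k\<bar>)\<^sup>2"
    have A: "A \<ge> 0" by (simp add: A_def)
    have "- (d / (A + 1)) * A \<le> S r"
      using main[OF r divide_pos_pos[OF d, of "A + 1"]] A unfolding A_def by auto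
    moreover have "d / (A + 1) * A \<le> d" using d A by (simp add: field_simps)
    ultimately show "0 \<le> S r + d" by simp
  qed
  (* S is a polynomial in r, and S 1 is the form in question. *)
  have "(S \<longlongrightarrow> S 1) (at_left 1)"
    unfolding S_def by (intro tendsto_intros)
  moreover have "eventually (\<lambda>r. 0 \<le> S r) (at_left 1)"
    using eventually_at_left_real[of 0 "1::real"] by (auto elim!: eventually_mono intro: Spos)
  ultimately have "0 \<le> S 1"
    by (intro tendsto_lowerbound[of S "S 1" "at_left 1" 0]) auto
  then show ?thesis by (simp add: S_def)
qed

lemma sums_one_minus_pow:
  fixes z c :: complex
  assumes "norm z < 1"
  shows "(\<lambda>n. fps_nth (one_minus_pow c) n * z ^ n) sums (1 - z) powr c"
proof -
  have "(\<lambda>n. (c gchoose n) * (- z) ^ n) sums (1 + (- z)) powr c"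
    by (rule gen_binomial_complex) (use assms in simp)
  moreover have "(c gchoose n) * (- z) ^ n = fps_nth (one_minus_pow c) n * z ^ n" for n
    by (subst power_minus) (simp add: one_minus_pow_nth mult_ac)
  ultimately show ?thesis by simp
qed

text \<open>The quotient (1 + z)/(1 - z) maps the disc to the right half plane, so its argument
  is less than \<pi>/2, and a power between 0 and 1 does not increase it. The logarithms of 1 +
  z and 1 - z are kept apart because the power series is a product of two binomial
  series.\<close>

lemma Re_quotient_powr_nonneg:
  fixes z :: complex and g :: real
  assumes z: "norm z < 1" and g: "0 \<le> g" "g \<le> 1"
  shows "0 \<le> Re ((1 + z) powr of_real g * (1 - z) powr of_real (- g))"
proof -
  have z1: "\<bar>Re z\<bar> < 1" using z abs_Re_le_cmod[of z] by linarith
  have nz: "1 + z \<noteq> 0" "1 - z \<noteq> 0"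
    using z by (auto simp: add_eq_0_iff)
  have Re1: "Re (1 + z) > 0" "Re (1 - z) > 0" using z1 by auto
  have a: "\<bar>Im (Ln (1 + z))\<bar> < pi / 2" "\<bar>Im (Ln (1 - z))\<bar> < pi / 2"
    using Re_Ln_pos_lt_imp[OF _ ] Re1 nz Re_Ln_pos_lt by blast+
  define L where "L = Ln (1 + z) - Ln (1 - z)"
  have exL: "exp L = (1 + z) / (1 - z)" using nz by (simp add: L_def exp_diff)
  have "Re ((1 + z) * cnj (1 - z)) = 1 - (norm z)\<^sup>2"
    by (simp add: cmod_power2) (simp add: power2_eq_square algebra_simps)
  also have "\<dots> > 0" using z by (simp add: power_less_one_iff abs_square_less_1)
  finally have "Re ((1 + z) / (1 - z)) > 0"
    using Re_complex_div_gt_0 by blast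
  then have "Re (exp L) > 0" using exL by simp
  then have c: "cos (Im L) > 0" by (simp add: Re_exp zero_less_mult_iff)
  have IL: "\<bar>Im L\<bar> < pi" using a by (auto simp: L_def)
  have ILs: "\<bar>Im L\<bar> < pi / 2"
  proof (rule ccontr)
    assume "\<not> ?thesis"
    then have "cos \<bar>Im L\<bar> \<le> cos (pi / 2)" using IL by (intro cos_monotone_0_pi_le) auto
    then show False using c by simp
  qed
  have "(1 + z) powr of_real g * (1 - z) powr of_real (- g) = exp (of_real g * L)"
    using nz by (simp add: powr_def L_def exp_add[symmetric] algebra_simps)
  moreover have "Re (exp (of_real g * L)) = exp (g * Re L) * cos (g * Im L)"
    by (simp add: Re_exp)
  moreover have "0 \<le> cos (g * Im L)"
  proof (rule cos_ge_zero)
    have "\<bar>g * Im L\<bar> \<le> \<bar>Im L\<bar>" using g by (simp add: abs_mult mult_left_le_one_le)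
    then have "\<bar>g * Im L\<bar> \<le> pi / 2" using ILs by linarith
    then show "- (pi / 2) \<le> g * Im L" "g * Im L \<le> pi / 2" by auto
  qed
  ultimately show ?thesis by simp
qed

lemma of_real_gbinomial: "of_real (c gchoose n) = ((of_real c :: complex) gchoose n)"
  by (simp add: gbinomial_prod_rev)

lemma trapez_positive_type:
  fixes v :: "nat \<Rightarrow> real"
  assumes g: "0 \<le> g" "g \<le> 1"
  shows "0 \<le> (\<Sum>l\<le>m. v l * (\<Sum>k\<le>l. fps_nth (trapez_fps g) (l - k) * v k))"
proof -
  have S: "(\<lambda>n. complex_of_real (fps_nth (trapez_fps g) n) * z ^ n) sums
      ((1 + z) powr of_real g * (1 - z) powr of_real (- g))" if z: "norm z < 1" for z
  proof -
    define a where "a n = (of_real g gchoose n) * z ^ n" for n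
    define b where "b n = fps_nth (one_minus_pow (of_real (- g))) n * z ^ n" for n
    have za: "a sums (1 + z) powr of_real g" and zb: "b sums (1 - z) powr of_real (- g)"
      unfolding a_def[abs_def] b_def[abs_def]
      by (rule gen_binomial_complex[OF z], rule sums_one_minus_pow[OF z])
    let ?w = "of_real ((norm z + 1) / 2) :: complex"
    have w: "norm ?w < 1" "norm z < norm ?w" using z by (auto simp: norm_divide simp del: of_real_divide)
    have na: "summable (\<lambda>n. norm (a n))"
      unfolding a_def
      by (rule powser_insidea[OF sums_summable[OF gen_binomial_complex[OF w(1)]] w(2)])
    have nb: "summable (\<lambda>n. norm (b n))"
      unfolding b_def
      by (rule powser_insidea[OF sums_summable[OF sums_one_minus_pow[OF w(1)]] w(2)])
    have "(\<lambda>k. \<Sum>i\<le>k. a i * b (k - i)) sums ((\<Sum>k. a k) * (\<Sum>k. b k))"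
      by (rule Cauchy_product_sums[OF na nb])
    moreover have "(\<Sum>i\<le>k. a i * b (k - i)) = complex_of_real (fps_nth (trapez_fps g) k) * z ^ k" for k
    proof -
      have "a i * b (k - i) = complex_of_real ((g gchoose i) * ((- 1) ^ (k - i) * ((- g) gchoose (k - i)))) * z ^ k"
        if "i \<le> k" for i
      proof -
        have "z ^ k = z ^ i * z ^ (k - i)" using that by (simp flip: power_add)
        then show ?thesis
          by (simp add: a_def b_def one_minus_pow_nth of_real_gbinomial)
      qed
      then show ?thesis
        by (simp add: trapez_fps_def fps_mult_nth one_minus_pow_nth sum_distrib_right atLeast0AtMost)
    qed
    ultimately show ?thesis using za zb by (simp add: sums_iff)
  qed
  show ?thesis
  proof (rule positive_type_of_Re_nonneg)
    fix z :: complex assume z: "norm z < 1"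
    show "summable (\<lambda>n. complex_of_real (fps_nth (trapez_fps g) n) * z ^ n)"
      using S[OF z] by (rule sums_summable)
    show "0 \<le> Re (\<Sum>n. complex_of_real (fps_nth (trapez_fps g) n) * z ^ n)"
      using sums_unique[OF S[OF z]] Re_quotient_powr_nonneg[OF z g] by simp
  qed
qed

section \<open>The energy estimate\<close>

lemma second_diff_summation_by_parts:
  fixes p q :: "nat \<Rightarrow> real"
  assumes "0 < N" "q 0 = 0" "q N = 0"
  shows "(\<Sum>j=1..<N. second_diff h p j * q j) =
    - (\<Sum>j<N. (p (Suc j) - p j) * (q (Suc j) - q j)) / h\<^sup>2"
proof -
  have *: "(\<Sum>j=1..<M. (p (j + 1) - 2 * p j + p (j - 1)) * q j) =
      (p M - p (M - 1)) * q M - (p 1 - p 0) * q 0 - (\<Sum>j<M. (p (Suc j) - p j) * (q (Suc j) - q j))"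
    if "0 < M" for M
    using that
  proof (induction M)
    case (Suc M)
    show ?case
    proof (cases "M = 0")
      case False
      then have "(\<Sum>j=1..<Suc M. (p (j + 1) - 2 * p j + p (j - 1)) * q j) =
          (\<Sum>j=1..<M. (p (j + 1) - 2 * p j + p (j - 1)) * q j) + (p (M + 1) - 2 * p M + p (M - 1)) * q M"
        by simp
      then show ?thesis using Suc.IH False by (simp add: algebra_simps)
    qed (simp add: algebra_simps)
  qed simp
  have "(\<Sum>j=1..<N. second_diff h p j * q j) =
      (\<Sum>j=1..<N. (p (j + 1) - 2 * p j + p (j - 1)) * q j) / h\<^sup>2"
    by (simp add: second_diff_def sum_divide_distrib)
  then show ?thesis using *[OF assms(1)] assms by simp
qed

text \<open>The equation is tested with v = e^n + e^(n-1): the left-hand side telescopes to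
  squared norms, and summation by parts in space turns the convolution term into minus a sum of
  quadratic forms that are nonnegative by the assumption on g. Only the sources s
  remain.\<close>

lemma energy_stability:
  fixes e s :: "nat \<Rightarrow> nat \<Rightarrow> real" and g :: "nat \<Rightarrow> real" and h kap sig :: real
  defines "v \<equiv> \<lambda>j n. e j n + (if n = 0 then 0 else e j (n - 1))"
  assumes N: "0 < N" and h: "0 < h" and kap: "0 \<le> kap" and sig: "0 \<le> sig"
    and g: "\<And>w m. 0 \<le> (\<Sum>l\<le>m. w l * (\<Sum>k\<le>l. g (l - k) * w k))"
    and init: "\<And>j. j \<le> N \<Longrightarrow> e j 0 = 0"
    and bdry: "\<And>n. n \<le> M \<Longrightarrow> e 0 n = 0 \<and> e N n = 0"
    and eq: "\<And>j n. 1 \<le> j \<Longrightarrow> j < N \<Longrightarrow> 1 \<le> n \<Longrightarrow> n \<le> M \<Longrightarrow>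
      e j n - e j (n - 1) =
        kap * (\<Sum>k\<le>n. g (n - k) * second_diff h (\<lambda>i. v i k) j) + s j n"
    and s: "\<And>j n. 1 \<le> j \<Longrightarrow> j < N \<Longrightarrow> 1 \<le> n \<Longrightarrow> n \<le> M \<Longrightarrow> \<bar>s j n\<bar> \<le> sig"
    and n: "n \<le> M"
  shows "grid_norm h N (\<lambda>j. e j n) \<le> 2 * real M * sqrt (h * real N) * sig"
proof -
  define nm where "nm n = L2_set (\<lambda>j. e j n) {1..<N}" for n
  have nm0: "nm n \<ge> 0" for n by (simp add: nm_def)
  have nmsq: "(nm n)\<^sup>2 = (\<Sum>j=1..<N. (e j n)\<^sup>2)" for n
    unfolding nm_def L2_set_def by (rule real_sqrt_pow2) (simp add: sum_nonneg)
  have v0: "v j 0 = 0" if "j \<le> N" for j using init that by (simp add: v_def)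
  have vb: "v 0 n = 0" "v N n = 0" if "n \<le> M" for n
    using that bdry[of n] bdry[of "n - 1"] by (auto simp: v_def)
  (* The convolution terms after summation by parts: one quadratic form for each space interval.
     *)
  define B where "B m = (\<Sum>l\<le>m. \<Sum>j<N. (v (Suc j) l - v j l) *
      (\<Sum>k\<le>l. g (l - k) * (v (Suc j) k - v j k)))" for m
  have B: "0 \<le> B m" for m
  proof -
    have "B m = (\<Sum>j<N. \<Sum>l\<le>m. (v (Suc j) l - v j l) *
      (\<Sum>k\<le>l. g (l - k) * (v (Suc j) k - v j k)))"
      unfolding B_def by (rule sum.swap)
    moreover have "\<dots> \<ge> 0" by (rule sum_nonneg) (rule g)
    ultimately show ?thesis by simp
  qed
  have key: "(nm m)\<^sup>2 \<le> - (kap / h\<^sup>2) * B m + (\<Sum>l=1..m. sqrt (real N) * sig * (nm l + nm (l - 1)))"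
    if "m \<le> M" for m
    using that
  proof (induction m)
    case 0
    have "(nm 0)\<^sup>2 = 0" unfolding nmsq using init by simp
    moreover have "B 0 = 0" unfolding B_def using v0 by simp
    ultimately show ?case by simp
  next
    case (Suc m)
    let ?n = "Suc m"
    have "(nm ?n)\<^sup>2 - (nm m)\<^sup>2 = (\<Sum>j=1..<N. (e j ?n - e j m) * v j ?n)"
      unfolding nmsq by (simp add: v_def sum_subtractf[symmetric] power2_eq_square algebra_simps)
    also have "\<dots> = (\<Sum>j=1..<N. (kap * (\<Sum>k\<le>?n. g (?n - k) * second_diff h (\<lambda>i. v i k) j) + s j ?n) * v j ?n)"
      using eq[of _ ?n] Suc.prems by (intro sum.cong) auto
    also have "\<dots> = kap * (\<Sum>k\<le>?n. g (?n - k) * (\<Sum>j=1..<N. second_diff h (\<lambda>i. v i k) j * v j ?n))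
        + (\<Sum>j=1..<N. s j ?n * v j ?n)"
      by (simp only: sum.swap[of _ "{1..<N}" "{..?n}"] sum_distrib_left sum_distrib_right distrib_right sum.distrib mult.assoc)
    also have "(\<Sum>k\<le>?n. g (?n - k) * (\<Sum>j=1..<N. second_diff h (\<lambda>i. v i k) j * v j ?n)) =
       (\<Sum>k\<le>?n. g (?n - k) * (- (\<Sum>j<N. (v (Suc j) k - v j k) * (v (Suc j) ?n - v j ?n)) / h\<^sup>2))"
      using second_diff_summation_by_parts[OF N vb[OF Suc.prems]] by simp
    also have "\<dots> = - (\<Sum>j<N. (v (Suc j) ?n - v j ?n) * (\<Sum>k\<le>?n. g (?n - k) * (v (Suc j) k - v j k))) / h\<^sup>2"
    proof -
      have "(\<Sum>j<N. (v (Suc j) ?n - v j ?n) * (\<Sum>k\<le>?n. g (?n - k) * (v (Suc j) k - v j k))) =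
          (\<Sum>k\<le>?n. g (?n - k) * (\<Sum>j<N. (v (Suc j) k - v j k) * (v (Suc j) ?n - v j ?n)))"
        unfolding sum_distrib_left by (subst sum.swap) (simp only: mult_ac)
      then show ?thesis by (simp only: sum_divide_distrib[symmetric] sum_negf mult_minus_right minus_divide_left times_divide_eq_right)
    qed
    also have "(\<Sum>j=1..<N. s j ?n * v j ?n) \<le> sqrt (real N) * sig * (nm ?n + nm m)"
    proof -
      have "(\<Sum>j=1..<N. s j ?n * v j ?n) \<le> (\<Sum>j=1..<N. \<bar>s j ?n\<bar> * \<bar>v j ?n\<bar>)"
        by (intro sum_mono) (metis abs_ge_self abs_mult)
      also have "\<dots> \<le> L2_set (\<lambda>j. s j ?n) {1..<N} * L2_set (\<lambda>j. v j ?n) {1..<N}"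
        by (rule L2_set_mult_ineq)
      also have "\<dots> \<le> (sqrt (real N) * sig) * (nm ?n + nm m)"
      proof (rule mult_mono)
        have "L2_set (\<lambda>j. s j ?n) {1..<N} \<le> L2_set (\<lambda>j. sig) {1..<N}"
          unfolding L2_set_def using s[of _ ?n] Suc.prems sig
          by (intro real_sqrt_le_mono sum_mono) (metis atLeastLessThan_iff le_add1 plus_1_eq_Suc power2_le_iff_abs_le)
        also have "\<dots> = sqrt (real (N - 1)) * sig" using sig by (simp add: L2_set_def real_sqrt_mult)
        also have "\<dots> \<le> sqrt (real N) * sig" using sig by (intro mult_right_mono) auto
        finally show "L2_set (\<lambda>j. s j ?n) {1..<N} \<le> sqrt (real N) * sig" .
        show "L2_set (\<lambda>j. v j ?n) {1..<N} \<le> nm ?n + nm m"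
          unfolding nm_def v_def using L2_set_triangle_ineq[of "\<lambda>j. e j ?n" "\<lambda>j. e j m" "{1..<N}"] by simp
      qed (use sig in auto)
      finally show ?thesis .
    qed
    finally have "(nm ?n)\<^sup>2 \<le> (nm m)\<^sup>2 + (- (kap / h\<^sup>2) * (\<Sum>j<N. (v (Suc j) ?n - v j ?n) *
        (\<Sum>k\<le>?n. g (?n - k) * (v (Suc j) k - v j k))) + sqrt (real N) * sig * (nm ?n + nm m))"
      by simp
    moreover have "B ?n = B m + (\<Sum>j<N. (v (Suc j) ?n - v j ?n) * (\<Sum>k\<le>?n. g (?n - k) * (v (Suc j) k - v j k)))"
      by (simp add: B_def)
    ultimately show ?case using Suc by (simp add: algebra_simps)
  qed
  (* At the time level with the largest norm, one factor of that norm cancels. *)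
  define E where "E = Max (nm ` {..M})"
  have E: "nm l \<le> E" if "l \<le> M" for l unfolding E_def using that by auto
  have E0: "0 \<le> E" using E[of 0] nm0[of 0] by simp
  obtain m where m: "m \<le> M" "nm m = E"
  proof -
    have "E \<in> nm ` {..M}" unfolding E_def by (rule Max_in) auto
    then show ?thesis using that by auto
  qed
  have "E\<^sup>2 \<le> (\<Sum>l=1..m. sqrt (real N) * sig * (nm l + nm (l - 1)))"
  proof -
    have "0 \<le> (kap / h\<^sup>2) * B m" using kap B[of m] by simp
    then show ?thesis using key[OF m(1)] m(2) by simp
  qed
  also have "\<dots> \<le> (\<Sum>l=1..m. sqrt (real N) * sig * (2 * E))"
    using m(1) sig by (intro sum_mono mult_left_mono) (auto intro!: E order_trans[OF add_mono[OF E E]])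
  also have "\<dots> = real m * (sqrt (real N) * sig * (2 * E))" by simp
  also have "\<dots> \<le> real M * (sqrt (real N) * sig * (2 * E))"
    using m(1) sig E0 by (intro mult_right_mono) auto
  finally have "E * E \<le> (2 * real M * sqrt (real N) * sig) * E" by (simp add: power2_eq_square mult_ac)
  then have Eb: "E \<le> 2 * real M * sqrt (real N) * sig"
    using E0 sig by (cases "E = 0") auto
  have "grid_norm h N (\<lambda>j. e j n) = sqrt h * sqrt (\<Sum>j=0..<N. (e j n)\<^sup>2)"
    by (simp add: grid_norm_def real_sqrt_mult)
  also have "(\<Sum>j=0..<N. (e j n)\<^sup>2) = (\<Sum>j=1..<N. (e j n)\<^sup>2)"
    using N bdry[OF n] by (subst sum.atLeast_Suc_lessThan) auto
  also have "sqrt \<dots> = nm n" by (simp add: nm_def L2_set_def)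
  also have "sqrt h * nm n \<le> sqrt h * (2 * real M * sqrt (real N) * sig)"
    using E[OF n] Eb h by (intro mult_left_mono) auto
  finally show ?thesis by (simp add: real_sqrt_mult mult_ac)
qed

section \<open>Fractional integrals of continuous functions\<close>

lemma has_integral_reflect_Icc:
  fixes f :: "real \<Rightarrow> real"
  assumes "(f has_integral I) {0..t}"
  shows "((\<lambda>s. f (t - s)) has_integral I) {0..t}"
proof -
  have "((\<lambda>x. f ((- 1) *\<^sub>R x + t)) has_integral (1 / \<bar>- 1\<bar> ^ DIM(real)) *\<^sub>R I)
      ((\<lambda>x. (1 / (- 1)) *\<^sub>R x + - ((1 / (- 1)) *\<^sub>R t)) ` cbox 0 t)"
    by (rule has_integral_affinity) (use assms in auto)
  moreover have "(\<lambda>x::real. (1 / (- 1)) *\<^sub>R x + - ((1 / (- 1)) *\<^sub>R t)) ` cbox 0 t = {0..t}"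
  proof -
    have "(\<lambda>x::real. (1 / (- 1)) *\<^sub>R x + - ((1 / (- 1)) *\<^sub>R t)) = (\<lambda>x. t - x)" by auto
    moreover have "(\<lambda>x. t - x) ` {0..t} = {0..t}" by (simp add: image_diff_atLeastAtMost)
    ultimately show ?thesis by simp
  qed
  ultimately show ?thesis by simp
qed

lemma has_integral_frac_kernel:
  fixes d t :: real
  assumes "0 < d" "0 \<le> t"
  shows "((\<lambda>s. (t - s) powr (d - 1)) has_integral (t powr d / d)) {0..t}"
  using has_integral_reflect_Icc[OF has_integral_powr_from_0[of "d - 1" t]] assms by simp

lemma frac_kernel_abs_integrable:
  fixes d t :: real
  assumes "0 < d" "0 \<le> t" "continuous_on {0..t} k"
  shows "(\<lambda>s. (t - s) powr (d - 1) * k s) absolutely_integrable_on {0..t}"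
proof -
  have "(\<lambda>s. k s * (t - s) powr (d - 1)) absolutely_integrable_on {0..t}"
  proof (rule absolutely_integrable_bounded_measurable_product_real)
    show "k \<in> borel_measurable (lebesgue_on {0..t})"
      by (rule continuous_imp_measurable_on_sets_lebesgue) (use assms in auto)
    show "bounded (k ` {0..t})"
      using assms(3) compact_continuous_image compact_imp_bounded by blast
    show "(\<lambda>s. (t - s) powr (d - 1)) absolutely_integrable_on {0..t}"
      using has_integral_frac_kernel[OF assms(1,2)]
      by (intro nonnegative_absolutely_integrable_1) (auto simp: integrable_on_def)
  qed auto
  then show ?thesis by (simp add: mult.commute)
qed

lemma frac_kernel_integrable:
  fixes d t :: real
  assumes "0 < d" "0 \<le> t" "continuous_on {0..t} k"
  shows "(\<lambda>s. (t - s) powr (d - 1) * k s) integrable_on {0..t}"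
  using frac_kernel_abs_integrable[OF assms] absolutely_integrable_on_def by blast

lemma frac_integral_0 [simp]: "frac_integral d k 0 = 0"
  by (simp add: frac_integral_def)

text \<open>The integrand matters only inside the interval. This permits integrands such as f(x,
  .), about which nothing is known at time 0.\<close>

lemma frac_integral_cong_open:
  assumes "\<And>s. 0 < s \<Longrightarrow> s < t \<Longrightarrow> k s = k' s"
  shows "frac_integral d k t = frac_integral d k' t"
proof -
  have "integral {0..t} (\<lambda>s. (t - s) powr (d - 1) * k s) = integral {0..t} (\<lambda>s. (t - s) powr (d - 1) * k' s)"
    by (rule integral_spike[of "{0, t}"]) (use assms in auto)
  then show ?thesis by (simp add: frac_integral_def)
qed

lemma frac_integral_add:
  assumes "0 < d" "0 \<le> t" "continuous_on {0..t} k" "continuous_on {0..t} l"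
  shows "frac_integral d (\<lambda>s. k s + l s) t = frac_integral d k t + frac_integral d l t"
  using integral_add[OF frac_kernel_integrable[OF assms(1,2,3)] frac_kernel_integrable[OF assms(1,2,4)]]
  by (simp add: frac_integral_def distrib_left)

lemma frac_integral_cmult:
  "frac_integral d (\<lambda>s. c * k s) t = c * frac_integral d k t"
proof -
  have "(\<lambda>s. (t - s) powr (d - 1) * (c * k s)) = (\<lambda>s. c * ((t - s) powr (d - 1) * k s))"
    by (simp add: mult_ac)
  then show ?thesis by (simp add: frac_integral_def)
qed

lemma frac_integral_diff:
  assumes "0 < d" "0 \<le> t" "continuous_on {0..t} k" "continuous_on {0..t} l"
  shows "frac_integral d (\<lambda>s. k s - l s) t = frac_integral d k t - frac_integral d l t"
  using integral_diff[OF frac_kernel_integrable[OF assms(1,2,3)] frac_kernel_integrable[OF assms(1,2,4)]]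
  by (simp add: frac_integral_def right_diff_distrib diff_divide_distrib)

lemma frac_integral_sum:
  assumes "0 < d" "0 \<le> t" "finite A" "\<And>i. i \<in> A \<Longrightarrow> continuous_on {0..t} (k i)"
  shows "frac_integral d (\<lambda>s. \<Sum>i\<in>A. k i s) t = (\<Sum>i\<in>A. frac_integral d (k i) t)"
  using assms(3,4)
proof (induction A rule: finite_induct)
  case empty
  then show ?case by (simp add: frac_integral_def)
next
  case (insert i A)
  then show ?case using assms(1,2)
    by (simp add: frac_integral_add continuous_on_sum)
qed

lemma Gamma_plus1_pos: "0 < d \<Longrightarrow> Gamma (d + 1) = d * Gamma (d::real)"
  by (rule Gamma_plus1) (auto elim!: nonpos_Ints_cases)

lemma frac_integral_bound:
  assumes "0 < d" "0 \<le> t" "continuous_on {0..t} k" "\<And>s. 0 \<le> s \<Longrightarrow> s \<le> t \<Longrightarrow> \<bar>k s\<bar> \<le> B"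
  shows "\<bar>frac_integral d k t\<bar> \<le> B * t powr d / Gamma (d + 1)"
proof -
  have "norm (integral {0..t} (\<lambda>s. (t - s) powr (d - 1) * k s)) \<le> integral {0..t} (\<lambda>s. B * (t - s) powr (d - 1))"
  proof (rule integral_norm_bound_integral)
    show "(\<lambda>s. B * (t - s) powr (d - 1)) integrable_on {0..t}"
      using has_integral_frac_kernel[OF assms(1,2)] by (intro integrable_on_mult_right) (auto simp: integrable_on_def)
    show "norm ((t - s) powr (d - 1) * k s) \<le> B * (t - s) powr (d - 1)" if "s \<in> {0..t}" for s
      using assms(4)[of s] that by (simp add: abs_mult mult.commute mult_right_mono)
  qed (rule frac_kernel_integrable[OF assms(1-3)])
  also have "\<dots> = B * (t powr d / d)"
    using has_integral_frac_kernel[OF assms(1,2)] by (simp add: integral_unique)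
  finally have "\<bar>integral {0..t} (\<lambda>s. (t - s) powr (d - 1) * k s)\<bar> \<le> B * (t powr d / d)" by simp
  then have "\<bar>frac_integral d k t\<bar> \<le> (B * (t powr d / d)) / Gamma d"
    using divide_right_mono[OF _ less_imp_le[OF Gamma_real_pos[OF assms(1)]]] Gamma_real_pos[OF assms(1)]
    by (fastforce simp: frac_integral_def abs_mult)
  also have "\<dots> = B * t powr d / Gamma (d + 1)"
    using Gamma_plus1_pos[OF assms(1)] by (simp add: field_simps)
  finally show ?thesis .
qed

text \<open>A Beta integral, rescaled from the unit interval.\<close>

lemma frac_integral_powr:
  assumes d: "0 < d" and q: "0 \<le> q" and t: "0 \<le> t"
  shows "frac_integral d (\<lambda>s. s powr q) t = Gamma (q + 1) / Gamma (q + 1 + d) * t powr (q + d)"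
proof (cases "t = 0")
  case False
  with t have t: "t > 0" by simp
  have "((\<lambda>x. x powr (q + 1 - 1) * (1 - x) powr (d - 1)) has_integral Beta (q + 1) d) {0..1}"
    by (rule has_integral_Beta_real) (use d q in auto)
  then have "((\<lambda>x. ((1 / t) *\<^sub>R x + 0) powr (q + 1 - 1) * (1 - ((1 / t) *\<^sub>R x + 0)) powr (d - 1)) has_integral
      (1 / \<bar>1 / t\<bar> ^ DIM(real)) *\<^sub>R Beta (q + 1) d) ((\<lambda>x. (1 / (1 / t)) *\<^sub>R x + - ((1 / (1 / t)) *\<^sub>R 0)) ` cbox 0 1)"
    by (intro has_integral_affinity) (use t in auto)
  moreover have "(\<lambda>x. (1 / (1 / t)) *\<^sub>R x + - ((1 / (1 / t)) *\<^sub>R 0)) ` cbox 0 1 = {0..t}"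
    using t image_mult_atLeastAtMost[of t 0 1] by simp
  ultimately have "((\<lambda>x. (x / t) powr q * (1 - x / t) powr (d - 1)) has_integral t * Beta (q + 1) d) {0..t}"
    using t by simp
  then have "((\<lambda>x. t powr (q + d - 1) * ((x / t) powr q * (1 - x / t) powr (d - 1))) has_integral
      t powr (q + d - 1) * (t * Beta (q + 1) d)) {0..t}"
    by (rule has_integral_mult_right)
  moreover have "t powr (q + d - 1) * ((x / t) powr q * (1 - x / t) powr (d - 1)) = (t - x) powr (d - 1) * x powr q"
    if "x \<in> {0..t}" for x
  proof -
    have "t powr (q + d - 1) = t powr q * t powr (d - 1)" using powr_add[of t q "d - 1"] by (simp add: algebra_simps)
    moreover have "t powr q * (x / t) powr q = x powr q" using that t by (simp add: powr_mult[symmetric])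
    moreover have "t powr (d - 1) * (1 - x / t) powr (d - 1) = (t - x) powr (d - 1)"
    proof -
      have "t powr (d - 1) * (1 - x / t) powr (d - 1) = (t * (1 - x / t)) powr (d - 1)"
        using that t by (simp add: powr_mult)
      also have "t * (1 - x / t) = t - x" using t by (simp add: field_simps)
      finally show ?thesis .
    qed
    ultimately show ?thesis by (simp add: algebra_simps)
  qed
  ultimately have "((\<lambda>x. (t - x) powr (d - 1) * x powr q) has_integral t powr (q + d - 1) * (t * Beta (q + 1) d)) {0..t}"
    by (rule has_integral_eq[rotated]) auto
  moreover have "t powr (q + d - 1) * t = t powr (q + d)"
    using t powr_add[of t "q + d - 1" 1] by simp
  ultimately have "integral {0..t} (\<lambda>x. (t - x) powr (d - 1) * x powr q) = t powr (q + d) * Beta (q + 1) d"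
    by (metis (no_types, lifting) integral_unique mult.assoc)
  moreover have "Gamma d > 0" using d by (rule Gamma_real_pos)
  ultimately show ?thesis
    by (simp add: frac_integral_def Beta_def mult_ac)
qed (use d q in simp)

lemma frac_integral_monomial:
  assumes "0 < d" "0 \<le> t"
  shows "frac_integral d (\<lambda>s. s ^ i) t = fact i / Gamma (real i + 1 + d) * t powr (real i + d)"
proof -
  have "frac_integral d (\<lambda>s. s ^ i) t = frac_integral d (\<lambda>s. s powr real i) t"
    by (rule frac_integral_cong_open) (simp add: powr_realpow)
  then show ?thesis using frac_integral_powr[OF assms(1) _ assms(2), of "real i"]
    by (simp add: Gamma_fact add.commute)
qed

lemma frac_integral_poly:
  assumes "0 < d" "0 \<le> t"
  shows "frac_integral d (\<lambda>s. \<Sum>i\<le>n. a i * s ^ i) t =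
    (\<Sum>i\<le>n. a i * (fact i / Gamma (real i + 1 + d)) * t powr (real i + d))"
proof -
  have "frac_integral d (\<lambda>s. \<Sum>i\<le>n. a i * s ^ i) t = (\<Sum>i\<le>n. frac_integral d (\<lambda>s. a i * s ^ i) t)"
    by (rule frac_integral_sum[OF assms]) (auto intro!: continuous_intros)
  then show ?thesis using frac_integral_monomial[OF assms]
    by (simp add: frac_integral_cmult mult.assoc)
qed

text \<open>A ramp is the identity function started at c. Ramps are the pieces from which linear
  interpolants are built below.\<close>

lemma frac_integral_ramp:
  assumes d: "0 < d" and c: "0 \<le> c" "c \<le> t"
  shows "frac_integral d (\<lambda>s. max 0 (s - c)) t = (t - c) powr (d + 1) / Gamma (d + 2)"
proof -
  let ?f = "\<lambda>s. (t - c - s) powr (d - 1) * s"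
  have "continuous_on {0..t - c} (\<lambda>s::real. s)" by (intro continuous_intros)
  then have "?f integrable_on {0..t - c}"
    using frac_kernel_integrable[OF d, of "t - c" "\<lambda>s. s"] c by simp
  then have i: "(?f has_integral integral {0..t - c} ?f) (cbox 0 (t - c))"
    using integrable_integral by fastforce
  have "((\<lambda>x. ?f (1 *\<^sub>R x + - c)) has_integral (1 / \<bar>1\<bar> ^ DIM(real)) *\<^sub>R integral {0..t - c} ?f)
      ((\<lambda>x. (1 / 1) *\<^sub>R x + - ((1 / 1) *\<^sub>R - c)) ` cbox 0 (t - c))"
    by (rule has_integral_affinity[OF i]) auto
  then have "((\<lambda>x. (t - x) powr (d - 1) * (x - c)) has_integral integral {0..t - c} ?f) {c..t}"
    by (simp add: algebra_simps)
  then have 1: "((\<lambda>x. (t - x) powr (d - 1) * max 0 (x - c)) has_integral integral {0..t - c} ?f) {c..t}"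
    by (rule has_integral_eq[rotated]) auto
  have 2: "((\<lambda>x. (t - x) powr (d - 1) * max 0 (x - c)) has_integral 0) {0..c}"
    by (rule has_integral_is_0) auto
  have "((\<lambda>x. (t - x) powr (d - 1) * max 0 (x - c)) has_integral 0 + integral {0..t - c} ?f) {0..t}"
    by (rule has_integral_combine[OF c 2 1])
  then have "integral {0..t} (\<lambda>x. (t - x) powr (d - 1) * max 0 (x - c)) = integral {0..t - c} ?f"
    by (simp add: integral_unique)
  then have "frac_integral d (\<lambda>s. max 0 (s - c)) t = frac_integral d (\<lambda>s. s ^ 1) (t - c)"
    by (simp add: frac_integral_def)
  also have "\<dots> = (t - c) powr (d + 1) / Gamma (d + 2)"
    using frac_integral_monomial[OF d, of "t - c" 1] c by (simp add: add_ac)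
  finally show ?thesis .
qed

lemma poly_approx:
  assumes "continuous_on {0..T::real} k" "0 < e"
  obtains a :: "nat \<Rightarrow> real" and n where "\<And>s. 0 \<le> s \<Longrightarrow> s \<le> T \<Longrightarrow> \<bar>k s - (\<Sum>i\<le>n. a i * s ^ i)\<bar> < e"
proof -
  obtain p where p: "polynomial_function p" "\<forall>x\<in>{0..T}. norm (k x - p x) < e"
    using Stone_Weierstrass_polynomial_function[of "{0..T}" k e] assms by auto
  then obtain a n where "p = (\<lambda>x. \<Sum>i\<le>n. a i * x ^ i)"
    using real_polynomial_function_iff_sum[of p] real_polynomial_function_eq[of p] by blast
  then have "\<bar>k s - (\<Sum>i\<le>n. a i * s ^ i)\<bar> < e" if "0 \<le> s" "s \<le> T" for s
    using p(2) that by simp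
  then show ?thesis using that by blast
qed

lemma continuous_on_powr_pos_exponent:
  fixes q :: real
  assumes "0 < q" "S \<subseteq> {0..}"
  shows "continuous_on S (\<lambda>t. t powr q)"
  using assms by (intro continuous_on_powr') (auto intro: continuous_intros)

text \<open>On polynomials the fractional integral is explicit and continuous; by
  frac_integral_bound, uniform approximation carries this over to continuous functions.\<close>

lemma continuous_on_frac_integral:
  assumes d: "0 < d" and T: "0 \<le> T" and k: "continuous_on {0..T} k"
  shows "continuous_on {0..T} (frac_integral d k)"
proof -
  define c where "c = T powr d / Gamma (d + 1)"
  have c: "c \<ge> 0" unfolding c_def using Gamma_real_pos[of "d + 1"] d by simp
  have ex: "\<exists>f. continuous_on {0..T} f \<and> (\<forall>t\<in>{0..T}. dist (f t) (frac_integral d k t) < e)" if e: "e > 0" for e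
  proof -
    have "0 < e / (c + 1)" using e c by simp
    from poly_approx[OF k this] obtain a n
      where a: "\<And>s. 0 \<le> s \<Longrightarrow> s \<le> T \<Longrightarrow> \<bar>k s - (\<Sum>i\<le>n. a i * s ^ i)\<bar> < e / (c + 1)" by metis
    let ?p = "\<lambda>s. \<Sum>i\<le>n. a i * s ^ i"
    let ?f = "\<lambda>t. \<Sum>i\<le>n. a i * (fact i / Gamma (real i + 1 + d)) * t powr (real i + d)"
    have "continuous_on {0..T} ?f"
      using d by (intro continuous_on_sum continuous_on_mult_left continuous_on_powr_pos_exponent) auto
    moreover have "dist (?f t) (frac_integral d k t) < e" if t: "t \<in> {0..T}" for t
    proof -
      have kt: "continuous_on {0..t} k" using k t by (auto intro: continuous_on_subset)
      have "?f t = frac_integral d ?p t" using frac_integral_poly[OF d, of t] t by simp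
      then have "dist (?f t) (frac_integral d k t) = \<bar>frac_integral d (\<lambda>s. k s - ?p s) t\<bar>"
        using frac_integral_diff[OF d _ kt, of ?p] t by (simp add: dist_real_def continuous_intros abs_minus_commute)
      also have "\<dots> \<le> e / (c + 1) * t powr d / Gamma (d + 1)"
        using d t a by (intro frac_integral_bound continuous_intros kt) (auto intro!: less_imp_le)
      also have "\<dots> = e / (c + 1) * (t powr d / Gamma (d + 1))" by simp
      also have "\<dots> \<le> e / (c + 1) * c"
        unfolding c_def using t d e c Gamma_real_pos[of "d + 1"]
        by (intro mult_left_mono divide_right_mono powr_mono2) (auto simp: c_def)
      also have "\<dots> < e" using e c by (simp add: field_simps)
      finally show ?thesis .
    qed
    ultimately show ?thesis by blast
  qed
  define F where "F m = (SOME f. continuous_on {0..T} f \<and> (\<forall>t\<in>{0..T}. dist (f t) (frac_integral d k t) < inverse (real (Suc m))))" for m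
  have F: "continuous_on {0..T} (F m)" "\<And>t. t \<in> {0..T} \<Longrightarrow> dist (F m t) (frac_integral d k t) < inverse (real (Suc m))" for m
    using someI_ex[OF ex[of "inverse (real (Suc m))"]] unfolding F_def by auto
  show ?thesis
  proof (rule uniform_limit_theorem)
    show "\<forall>\<^sub>F m in sequentially. continuous_on {0..T} (F m)" using F by simp
    show "uniform_limit {0..T} F (frac_integral d k) sequentially"
    proof (rule uniform_limitI)
      fix e :: real assume "e > 0"
      then obtain M where M: "inverse (real (Suc M)) < e" using reals_Archimedean by blast
      show "\<forall>\<^sub>F m in sequentially. \<forall>t\<in>{0..T}. dist (F m t) (frac_integral d k t) < e"
      proof (rule eventually_sequentiallyI[of M])
        fix m assume "M \<le> m"
        then have "inverse (real (Suc m)) \<le> inverse (real (Suc M))" by (simp add: divide_simps)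
        then show "\<forall>t\<in>{0..T}. dist (F m t) (frac_integral d k t) < e" using F(2)[of _ m] M by (meson less_le_trans less_trans)
      qed
    qed
  qed simp
qed

text \<open>For powers this is a product of Gamma quotients. Both sides are bounded in the
  supremum norm, so density of the polynomials gives the general case and no interchange of
  integrals is needed.\<close>

theorem frac_integral_semigroup:
  assumes c: "0 < c" and d: "0 < d" and t: "0 \<le> t" and k: "continuous_on {0..t} k"
  shows "frac_integral c (frac_integral d k) t = frac_integral (c + d) k t"
proof (rule ccontr)
  assume ne: "\<not> ?thesis"
  define D where "D = \<bar>frac_integral c (frac_integral d k) t - frac_integral (c + d) k t\<bar>"
  have D: "D > 0" using ne by (simp add: D_def)
  (* A bounds the effect of a unit uniform perturbation of k on the two sides together. *)
  define A where "A = t powr d / Gamma (d + 1) * t powr c / Gamma (c + 1) + t powr (c + d) / Gamma (c + d + 1)"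
  have A: "A \<ge> 0" unfolding A_def using c d Gamma_real_pos[of "c + 1"] Gamma_real_pos[of "d + 1"] Gamma_real_pos[of "c + d + 1"]
    by (intro add_nonneg_nonneg divide_nonneg_pos mult_nonneg_nonneg) auto
  define e where "e = D / (A + 1)"
  have e: "e > 0" using D A by (simp add: e_def add_nonneg_pos)
  from poly_approx[OF k this] obtain a n
    where a: "\<And>s. 0 \<le> s \<Longrightarrow> s \<le> t \<Longrightarrow> \<bar>k s - (\<Sum>i\<le>n. a i * s ^ i)\<bar> < e" by metis
  define p where "p s = (\<Sum>i\<le>n. a i * s ^ i)" for s
  have pc: "continuous_on S p" for S unfolding p_def by (intro continuous_intros)
  have ks: "continuous_on {0..s} k" if "s \<le> t" for s
    using k that by (auto intro: continuous_on_subset)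
  have poly: "frac_integral c (frac_integral d p) t = frac_integral (c + d) p t"
  proof -
    have "frac_integral c (frac_integral d p) t =
        frac_integral c (\<lambda>s. \<Sum>i\<le>n. a i * (fact i / Gamma (real i + 1 + d)) * s powr (real i + d)) t"
      by (rule frac_integral_cong_open) (simp add: p_def[abs_def] frac_integral_poly[OF d])
    also have "\<dots> = (\<Sum>i\<le>n. frac_integral c (\<lambda>s. a i * (fact i / Gamma (real i + 1 + d)) * s powr (real i + d)) t)"
      using d by (intro frac_integral_sum[OF c t] continuous_on_mult_left continuous_on_powr_pos_exponent) auto
    also have "\<dots> = (\<Sum>i\<le>n. a i * (fact i / Gamma (real i + 1 + (c + d))) * t powr (real i + (c + d)))"
    proof (rule sum.cong[OF refl])
      fix i
      have "Gamma (real i + 1 + d) \<noteq> 0" using d by (intro less_imp_neq[symmetric] Gamma_real_pos) simp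
      then show "frac_integral c (\<lambda>s. a i * (fact i / Gamma (real i + 1 + d)) * s powr (real i + d)) t =
          a i * (fact i / Gamma (real i + 1 + (c + d))) * t powr (real i + (c + d))"
        using frac_integral_powr[OF c _ t, of "real i + d"] d
        unfolding frac_integral_cmult[of c "a i * (fact i / Gamma (real i + 1 + d))"]
        by (simp add: add_ac)
    qed
    also have "\<dots> = frac_integral (c + d) p t"
      using frac_integral_poly[of "c + d" t a n] c d t by (simp add: p_def[abs_def])
    finally show ?thesis .
  qed
  have Jd: "\<bar>frac_integral d k s - frac_integral d p s\<bar> \<le> e * t powr d / Gamma (d + 1)" if s: "0 \<le> s" "s \<le> t" for s
  proof -
    have "\<bar>frac_integral d k s - frac_integral d p s\<bar> = \<bar>frac_integral d (\<lambda>s. k s - p s) s\<bar>"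
      using frac_integral_diff[OF d s(1) ks[OF s(2)] pc] by simp
    also have "\<dots> \<le> e * s powr d / Gamma (d + 1)"
      using s a by (intro frac_integral_bound[OF d s(1)] continuous_intros ks pc) (auto simp: p_def intro!: less_imp_le)
    also have "\<dots> \<le> e * t powr d / Gamma (d + 1)"
      using s d e Gamma_real_pos[of "d + 1"] by (intro divide_right_mono mult_left_mono powr_mono2) auto
    finally show ?thesis .
  qed
  have cont: "continuous_on {0..t} (frac_integral d k)" "continuous_on {0..t} (frac_integral d p)"
    by (intro continuous_on_frac_integral d t k pc)+
  have 1: "\<bar>frac_integral c (frac_integral d k) t - frac_integral c (frac_integral d p) t\<bar>
      \<le> e * t powr d / Gamma (d + 1) * t powr c / Gamma (c + 1)"
    using frac_integral_bound[OF c t continuous_on_diff[OF cont] Jd] frac_integral_diff[OF c t cont] by simp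
  have 2: "\<bar>frac_integral (c + d) k t - frac_integral (c + d) p t\<bar> \<le> e * t powr (c + d) / Gamma (c + d + 1)"
  proof -
    have cd: "0 < c + d" using c d by simp
    have "\<bar>frac_integral (c + d) (\<lambda>s. k s - p s) t\<bar> \<le> e * t powr (c + d) / Gamma (c + d + 1)"
      using a by (intro frac_integral_bound[OF cd t] continuous_intros k pc) (auto simp: p_def intro!: less_imp_le)
    then show ?thesis using frac_integral_diff[OF cd t k pc] by simp
  qed
  have "D \<le> e * A" using 1 2 poly unfolding D_def A_def by (simp add: algebra_simps)
  also have "\<dots> < D" using D A by (simp add: e_def field_simps)
  finally show False by simp
qed

lemma frac_integral_1: "frac_integral 1 k t = integral {0..t} k"
proof -
  have "integral {0..t} (\<lambda>s. (t - s) powr (1 - 1) * k s) = integral {0..t} k"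
    by (rule integral_spike[of "{t}"]) auto
  then show ?thesis by (simp add: frac_integral_def)
qed

text \<open>Taylor's formula with integral remainder, as two successive integrations.\<close>

lemma frac_integral_2_taylor:
  assumes t: "0 \<le> t" "t \<le> T"
    and g: "\<And>s. s \<in> {0..T} \<Longrightarrow> (g has_real_derivative g1 s) (at s within {0..T})"
    and g1: "\<And>s. s \<in> {0..T} \<Longrightarrow> (g1 has_real_derivative g2 s) (at s within {0..T})"
    and g2: "continuous_on {0..T} g2"
  shows "frac_integral 2 g2 t = g t - g 0 - g1 0 * t"
proof -
  have J1: "frac_integral 1 g2 s = g1 s - g1 0" if s: "0 \<le> s" "s \<le> T" for s
  proof -
    have "(g2 has_integral (g1 s - g1 0)) {0..s}"
      by (rule fundamental_theorem_of_calculus)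
        (use s in \<open>auto intro!: DERIV_subset[OF g1, of _ "{0..s}"] simp flip: has_real_derivative_iff_has_vector_derivative\<close>)
    then show ?thesis by (simp add: frac_integral_1 integral_unique)
  qed
  have "frac_integral 2 g2 t = frac_integral 1 (frac_integral 1 g2) t"
    using frac_integral_semigroup[of 1 1 t g2] t g2 by (simp add: continuous_on_subset)
  also have "\<dots> = frac_integral 1 (\<lambda>s. g1 s - g1 0) t"
    by (rule frac_integral_cong_open) (use J1 t in auto)
  also have "\<dots> = g t - g 0 - g1 0 * t"
  proof -
    have "((\<lambda>s. g1 s - g1 0) has_integral ((g t - g1 0 * t) - (g 0 - g1 0 * 0))) {0..t}"
      by (rule fundamental_theorem_of_calculus)
        (use t in \<open>auto intro!: derivative_eq_intros DERIV_subset[OF g, of _ "{0..t}"] simp flip: has_real_derivative_iff_has_vector_derivative\<close>)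
    then show ?thesis by (simp add: frac_integral_1 integral_unique)
  qed
  finally show ?thesis .
qed

section \<open>Size and asymptotics of the convolution weights\<close>

text \<open>In (1 - X)^g with 0 < g < 1 all coefficients but the first are nonpositive, and the
  partial sums of the series, which are coefficients of (1 - X)^(g-1), are positive. The
  absolute values therefore sum to at most 2.\<close>

lemma abs_gbinomial_partial_sums:
  fixes g :: real
  assumes g: "0 < g" "g < 1"
  shows "(\<Sum>k\<le>n. \<bar>g gchoose k\<bar>) \<le> 2"
proof -
  have neg: "fps_nth (one_minus_pow g) k \<le> 0" if k: "k \<noteq> 0" for k
  proof -
    obtain j where j: "k = Suc j" using k not0_implies_Suc by blast
    have "pochhammer (- g) k = - g * pochhammer (1 - g) j"
      unfolding j by (simp add: pochhammer_rec)
    moreover have "pochhammer (1 - g) j > 0" using g by (intro pochhammer_pos) simp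
    ultimately have "pochhammer (- g) k \<le> 0" using g by (simp add: mult_nonneg_nonneg)
    then show ?thesis using one_minus_pow_neg_nth[of "- g" k] by (simp add: divide_nonpos_pos)
  qed
  have "\<bar>g gchoose k\<bar> = 2 * (if k = 0 then 1 else 0) - fps_nth (one_minus_pow g) k" for k
  proof -
    have "\<bar>g gchoose k\<bar> = \<bar>fps_nth (one_minus_pow g) k\<bar>"
      by (simp add: one_minus_pow_nth abs_mult power_abs)
    then show ?thesis using neg[of k] by (auto simp: one_minus_pow_nth)
  qed
  then have "(\<Sum>k\<le>n. \<bar>g gchoose k\<bar>) = 2 - (\<Sum>k\<le>n. fps_nth (one_minus_pow g) k)"
    by (simp add: sum_subtractf sum.delta flip: sum_distrib_left)
  also have "\<dots> = 2 - fps_nth (one_minus_pow (- (1 - g))) n"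
    by (simp add: one_minus_pow_partial_sums)
  also have "\<dots> \<le> 2" using one_minus_pow_neg_pos[of "1 - g" n] g by simp
  finally show ?thesis .
qed

lemma summable_abs_gbinomial:
  fixes g :: real
  assumes "0 < g" "g < 1"
  shows "summable (\<lambda>k. \<bar>g gchoose k\<bar>)" "(\<Sum>k. \<bar>g gchoose k\<bar>) \<le> 2"
proof -
  show s: "summable (\<lambda>k. \<bar>g gchoose k\<bar>)"
    by (rule bounded_imp_summable[of _ 2]) (use abs_gbinomial_partial_sums[OF assms] in auto)
  show "(\<Sum>k. \<bar>g gchoose k\<bar>) \<le> 2"
  proof (rule suminf_le_const[OF s])
    fix n show "(\<Sum>k<n. \<bar>g gchoose k\<bar>) \<le> 2"
      using abs_gbinomial_partial_sums[OF assms, of n] by (simp add: lessThan_Suc_atMost[symmetric])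
  qed
qed

text \<open>Coefficient n of the expansion of ((1 + X)/2)^g in powers of (1 - X)/2. By trinomial
  revision it is again a binomial series, evaluated at -1/2.\<close>

lemma half_binomial_reexpansion:
  fixes g :: real
  shows "(\<lambda>k. (g gchoose k) * (- 1) ^ k * ((- 1) ^ n * real (k choose n) / 2 ^ k))
    sums (2 powr (- g) * (g gchoose n))"
proof -
  have "(\<lambda>k. (g - real n gchoose k) * (- 1 / 2) ^ k) sums (1 + (- 1 / 2)) powr (g - real n)"
    by (rule gen_binomial_real) simp
  then have "(\<lambda>k. ((g gchoose n) / 2 ^ n) * ((g - real n gchoose k) * (- 1 / 2) ^ k)) sums
      (((g gchoose n) / 2 ^ n) * (1 / 2) powr (g - real n))"
    by (intro sums_mult) simp
  moreover have "((g gchoose n) / 2 ^ n) * (1 / 2) powr (g - real n) = 2 powr (- g) * (g gchoose n)"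
    by (simp add: powr_diff powr_realpow powr_divide powr_minus field_simps)
  moreover have "((g gchoose n) / 2 ^ n) * ((g - real n gchoose k) * (- 1 / 2) ^ k) =
      (g gchoose (k + n)) * (- 1) ^ (k + n) * ((- 1) ^ n * real ((k + n) choose n) / 2 ^ (k + n))" for k
  proof -
    have "(g gchoose (k + n)) * real ((k + n) choose n) = (g gchoose n) * (g - real n gchoose k)"
      using gbinomial_trinomial_revision[of n "k + n" g] by (simp add: binomial_gbinomial)
    moreover have "(- 1 :: real) ^ (k + n) * (- 1) ^ n = (- 1) ^ k"
      by (simp add: power_add mult.assoc power_mult_distrib[symmetric])
    moreover have "(- 1 / 2 :: real) ^ k = (- 1) ^ k / 2 ^ k" by (rule power_divide)
    ultimately show ?thesis by (simp add: power_add field_simps)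
  qed
  ultimately have "(\<lambda>k. (g gchoose (k + n)) * (- 1) ^ (k + n) * ((- 1) ^ n * real ((k + n) choose n) / 2 ^ (k + n)))
    sums (2 powr (- g) * (g gchoose n))" by simp
  moreover have "(\<Sum>k<n. (g gchoose k) * (- 1) ^ k * ((- 1) ^ n * real (k choose n) / 2 ^ k)) = 0"
    by (intro sum.neutral) (simp add: binomial_eq_0)
  ultimately show ?thesis
    using sums_iff_shift[of "\<lambda>k. (g gchoose k) * (- 1) ^ k * ((- 1) ^ n * real (k choose n) / 2 ^ k)" n] by simp
qed

lemma half_one_minus_X_power_nth:
  "fps_nth ((fps_const (1 / 2) * (1 - fps_X)) ^ k) n = (- 1) ^ n * real (k choose n) / 2 ^ k"
proof -
  have "(1 - fps_X :: real fps) ^ k = one_minus_pow (real k)"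
  proof (induction k)
    case (Suc k)
    then show ?case using one_minus_pow_add[of 1 "real k"] by (simp add: one_minus_pow_1)
  qed (simp add: one_minus_pow_0)
  then show ?thesis
    by (simp add: power_mult_distrib fps_const_power one_minus_pow_nth binomial_gbinomial power_one_over)
qed

text \<open>With x = (1 - X)/2 the left-hand side is (1 - x)^g, whose expansion starts with 1 -
  g x. The coefficients of each power of x have absolute sum 1, so the rest is x^2 times a
  series with absolutely summable coefficients. Thus (1 + X)^g, although singular at X = -1,
  acts on sequences with small second differences almost like its linearisation at X =
  1.\<close>

lemma half_one_plus_pow_remainder:
  fixes g :: real
  assumes g: "0 < g" "g < 1"
  obtains r :: "real fps" where
    "fps_const (2 powr (- g)) * fps_binomial g =
       1 - fps_const (g / 2) * (1 - fps_X) + (1 - fps_X)\<^sup>2 * r"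
    "\<And>n. (\<Sum>m\<le>n. \<bar>fps_nth r m\<bar>) \<le> 1"
proof -
  define x :: "real fps" where "x = fps_const (1 / 2) * (1 - fps_X)"
  define c where "c k n = fps_nth (x ^ k) n" for k n
  have c: "c k n = (- 1) ^ n * real (k choose n) / 2 ^ k" for k n
    unfolding c_def x_def by (rule half_one_minus_X_power_nth)
  define d where "d k = (g gchoose k) * (- 1) ^ k" for k
  have absd: "\<bar>d k\<bar> = \<bar>g gchoose k\<bar>" for k by (simp add: d_def abs_mult power_abs)
  have csum: "(\<Sum>n\<le>m. \<bar>c k n\<bar>) \<le> 1" for k m
  proof -
    have "(\<Sum>n\<le>m. \<bar>c k n\<bar>) = (\<Sum>n\<le>m. real (k choose n)) / 2 ^ k"
      unfolding c by (simp add: abs_mult power_abs sum_divide_distrib)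
    also have "(\<Sum>n\<le>m. real (k choose n)) \<le> (\<Sum>n\<le>max m k. real (k choose n))"
      by (intro sum_mono2) auto
    also have "\<dots> = (\<Sum>n\<le>k. real (k choose n))"
      by (intro sum.mono_neutral_right) (auto simp: binomial_eq_0)
    also have "\<dots> = 2 ^ k"
      using arg_cong[OF choose_row_sum[of k], of real] by simp
    finally show ?thesis by (simp add: divide_right_mono)
  qed
  have cle: "\<bar>c k n\<bar> \<le> 1" for k n
  proof -
    have "\<bar>c k n\<bar> \<le> (\<Sum>m\<le>n. \<bar>c k m\<bar>)" by (rule member_le_sum) auto
    then show ?thesis using csum[of k n] by linarith
  qed
  have sd: "summable (\<lambda>k. \<bar>d (k + 2)\<bar>)"
    unfolding absd using summable_ignore_initial_segment[OF summable_abs_gbinomial(1)[OF g], of 2] .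
  have sdc: "summable (\<lambda>k. \<bar>d (k + 2) * c k n\<bar>)" for n
  proof (rule summable_comparison_test'[OF sd])
    show "norm \<bar>d (k + 2) * c k n\<bar> \<le> \<bar>d (k + 2)\<bar>" for k
      using mult_left_le[OF cle[of k n], of "\<bar>d (k + 2)\<bar>"] by (simp only: abs_mult real_norm_def abs_abs abs_ge_zero)
  qed
  have sdc': "summable (\<lambda>k. d (k + 2) * c k n)" for n
    by (rule summable_rabs_cancel) (rule sdc)
  define r0 where "r0 = Abs_fps (\<lambda>n. \<Sum>k. d (k + 2) * c k n)"
  define r where "r = fps_const (1 / 4) * r0"
  have d2: "(\<Sum>k. \<bar>d (k + 2)\<bar>) \<le> 2"
  proof -
    have "(\<Sum>k. \<bar>d (k + 2)\<bar>) = (\<Sum>k. \<bar>d k\<bar>) - (\<Sum>k<2. \<bar>d k\<bar>)"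
      using suminf_split_initial_segment[of "\<lambda>k. \<bar>d k\<bar>" 2] summable_abs_gbinomial(1)[OF g] by (simp add: absd)
    also have "\<dots> \<le> (\<Sum>k. \<bar>d k\<bar>)" by (simp add: sum_nonneg)
    finally show ?thesis using summable_abs_gbinomial(2)[OF g] by (simp add: absd)
  qed
  show thesis
  proof (rule that)
    show "(\<Sum>m\<le>n. \<bar>fps_nth r m\<bar>) \<le> 1" for n
    proof -
      have "(\<Sum>m\<le>n. \<bar>fps_nth r0 m\<bar>) \<le> (\<Sum>m\<le>n. \<Sum>k. \<bar>d (k + 2) * c k m\<bar>)"
        unfolding r0_def by (intro sum_mono) (simp only: fps_nth_Abs_fps summable_rabs[OF sdc])
      also have "\<dots> = (\<Sum>k. \<Sum>m\<le>n. \<bar>d (k + 2) * c k m\<bar>)"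
        by (rule suminf_sum[symmetric]) (rule sdc)
      also have "\<dots> \<le> (\<Sum>k. \<bar>d (k + 2)\<bar>)"
      proof (rule suminf_le)
        show "(\<Sum>m\<le>n. \<bar>d (k + 2) * c k m\<bar>) \<le> \<bar>d (k + 2)\<bar>" for k
          using mult_left_mono[OF csum[of k n], of "\<bar>d (k + 2)\<bar>"]
          by (simp add: abs_mult sum_distrib_left)
        show "summable (\<lambda>k. \<Sum>m\<le>n. \<bar>d (k + 2) * c k m\<bar>)"
          by (intro summable_sum sdc)
      qed (rule sd)
      also have "\<dots> \<le> 2" by (rule d2)
      finally have "(\<Sum>m\<le>n. \<bar>fps_nth r0 m\<bar>) \<le> 2" .
      then show ?thesis by (simp add: r_def abs_mult flip: sum_divide_distrib)
    qed
    have "fps_const (2 powr (- g)) * fps_binomial g = 1 - fps_const g * x + x\<^sup>2 * r0"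
    proof (rule fps_ext)
      fix n
      have "(\<lambda>k. d k * c k n) sums (2 powr (- g) * (g gchoose n))"
        unfolding d_def c by (rule half_binomial_reexpansion)
      moreover have "(\<lambda>k. d k * c k n) sums (fps_nth (x\<^sup>2 * r0) n + (\<Sum>k<2. d k * c k n))"
      proof -
        have "(\<lambda>k. \<Sum>i=0..n. fps_nth (x\<^sup>2) i * (d (k + 2) * c k (n - i))) sums
            (\<Sum>i=0..n. fps_nth (x\<^sup>2) i * fps_nth r0 (n - i))"
          unfolding r0_def by (intro sums_sum sums_mult) (simp only: fps_nth_Abs_fps summable_sums[OF sdc'])
        moreover have "(\<Sum>i=0..n. fps_nth (x\<^sup>2) i * (d (k + 2) * c k (n - i))) = d (k + 2) * c (k + 2) n" for k
        proof -
          have "x ^ (k + 2) = x\<^sup>2 * x ^ k" by (simp only: power_add mult.commute)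
          then have "c (k + 2) n = (\<Sum>i=0..n. fps_nth (x\<^sup>2) i * c k (n - i))"
            by (simp only: c_def fps_mult_nth)
          then show ?thesis by (simp add: sum_distrib_left mult_ac)
        qed
        ultimately have "(\<lambda>k. d (k + 2) * c (k + 2) n) sums fps_nth (x\<^sup>2 * r0) n"
          by (simp only: fps_mult_nth)
        then show ?thesis
          using sums_iff_shift[of "\<lambda>k. d k * c k n" 2] by simp
      qed
      ultimately have "2 powr (- g) * (g gchoose n) = fps_nth (x\<^sup>2 * r0) n + (\<Sum>k<2. d k * c k n)"
        by (rule sums_unique2)
      moreover have "(\<Sum>k<2. d k * c k n) = fps_nth (1 - fps_const g * x) n"
        by (simp add: numeral_2_eq_2 d_def c_def)
      ultimately show "fps_nth (fps_const (2 powr (- g)) * fps_binomial g) n =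
          fps_nth (1 - fps_const g * x + x\<^sup>2 * r0) n" by simp
    qed
    also have "fps_const g * x = fps_const (g / 2) * (1 - fps_X)"
    proof -
      have "fps_const g * fps_const (1 / 2) = fps_const (g / 2)" by (simp add: fps_const_mult)
      then show ?thesis unfolding x_def by (simp only: mult.assoc[symmetric])
    qed
    also have "x\<^sup>2 * r0 = (1 - fps_X)\<^sup>2 * r"
    proof -
      have "x\<^sup>2 = fps_const (1 / 4) * (1 - fps_X)\<^sup>2"
        by (simp add: x_def power_mult_distrib fps_const_power power_one_over)
      then show ?thesis unfolding r_def by (simp only: mult_ac)
    qed
    finally show "fps_const (2 powr (- g)) * fps_binomial g =
       1 - fps_const (g / 2) * (1 - fps_X) + (1 - fps_X)\<^sup>2 * r" .
  qed
qed

lemma one_minus_pow_neg_asymptotic: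
  fixes g :: real
  assumes g: "0 < g"
  shows "(\<lambda>n. fps_nth (one_minus_pow (- g)) n * real (n + 1) powr (1 - g)) \<longlonglongrightarrow> 1 / Gamma g"
proof -
  have "(\<lambda>n. (- g gchoose n) / ((- 1) ^ n / exp ((- g + 1) * of_real (ln (real n))))) \<longlonglongrightarrow> inverse (Gamma (- (- g)))"
    by (rule gbinomial_asymptotic)
  then have L: "(\<lambda>n. (- g gchoose n) / ((- 1) ^ n / exp ((- g + 1) * ln (real n)))) \<longlonglongrightarrow> 1 / Gamma g"
    by (simp add: divide_inverse)
  have "(\<lambda>n. ((real n + 1) / real n) powr (1 - g)) \<longlonglongrightarrow> 1" by real_asymp
  from tendsto_mult[OF L this]
  have "(\<lambda>n. (- g gchoose n) / ((- 1) ^ n / exp ((- g + 1) * ln (real n))) * ((real n + 1) / real n) powr (1 - g))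
     \<longlonglongrightarrow> 1 / Gamma g" by simp
  moreover have "\<forall>\<^sub>F n in sequentially. (- g gchoose n) / ((- 1) ^ n / exp ((- g + 1) * ln (real n))) * ((real n + 1) / real n) powr (1 - g)
      = fps_nth (one_minus_pow (- g)) n * real (n + 1) powr (1 - g)"
  proof (rule eventually_sequentiallyI[of 1])
    fix n :: nat assume n: "1 \<le> n"
    have "exp ((- g + 1) * ln (real n)) = real n powr (1 - g)" using n by (simp add: powr_def)
    moreover have "x / ((- 1) ^ n / e) = (- 1) ^ n * x * e" for x e :: real
      by (cases "even n") auto
    ultimately show "(- g gchoose n) / ((- 1) ^ n / exp ((- g + 1) * ln (real n))) * ((real n + 1) / real n) powr (1 - g)
      = fps_nth (one_minus_pow (- g)) n * real (n + 1) powr (1 - g)"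
      using n by (simp add: one_minus_pow_nth powr_divide add.commute)
  qed
  ultimately show ?thesis by (rule Lim_transform_eventually)
qed

lemma convergent_seq_bounded:
  fixes X :: "nat \<Rightarrow> real"
  assumes "X \<longlonglongrightarrow> L"
  obtains C where "0 < C" "\<And>n. \<bar>X n\<bar> \<le> C"
  using Bseq_def convergent_imp_Bseq[OF convergentI[OF assms]] by (auto simp: Bseq_def)

lemma one_minus_pow_neg_bounds:
  fixes g :: real
  assumes g: "0 < g"
  obtains c C where "0 < c" "0 < C"
    "\<And>n. fps_nth (one_minus_pow (- g)) n \<le> C * real (n + 1) powr (g - 1)"
    "\<And>n. real (n + 1) powr (g - 1) \<le> c * fps_nth (one_minus_pow (- g)) n"
proof -
  define X where "X n = fps_nth (one_minus_pow (- g)) n * real (n + 1) powr (1 - g)" for n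
  have X: "X \<longlonglongrightarrow> 1 / Gamma g" unfolding X_def[abs_def] by (rule one_minus_pow_neg_asymptotic[OF g])
  have Xp: "X n > 0" for n unfolding X_def using one_minus_pow_neg_pos[OF g, of n] by simp
  have e: "fps_nth (one_minus_pow (- g)) n = X n * real (n + 1) powr (g - 1)" for n
    by (simp add: X_def mult.assoc flip: powr_add)
  have "1 / Gamma g \<noteq> 0" using Gamma_real_pos[OF g] by simp
  then have iX: "(\<lambda>n. inverse (X n)) \<longlonglongrightarrow> inverse (1 / Gamma g)" by (intro tendsto_inverse X)
  obtain C where C: "0 < C" "\<And>n. \<bar>X n\<bar> \<le> C" using convergent_seq_bounded[OF X] by blast
  obtain c where c: "0 < c" "\<And>n. \<bar>inverse (X n)\<bar> \<le> c" using convergent_seq_bounded[OF iX] by blast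
  show thesis
  proof (rule that[OF c(1) C(1)])
    fix n
    show "fps_nth (one_minus_pow (- g)) n \<le> C * real (n + 1) powr (g - 1)"
      unfolding e using C(2)[of n] by (intro mult_right_mono) auto
    have "1 = inverse (X n) * X n" using Xp[of n] by simp
    also have "\<dots> \<le> c * X n" using c(2)[of n] Xp[of n] by (intro mult_right_mono) auto
    finally have "1 * real (n + 1) powr (g - 1) \<le> (c * X n) * real (n + 1) powr (g - 1)"
      by (intro mult_right_mono) auto
    then show "real (n + 1) powr (g - 1) \<le> c * fps_nth (one_minus_pow (- g)) n"
      unfolding e by (simp add: mult.assoc)
  qed
qed

lemma one_minus_pow_neg_sum_bound:
  fixes g :: real
  assumes g: "0 < g"
  obtains C where "0 < C" "\<And>n. (\<Sum>m\<le>n. fps_nth (one_minus_pow (- g)) m) \<le> C * real (n + 1) powr g"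
proof -
  obtain C where C: "0 < C" "\<And>n. fps_nth (one_minus_pow (- (g + 1))) n \<le> C * real (n + 1) powr (g + 1 - 1)"
    using one_minus_pow_neg_bounds[of "g + 1"] g by (metis add_pos_pos zero_less_one)
  have "(\<Sum>m\<le>n. fps_nth (one_minus_pow (- g)) m) \<le> C * real (n + 1) powr g" for n
    using C(2)[of n] by (simp add: one_minus_pow_partial_sums)
  then show thesis using that C(1) by blast
qed

text \<open>As ln R tends to 0, it is minus the sum of its later increments, and a tail of the
  sum of the cubic inverses is of the order of the inverse square.\<close>

lemma limit_rate_of_ln_increments:
  fixes R :: "nat \<Rightarrow> real"
  assumes R: "R \<longlonglongrightarrow> 1" and pos: "\<And>n. R n > 0"
    and d: "(\<lambda>n. ln (R (Suc n)) - ln (R n)) \<in> O(\<lambda>n. 1 / real (n + 1) ^ 3)"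
  obtains C where "0 < C" "\<And>n. \<bar>R n - 1\<bar> \<le> C / (real n + 1)\<^sup>2"
proof -
  obtain B where B: "0 < B" "\<And>n. \<bar>R n\<bar> \<le> B" using convergent_seq_bounded[OF R] by blast
  define L where "L n = ln (R n)" for n
  have L0: "L \<longlonglongrightarrow> 0" using tendsto_ln[OF R] by (simp add: L_def[abs_def])
  from d have "(\<lambda>n. (L (Suc n) - L n) * real (n + 1) ^ 3) \<in> O(\<lambda>n. 1 / real (n + 1) ^ 3 * real (n + 1) ^ 3)"
    unfolding L_def by (rule landau_o.big.mult_right)
  also have "(\<lambda>n. 1 / real (n + 1) ^ 3 * real (n + 1) ^ 3) = (\<lambda>n. 1)" by (simp add: add_eq_0_iff)
  finally have "Bseq (\<lambda>n. (L (Suc n) - L n) * real (n + 1) ^ 3)"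
    by (simp add: bigo_def Bfun_def eventually_sequentially)
  then obtain D where D: "0 < D" "\<And>n. \<bar>(L (Suc n) - L n) * real (n + 1) ^ 3\<bar> \<le> D"
    by (auto simp: Bseq_def)
  define K where "K = 2 * D"
  have K: "K > 0" using D by (simp add: K_def)
  define q where "q n = K / (real n + 1)\<^sup>2" for n
  have step: "\<bar>L (Suc n) - L n\<bar> \<le> q n - q (Suc n)" for n
  proof -
    let ?x = "real n + 1"
    have x: "?x > 0" by simp
    have "\<bar>L (Suc n) - L n\<bar> * ?x ^ 3 \<le> D" using D(2)[of n] by (simp add: abs_mult add.commute)
    then have "\<bar>L (Suc n) - L n\<bar> \<le> D / ?x ^ 3" using x by (simp add: pos_le_divide_eq)
    also have "\<dots> = K * (1 / (2 * ?x ^ 3))" by (simp add: K_def)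
    (* The cubic bound telescopes: 1/x^2 - 1/(x + 1)^2 is at least 1/(2 x^3) for x at least 1.
       *)
    also have "\<dots> \<le> K * (1 / ?x\<^sup>2 - 1 / (?x + 1)\<^sup>2)"
    proof (rule mult_left_mono)
      have "1 / ?x\<^sup>2 - 1 / (?x + 1)\<^sup>2 - 1 / (2 * ?x ^ 3) = (3 * ?x\<^sup>2 - 1) / (2 * ?x ^ 3 * (?x + 1)\<^sup>2)"
        using x by (simp add: divide_simps) (simp add: power2_eq_square power3_eq_cube algebra_simps)
      also have "\<dots> \<ge> 0"
      proof (rule divide_nonneg_pos)
        have "1 \<le> ?x\<^sup>2" by (intro one_le_power) simp
        then show "0 \<le> 3 * ?x\<^sup>2 - 1" by linarith
      qed (use x in auto)
      finally show "1 / (2 * ?x ^ 3) \<le> 1 / ?x\<^sup>2 - 1 / (?x + 1)\<^sup>2" by simp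
    qed (use K in auto)
    also have "\<dots> = q n - q (Suc n)" by (simp add: q_def right_diff_distrib add_ac)
    finally show ?thesis .
  qed
  have q0: "q \<longlonglongrightarrow> 0" unfolding q_def[abs_def] by real_asymp
  have "decseq (\<lambda>n. L n + q n)"
  proof (rule decseq_SucI)
    show "L (Suc n) + q (Suc n) \<le> L n + q n" for n using step[of n] by linarith
  qed
  then have up: "0 \<le> L n + q n" for n
    using tendsto_add[OF L0 q0] by (intro decseq_ge) auto
  have "incseq (\<lambda>n. L n - q n)"
  proof (rule incseq_SucI)
    show "L n - q n \<le> L (Suc n) - q (Suc n)" for n using step[of n] by linarith
  qed
  then have lo: "L n - q n \<le> 0" for n
    using tendsto_diff[OF L0 q0] by (intro incseq_le) auto
  show thesis
  proof (rule that[of "(B + 1) * K"])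
    show "0 < (B + 1) * K" using B K by simp
    fix n
    have Rn: "R n = exp (L n)" using pos[of n] by (simp add: L_def)
    have "R n * exp (- L n) = 1" by (simp add: Rn exp_minus)
    moreover have "R n * (1 - L n) \<le> R n * exp (- L n)"
      using exp_ge_add_one_self[of "- L n"] pos[of n] by (intro mult_left_mono) auto
    ultimately have "R n - 1 \<le> R n * L n" by (simp add: right_diff_distrib)
    also have "\<dots> \<le> R n * \<bar>L n\<bar>" using pos[of n] by (intro mult_left_mono) auto
    also have "\<dots> \<le> B * \<bar>L n\<bar>" using B(2)[of n] by (intro mult_right_mono) auto
    also have "\<dots> \<le> (B + 1) * \<bar>L n\<bar>" by (simp add: distrib_right)
    finally have 1: "R n - 1 \<le> (B + 1) * \<bar>L n\<bar>" .
    have "- \<bar>L n\<bar> \<le> R n - 1" unfolding Rn using exp_ge_add_one_self[of "L n"] by linarith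
    moreover have "0 \<le> B * \<bar>L n\<bar>" using B by simp
    ultimately have "\<bar>R n - 1\<bar> \<le> (B + 1) * \<bar>L n\<bar>" using 1 by (simp add: abs_le_iff distrib_right)
    also have "\<dots> \<le> (B + 1) * q n" using up[of n] lo[of n] B by (intro mult_left_mono) auto
    finally show "\<bar>R n - 1\<bar> \<le> (B + 1) * K / (real n + 1)\<^sup>2" by (simp add: q_def)
  qed
qed

text \<open>Substitution of c/(n + 1) into an expansion of ln (1 + x), which has no
  parameter.\<close>

lemma ln_one_plus_third_order:
  fixes c :: real
  assumes "0 < c"
  shows "(\<lambda>n. ln (1 + c / (real n + 1)) - c / (real n + 1) + (c / (real n + 1))\<^sup>2 / 2)
    \<in> O(\<lambda>n. 1 / real (n + 1) ^ 3)"
proof -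
  have 1: "(\<lambda>x::real. ln (1 + x) - x + x\<^sup>2 / 2) \<in> O[at_right 0](\<lambda>x. x ^ 3)" by real_asymp
  have 2: "filterlim (\<lambda>n. c / (real n + 1)) (at_right 0) sequentially" using assms by real_asymp
  have "(\<lambda>n. ln (1 + c / (real n + 1)) - c / (real n + 1) + (c / (real n + 1))\<^sup>2 / 2) \<in> O(\<lambda>n. (c / (real n + 1)) ^ 3)"
    by (rule landau_o.big.compose[OF 1 2])
  also have "(\<lambda>n. (c / (real n + 1)) ^ 3) \<in> O(\<lambda>n. 1 / real (n + 1) ^ 3)"
    by (rule bigoI[of _ "\<bar>c\<bar> ^ 3"]) (simp add: power_divide power_abs abs_mult add.commute)
  finally show ?thesis .
qed

text \<open>The left-hand series is (1 - X)^(-g-2) (1 - (g/2)(1 - X)), the linearised kernel of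
  the quadrature rule applied to second differences; (n + 1)^(g+1)/\<Gamma>(g + 2) is the kernel
  of the integral itself. Each binomial coefficient alone agrees with its leading power only to
  first order; the correction with factor g/2 removes the next term, so that the relative
  difference R - 1 is of order n^(-2). That makes the absolute difference of order n^(g-1),
  which is the order of the coefficients of (1 - X)^(-g).\<close>

lemma main_part_asymptotic:
  fixes g :: real
  assumes g: "0 < g" "g < 1"
  obtains C where "0 < C"
    "\<And>n. \<bar>fps_nth (one_minus_pow (- (g + 2)) - fps_const (g / 2) * one_minus_pow (- (g + 1))) n
        - real (n + 1) powr (g + 1) / Gamma (g + 2)\<bar> \<le> C * fps_nth (one_minus_pow (- g)) n"
proof -
  define a where "a n = fps_nth (one_minus_pow (- g)) n" for n
  have ap: "a n > 0" for n unfolding a_def using one_minus_pow_neg_pos g by blast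
  define kk where "kk = g * (g + 1) / 2"
  have kk: "kk < 1" "0 < kk"
  proof -
    have "g * (g + 1) < 1 * 2" using g by (intro mult_strict_mono) auto
    then show "kk < 1" by (simp add: kk_def)
    show "0 < kk" using g by (simp add: kk_def)
  qed
  define H where "H n = a n * (real n + g) * (real n + 1 + g - kk) / (g * (g + 1))" for n
  have H: "fps_nth (one_minus_pow (- (g + 2)) - fps_const (g / 2) * one_minus_pow (- (g + 1))) n = H n" for n
  proof -
    have 1: "fps_nth (one_minus_pow (- (g + 1))) n = a n * (real n + g) / g"
      using one_minus_pow_raise[of g n] g by (simp add: a_def)
    have "fps_nth (one_minus_pow (- (g + 1 + 1))) n = fps_nth (one_minus_pow (- (g + 1))) n * (real n + (g + 1)) / (g + 1)"
      using one_minus_pow_raise[of "g + 1" n] g by simp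
    moreover have "g + 1 + 1 = g + 2" by simp
    ultimately have 2: "fps_nth (one_minus_pow (- (g + 2))) n = a n * (real n + g) / g * (real n + (g + 1)) / (g + 1)"
      using 1 by simp
    have "g \<noteq> 0" "g + 1 \<noteq> 0" using g by auto
    then show ?thesis
      unfolding H_def kk_def fps_sub_nth fps_mult_left_const_nth 1 2
      by (simp add: divide_simps) (simp add: algebra_simps)
  qed
  (* R is the quotient of the two kernels. *)
  define R where "R n = H n * Gamma (g + 2) / real (n + 1) powr (g + 1)" for n
  have G2: "Gamma (g + 2) = g * (g + 1) * Gamma g"
  proof -
    have "Gamma (g + 1) = g * Gamma g" "Gamma (g + 1 + 1) = (g + 1) * Gamma (g + 1)"
      by (rule Gamma_plus1; use g in \<open>auto elim!: nonpos_Ints_cases\<close>)+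
    moreover have "g + 1 + 1 = g + 2" by simp
    ultimately show ?thesis by simp
  qed
  have Gp: "Gamma g > 0" "Gamma (g + 2) > 0" using g by (auto intro: Gamma_real_pos)
  have Hp: "H n > 0" for n
    unfolding H_def using ap[of n] g kk by (intro divide_pos_pos mult_pos_pos) auto
  have Rp: "R n > 0" for n unfolding R_def using Hp[of n] Gp by simp
  have lim: "R \<longlonglongrightarrow> 1"
  proof -
    have R_eq: "R n = (a n * real (n + 1) powr (1 - g)) * Gamma g *
      ((real n + g) * (real n + 1 + g - kk) / (real n + 1)\<^sup>2)" for n
    proof -
      have "real (n + 1) powr (g + 1) = real (n + 1) powr (g - 1) * (real n + 1)\<^sup>2"
        using powr_add[of "real (n + 1)" "g - 1" 2] by (simp add: powr_numeral add_ac)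
      moreover have "real (n + 1) powr (1 - g) = 1 / real (n + 1) powr (g - 1)"
        using powr_minus_divide[of "real (n + 1)" "g - 1"] by simp
      moreover have "g * (g + 1) \<noteq> 0" using g by simp
      ultimately show ?thesis unfolding R_def H_def G2
        by (simp add: divide_simps)
    qed
    have "(\<lambda>n. a n * real (n + 1) powr (1 - g)) \<longlonglongrightarrow> 1 / Gamma g"
      unfolding a_def by (rule one_minus_pow_neg_asymptotic[OF g(1)])
    moreover have "(\<lambda>n. (real n + g) * (real n + 1 + g - kk) / (real n + 1)\<^sup>2) \<longlonglongrightarrow> 1"
      by real_asymp
    ultimately have "(\<lambda>n. (a n * real (n + 1) powr (1 - g)) * Gamma g *
      ((real n + g) * (real n + 1 + g - kk) / (real n + 1)\<^sup>2)) \<longlonglongrightarrow> 1 / Gamma g * Gamma g * 1"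
      by (intro tendsto_mult tendsto_const)
    then show ?thesis using Gp unfolding R_eq[abs_def] by simp
  qed
  have ratio: "(\<lambda>n. ln (R (Suc n)) - ln (R n)) \<in> O(\<lambda>n. 1 / real (n + 1) ^ 3)"
  proof -
    define l where "l c n = ln (1 + c / (real n + 1))" for c :: real and n :: nat
    define d where "d c n = l c n - c / (real n + 1) + (c / (real n + 1))\<^sup>2 / 2" for c n
    have gk: "g - kk > 0"
    proof -
      have "g - kk = g * (1 - g) / 2" by (simp add: kk_def algebra_simps)
      moreover have "0 < g * (1 - g)" using g by simp
      ultimately show ?thesis by linarith
    qed
    then have gk1: "1 + g - kk > 0" by simp
    have "ln (R (Suc n)) - ln (R n) = d g n - (g + 1) * d 1 n + d (1 + g - kk) n - d (g - kk) n" for n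
    proof -
      let ?x = "real n + 1"
      have x: "?x > 0" by simp
      have rec: "a (Suc n) = a n * (real n + g) / ?x"
        unfolding a_def one_minus_pow_neg_nth by (simp add: pochhammer_Suc field_simps)
      have lc: "l c n = ln (?x + c) - ln ?x" if "c > 0" for c
      proof -
        have "1 + c / ?x = (?x + c) / ?x" using x by (simp add: field_simps)
        then show ?thesis unfolding l_def using x that by (simp add: ln_div)
      qed
      have p: "real n + g > 0" "?x + g > 0" "?x + (g - kk) > 0" "?x + (1 + g - kk) > 0" "?x + 1 > 0"
        "g * (g + 1) > 0" "a n > 0" using g gk ap[of n] by auto
      have ln_quot: "ln (A * B * C / D * G / P powr e) = ln A + ln B + ln C - ln D + ln G - e * ln P"
        if "A > 0" "B > 0" "C > 0" "D > 0" "G > 0" "P > 0" for A B C D G P e :: real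
        using that by (simp add: ln_div ln_mult ln_powr)
      have "ln (R n) = ln (a n) + ln (real n + g) + ln (?x + g - kk) - ln (g * (g + 1)) + ln (Gamma (g + 2)) - (g + 1) * ln (real (n + 1))"
        unfolding R_def H_def using p Gp(2) by (intro ln_quot) auto
      moreover have "ln (R (Suc n)) = ln (a (Suc n)) + ln (real (Suc n) + g) + ln (real (Suc n) + 1 + g - kk) - ln (g * (g + 1))
          + ln (Gamma (g + 2)) - (g + 1) * ln (real (Suc n + 1))"
        unfolding R_def H_def using p Gp(2) ap[of "Suc n"] by (intro ln_quot) auto
      moreover have "ln (a (Suc n)) = ln (a n) + ln (real n + g) - ln ?x"
        unfolding rec using p x by (simp add: ln_div ln_mult)
      ultimately have "ln (R (Suc n)) - ln (R n) = l g n - (g + 1) * l 1 n + l (1 + g - kk) n - l (g - kk) n"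
        unfolding lc[OF g(1)] lc[OF zero_less_one] lc[OF gk] lc[OF gk1]
        by (simp add: algebra_simps)
      (* The terms of first order cancel because both kernels grow like n^(g+1), those of second
         order by the choice of the factor g / 2, that is of kk. *)
      moreover have "g / ?x - (g + 1) * (1 / ?x) + (1 + g - kk) / ?x - (g - kk) / ?x = 0"
        by (simp add: divide_inverse algebra_simps)
      moreover have "(g / ?x)\<^sup>2 / 2 - (g + 1) * ((1 / ?x)\<^sup>2 / 2) + ((1 + g - kk) / ?x)\<^sup>2 / 2 - ((g - kk) / ?x)\<^sup>2 / 2 = 0"
      proof -
        have "g\<^sup>2 - (g + 1) + (1 + g - kk)\<^sup>2 - (g - kk)\<^sup>2 = 0"
          by (simp add: kk_def power2_eq_square algebra_simps)
        then have "(g\<^sup>2 - (g + 1) + (1 + g - kk)\<^sup>2 - (g - kk)\<^sup>2) / (2 * ?x\<^sup>2) = 0" by simp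
        then show ?thesis unfolding power_divide by (simp add: add_divide_distrib diff_divide_distrib)
      qed
      ultimately show ?thesis unfolding d_def by (simp add: algebra_simps)
    qed
    moreover have "(\<lambda>n. d g n - (g + 1) * d 1 n + d (1 + g - kk) n - d (g - kk) n) \<in> O(\<lambda>n. 1 / real (n + 1) ^ 3)"
    proof -
      have D: "(\<lambda>n. d c n) \<in> O(\<lambda>n. 1 / real (n + 1) ^ 3)" if "c > 0" for c
        unfolding d_def l_def by (rule ln_one_plus_third_order[OF that])
      have D1: "(\<lambda>n. (g + 1) * d 1 n) \<in> O(\<lambda>n. 1 / real (n + 1) ^ 3)"
        by (rule landau_o.big.cmult_in_iff[THEN iffD2]) (use g D[of 1] in auto)
      show ?thesis
        by (intro sum_in_bigo D D1) (use g gk in auto)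
    qed
    ultimately show ?thesis by simp
  qed
  obtain C where C: "0 < C" "\<And>n. \<bar>R n - 1\<bar> \<le> C / (real n + 1)\<^sup>2"
    using limit_rate_of_ln_increments[OF lim Rp ratio] by blast
  obtain c where c: "0 < c" "\<And>n. real (n + 1) powr (g - 1) \<le> c * a n"
    unfolding a_def using one_minus_pow_neg_bounds[OF g(1)] by metis
  show thesis
  proof (rule that[of "C * c / Gamma (g + 2)"])
    show "0 < C * c / Gamma (g + 2)" using C c Gp by simp
    fix n
    have p: "real (n + 1) powr (g + 1) = real (n + 1) powr (g - 1) * (real n + 1)\<^sup>2"
      using powr_add[of "real (n + 1)" "g - 1" 2] by (simp add: powr_numeral add_ac)
    have "H n - real (n + 1) powr (g + 1) / Gamma (g + 2) = real (n + 1) powr (g + 1) / Gamma (g + 2) * (R n - 1)"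
      unfolding R_def using Gp by (simp add: field_simps)
    then have "\<bar>H n - real (n + 1) powr (g + 1) / Gamma (g + 2)\<bar> = real (n + 1) powr (g + 1) / Gamma (g + 2) * \<bar>R n - 1\<bar>"
      using Gp by (simp add: abs_mult)
    also have "\<dots> \<le> real (n + 1) powr (g + 1) / Gamma (g + 2) * (C / (real n + 1)\<^sup>2)"
      using C(2)[of n] Gp by (intro mult_left_mono) auto
    also have "\<dots> = C / Gamma (g + 2) * real (n + 1) powr (g - 1)"
      unfolding p by (simp add: field_simps)
    also have "\<dots> \<le> C / Gamma (g + 2) * (c * a n)"
      using c(2)[of n] C Gp by (intro mult_left_mono) auto
    finally show "\<bar>fps_nth (one_minus_pow (- (g + 2)) - fps_const (g / 2) * one_minus_pow (- (g + 1))) n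
        - real (n + 1) powr (g + 1) / Gamma (g + 2)\<bar> \<le> C * c / Gamma (g + 2) * fps_nth (one_minus_pow (- g)) n"
      unfolding H by (simp add: a_def)
  qed
qed

lemma fps_mult_abs_partial_sums:
  fixes f g :: "real fps"
  shows "(\<Sum>m\<le>n. \<bar>fps_nth (f * g) m\<bar>) \<le> (\<Sum>m\<le>n. \<bar>fps_nth f m\<bar>) * (\<Sum>m\<le>n. \<bar>fps_nth g m\<bar>)"
proof -
  have "(\<Sum>m\<le>n. \<bar>fps_nth (f * g) m\<bar>) \<le> (\<Sum>m\<le>n. \<Sum>i\<le>m. \<bar>fps_nth f i\<bar> * \<bar>fps_nth g (m - i)\<bar>)"
    unfolding fps_mult_nth atLeast0AtMost by (intro sum_mono order_trans[OF sum_abs]) (simp add: abs_mult)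
  also have "\<dots> = (\<Sum>(i, j)\<in>{(i, j). i + j \<le> n}. \<bar>fps_nth f i\<bar> * \<bar>fps_nth g j\<bar>)"
    by (rule sum.triangle_reindex_eq[symmetric])
  also have "\<dots> \<le> (\<Sum>(i, j)\<in>{..n} \<times> {..n}. \<bar>fps_nth f i\<bar> * \<bar>fps_nth g j\<bar>)"
    by (intro sum_mono2) auto
  also have "\<dots> = (\<Sum>m\<le>n. \<bar>fps_nth f m\<bar>) * (\<Sum>m\<le>n. \<bar>fps_nth g m\<bar>)"
    by (simp add: sum_product sum.cartesian_product)
  finally show ?thesis .
qed

lemma fps_mult_nth_bound:
  fixes f g :: "real fps"
  assumes "\<And>k. k \<le> n \<Longrightarrow> \<bar>fps_nth g k\<bar> \<le> B"
  shows "\<bar>fps_nth (f * g) n\<bar> \<le> (\<Sum>m\<le>n. \<bar>fps_nth f m\<bar>) * B"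
proof -
  have "\<bar>fps_nth (f * g) n\<bar> \<le> (\<Sum>m\<le>n. \<bar>fps_nth f m * fps_nth g (n - m)\<bar>)"
    unfolding fps_mult_nth atLeast0AtMost by (rule sum_abs)
  also have "\<dots> \<le> (\<Sum>m\<le>n. \<bar>fps_nth f m\<bar> * B)"
    by (intro sum_mono) (simp add: abs_mult assms mult_left_mono)
  finally show ?thesis by (simp add: sum_distrib_right)
qed

text \<open>Two factors 1 - X are set free for taking second differences; the kernel left over
  is that of main_part_asymptotic plus (1 - X)^(-g) r, in which r has absolutely summable
  coefficients whenever it comes from half_one_plus_pow_remainder.\<close>

lemma trapez_fps_split:
  fixes g :: real
  assumes r: "fps_const (2 powr (- g)) * fps_binomial g =
      1 - fps_const (g / 2) * (1 - fps_X) + (1 - fps_X)\<^sup>2 * r"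
  shows "fps_const (2 powr (- g)) * trapez_fps g =
    ((one_minus_pow (- (g + 2)) - fps_const (g / 2) * one_minus_pow (- (g + 1)))
      + one_minus_pow (- g) * r) * (1 - fps_X)\<^sup>2"
proof -
  have e1: "one_minus_pow (- (g + 1)) * (1 - fps_X) = one_minus_pow (- g)"
    using one_minus_pow_add[of "- (g + 1)" 1] by (simp add: one_minus_pow_1)
  have "one_minus_pow (- (g + 2)) * (1 - fps_X) = one_minus_pow (- (g + 1))"
  proof -
    have "- (g + 1) = - (g + 2) + 1" by simp
    then show ?thesis by (metis one_minus_pow_add one_minus_pow_1)
  qed
  with e1 have e2: "one_minus_pow (- (g + 2)) * (1 - fps_X)\<^sup>2 = one_minus_pow (- g)"
    by (simp only: power2_eq_square mult.assoc[symmetric])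
  have "fps_const (2 powr (- g)) * trapez_fps g =
      one_minus_pow (- g) * (1 - fps_const (g / 2) * (1 - fps_X) + (1 - fps_X)\<^sup>2 * r)"
    unfolding trapez_fps_def r[symmetric] by (simp only: mult_ac)
  also have "\<dots> = one_minus_pow (- (g + 2)) * (1 - fps_X)\<^sup>2
      - fps_const (g / 2) * (one_minus_pow (- (g + 1)) * (1 - fps_X)) * (1 - fps_X)
      + one_minus_pow (- g) * r * (1 - fps_X)\<^sup>2"
    unfolding e1 e2 by (simp add: algebra_simps)
  finally show ?thesis by (simp add: algebra_simps power2_eq_square)
qed

lemma trapez_abs_sum_bound:
  fixes g :: real
  assumes g: "0 < g" "g < 1"
  obtains C where "0 < C" "\<And>n. (\<Sum>m\<le>n. \<bar>fps_nth (trapez_fps g) m\<bar>) \<le> C * real (n + 1) powr g"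
proof -
  obtain C where C: "0 < C" "\<And>n. (\<Sum>m\<le>n. fps_nth (one_minus_pow (- g)) m) \<le> C * real (n + 1) powr g"
    using one_minus_pow_neg_sum_bound[OF g(1)] by blast
  have "(\<Sum>m\<le>n. \<bar>fps_nth (trapez_fps g) m\<bar>) \<le> (2 * C) * real (n + 1) powr g" for n
  proof -
    have "(\<Sum>m\<le>n. \<bar>fps_nth (trapez_fps g) m\<bar>) \<le> (\<Sum>m\<le>n. \<bar>g gchoose m\<bar>) * (\<Sum>m\<le>n. \<bar>fps_nth (one_minus_pow (- g)) m\<bar>)"
      using fps_mult_abs_partial_sums[of "fps_binomial g" "one_minus_pow (- g)" n] by (simp add: trapez_fps_def)
    also have "(\<Sum>m\<le>n. \<bar>fps_nth (one_minus_pow (- g)) m\<bar>) = (\<Sum>m\<le>n. fps_nth (one_minus_pow (- g)) m)"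
      using one_minus_pow_neg_pos[OF g(1)] by (intro sum.cong refl) (simp add: less_imp_le)
    also have "(\<Sum>m\<le>n. \<bar>g gchoose m\<bar>) * (\<Sum>m\<le>n. fps_nth (one_minus_pow (- g)) m) \<le> 2 * (C * real (n + 1) powr g)"
      using one_minus_pow_neg_pos[OF g(1)]
      by (intro mult_mono abs_gbinomial_partial_sums g C sum_nonneg) (auto intro: less_imp_le)
    finally show ?thesis by simp
  qed
  then show thesis using that[of "2 * C"] C(1) by simp
qed

section \<open>Accuracy of the fractional trapezoidal rule\<close>

lemma lipschitz_of_derivative_bound:
  fixes f :: "real \<Rightarrow> real"
  assumes "\<And>x. x \<in> {0..T} \<Longrightarrow> (f has_real_derivative f1 x) (at x within {0..T})"
    and "\<And>x. x \<in> {0..T} \<Longrightarrow> \<bar>f1 x\<bar> \<le> K" and "x \<in> {0..T}" "y \<in> {0..T}"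
  shows "\<bar>f x - f y\<bar> \<le> K * \<bar>x - y\<bar>"
  using field_differentiable_bound[of "{0..T}" f f1 K x y] assms by auto

text \<open>By the mean value theorem both slopes are values of the derivative.\<close>

lemma secant_error:
  fixes f :: "real \<Rightarrow> real"
  assumes d: "\<And>x. x \<in> {0..T} \<Longrightarrow> (f has_real_derivative f1 x) (at x within {0..T})"
    and lip: "\<And>x y. x \<in> {0..T} \<Longrightarrow> y \<in> {0..T} \<Longrightarrow> \<bar>f1 x - f1 y\<bar> \<le> K * \<bar>x - y\<bar>"
    and K: "0 \<le> K" and cd: "0 \<le> c" "c < d" "d \<le> T" and s: "c \<le> s" "s \<le> d"
  shows "\<bar>f s - (f c + (s - c) / (d - c) * (f d - f c))\<bar> \<le> K * (d - c)\<^sup>2"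
proof -
  have mvt: "\<exists>\<xi>\<in>{c..e}. f e - f c = f1 \<xi> * (e - c)" if e: "c \<le> e" "e \<le> d" for e
  proof (rule mvt_very_simple)
    show "(f has_derivative (*) (f1 x)) (at x within {c..e})" if "c \<le> x" "x \<le> e" for x
    proof -
      have "(f has_derivative (*) (f1 x)) (at x within {0..T})"
        using d[of x] that e cd by (simp add: has_field_derivative_def)
      then show ?thesis by (rule has_derivative_subset) (use e cd in auto)
    qed
  qed (rule e)
  obtain x where x: "x \<in> {c..s}" "f s - f c = f1 x * (s - c)" using mvt[OF s] by blast
  obtain y where y: "y \<in> {c..d}" "f d - f c = f1 y * (d - c)" using mvt[of d] cd by auto
  have "f s - (f c + (s - c) / (d - c) * (f d - f c)) = (f1 x - f1 y) * (s - c)"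
  proof -
    have "(s - c) / (d - c) * (f d - f c) = f1 y * (s - c)" using y(2) cd by simp
    then show ?thesis using x(2) by (simp add: algebra_simps)
  qed
  also have "\<bar>\<dots>\<bar> = \<bar>f1 x - f1 y\<bar> * (s - c)" using s by (simp add: abs_mult)
  also have "\<dots> \<le> (K * (d - c)) * (d - c)"
  proof (rule mult_mono)
    have "\<bar>f1 x - f1 y\<bar> \<le> K * \<bar>x - y\<bar>" using x(1) y(1) cd s by (intro lip) auto
    also have "\<dots> \<le> K * (d - c)" using x(1) y(1) s K by (intro mult_left_mono) auto
    finally show "\<bar>f1 x - f1 y\<bar> \<le> K * (d - c)" .
  qed (use s K cd in auto)
  finally show ?thesis by (simp add: power2_eq_square mult.assoc)
qed

lemma trapezoid_error:
  fixes f :: "real \<Rightarrow> real"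
  assumes d: "\<And>x. x \<in> {0..T} \<Longrightarrow> (f has_real_derivative f1 x) (at x within {0..T})"
    and lip: "\<And>x y. x \<in> {0..T} \<Longrightarrow> y \<in> {0..T} \<Longrightarrow> \<bar>f1 x - f1 y\<bar> \<le> K * \<bar>x - y\<bar>"
    and K: "0 \<le> K" and cd: "0 \<le> c" "c < d" "d \<le> T"
  shows "\<bar>integral {c..d} f - (d - c) / 2 * (f c + f d)\<bar> \<le> K * (d - c) ^ 3"
proof -
  define l where "l s = f c + (s - c) / (d - c) * (f d - f c)" for s
  have "continuous_on {0..T} f" by (rule DERIV_continuous_on) (rule d)
  then have "continuous_on {c..d} f" by (rule continuous_on_subset) (use cd in auto)
  then have fi: "(f has_integral integral {c..d} f) {c..d}"
    by (intro integrable_integral integrable_continuous_interval)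
  define q where "q = (f d - f c) / (d - c)"
  have lq: "l s = f c + (s - c) * q" for s by (simp add: l_def q_def)
  define P where "P s = f c * s + (s - c)\<^sup>2 * (q / 2)" for s
  have "(l has_integral (P d - P c)) {c..d}"
  proof (rule fundamental_theorem_of_calculus)
    show "(P has_vector_derivative l s) (at s within {c..d})" if "s \<in> {c..d}" for s
    proof -
      have "(P has_real_derivative f c + 2 * (s - c) * (q / 2)) (at s within {c..d})"
        unfolding P_def by (auto intro!: derivative_eq_intros)
      moreover have "f c + 2 * (s - c) * (q / 2) = l s" by (simp add: lq field_simps)
      ultimately show ?thesis by (simp only: has_real_derivative_iff_has_vector_derivative)
    qed
  qed (use cd in simp)
  moreover have "P d - P c = (d - c) / 2 * (f c + f d)"
    using cd by (simp add: P_def q_def power2_eq_square field_simps)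
  ultimately have li: "(l has_integral (d - c) / 2 * (f c + f d)) {c..d}" by simp
  have "norm (integral {c..d} f - (d - c) / 2 * (f c + f d)) \<le> K * (d - c)\<^sup>2 * measure lborel (cbox c d)"
  proof (rule has_integral_bound)
    show "((\<lambda>s. f s - l s) has_integral integral {c..d} f - (d - c) / 2 * (f c + f d)) (cbox c d)"
      using has_integral_diff[OF fi li] by simp
    show "norm (f s - l s) \<le> K * (d - c)\<^sup>2" if "s \<in> cbox c d" for s
      unfolding l_def real_norm_def using that cd
      by (intro secant_error[OF d lip K]) auto
  qed (use K in auto)
  then show ?thesis using cd by (simp add: power3_eq_cube power2_eq_square mult_ac)
qed

text \<open>The sequence is continued by 0 to negative indices.\<close>

lemma second_difference_nth:
  fixes Y :: "real fps"
  shows "fps_nth ((1 - fps_X)\<^sup>2 * Y) n =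
    fps_nth Y n - (if n = 0 then 0 else 2 * fps_nth Y (n - 1)) + (if n < 2 then 0 else fps_nth Y (n - 2))"
proof -
  have "(1 - fps_X)\<^sup>2 * Y = Y - fps_const 2 * (fps_X * Y) + fps_X * (fps_X * Y)"
    by (simp add: power2_eq_square algebra_simps numeral_fps_const[symmetric])
  then show ?thesis by (cases n; cases "n - 1") (auto simp: fps_X_mult_nth)
qed

text \<open>A sum of ramps whose slopes jump by the second differences is the piecewise linear
  interpolant; here at the point i + \<sigma> of the grid with unit step.\<close>

lemma ramp_sum_interpolates:
  fixes y :: "nat \<Rightarrow> real"
  assumes "y 0 = 0"
  shows "(\<Sum>k\<le>Suc i. fps_nth ((1 - fps_X)\<^sup>2 * Abs_fps y) k * (real i + \<sigma> + 1 - real k)) = y i + \<sigma> * (y (Suc i) - y i)"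
proof (induction i arbitrary: \<sigma>)
  case 0
  then show ?case using assms by (simp add: second_difference_nth)
next
  case (Suc i)
  have "(\<Sum>k\<le>Suc (Suc i). fps_nth ((1 - fps_X)\<^sup>2 * Abs_fps y) k * (real (Suc i) + \<sigma> + 1 - real k)) =
      (\<Sum>k\<le>Suc i. fps_nth ((1 - fps_X)\<^sup>2 * Abs_fps y) k * (real i + (\<sigma> + 1) + 1 - real k))
      + fps_nth ((1 - fps_X)\<^sup>2 * Abs_fps y) (Suc (Suc i)) * \<sigma>"
    by (simp add: add_ac)
  also have "\<dots> = y i + (\<sigma> + 1) * (y (Suc i) - y i) + (y (Suc (Suc i)) - 2 * y (Suc i) + y i) * \<sigma>"
    unfolding Suc.IH by (simp add: second_difference_nth)
  also have "\<dots> = y (Suc i) + \<sigma> * (y (Suc (Suc i)) - y (Suc i))" by (simp add: algebra_simps)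
  finally show ?case .
qed

text \<open>The continuation by 0 to negative times does no harm because y and its derivative
  vanish at 0: it is still continuously differentiable with Lipschitz derivative.\<close>

lemma smooth_second_difference_bound:
  fixes y :: "real \<Rightarrow> real"
  assumes d: "\<And>x. x \<in> {0..T} \<Longrightarrow> (y has_real_derivative y1 x) (at x within {0..T})"
    and lip: "\<And>x z. x \<in> {0..T} \<Longrightarrow> z \<in> {0..T} \<Longrightarrow> \<bar>y1 x - y1 z\<bar> \<le> M * \<bar>x - z\<bar>"
    and M: "0 \<le> M" and y0: "y 0 = 0" "y1 0 = 0" and \<tau>: "0 < \<tau>" and k: "real k * \<tau> \<le> T"
  shows "\<bar>fps_nth ((1 - fps_X)\<^sup>2 * Abs_fps (\<lambda>k. y (real k * \<tau>))) k\<bar> \<le> 8 * M * \<tau>\<^sup>2"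
proof -
  have T: "0 \<le> T" using k \<tau> by (meson mult_nonneg_nonneg of_nat_0_le_iff less_imp_le order_trans)
  consider "k = 0" | "k = 1" | j where "k = Suc (Suc j)"
    by (metis One_nat_def not0_implies_Suc)
  then show ?thesis
  proof cases
    case 1
    then show ?thesis using y0 M by (simp add: second_difference_nth)
  next
    case 2
    have T1: "\<tau> \<le> T" using k 2 by simp
    have "\<bar>y1 x\<bar> \<le> M * \<tau>" if "x \<in> {0..\<tau>}" for x
    proof -
      have "\<bar>y1 x\<bar> \<le> M * \<bar>x\<bar>" using lip[of x 0] that T1 T y0 by simp
      also have "\<dots> \<le> M * \<tau>" using that M by (intro mult_left_mono) auto
      finally show ?thesis .
    qed
    moreover have "(y has_real_derivative y1 x) (at x within {0..\<tau>})" if "x \<in> {0..\<tau>}" for x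
      by (rule DERIV_subset[OF d]) (use that T1 in auto)
    ultimately have "\<bar>y \<tau> - y 0\<bar> \<le> M * \<tau> * \<bar>\<tau> - 0\<bar>"
      using \<tau> by (intro lipschitz_of_derivative_bound) auto
    then have "\<bar>y \<tau>\<bar> \<le> M * \<tau>\<^sup>2" using y0 \<tau> by (simp add: power2_eq_square)
    also have "\<dots> \<le> 8 * M * \<tau>\<^sup>2" using M by (simp add: mult_right_mono)
    finally show ?thesis unfolding 2 second_difference_nth using y0 by simp
  next
    case 3
    let ?c = "real j * \<tau>" and ?d = "real (j + 2) * \<tau>" and ?s = "real (j + 1) * \<tau>"
    have dc: "?d - ?c = 2 * \<tau>" "?s - ?c = \<tau>" by (simp_all add: algebra_simps)
    have le: "0 \<le> ?c" "?c < ?d" "?d \<le> T" "?c \<le> ?s" "?s \<le> ?d"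
      using \<tau> k 3 by (simp_all add: algebra_simps)
    have "\<bar>y ?s - (y ?c + (?s - ?c) / (?d - ?c) * (y ?d - y ?c))\<bar> \<le> M * (?d - ?c)\<^sup>2"
      by (rule secant_error[OF d lip M le])
    moreover have "(?s - ?c) / (?d - ?c) = 1 / 2" unfolding dc using \<tau> by simp
    ultimately have "\<bar>y ?s - (y ?c + 1 / 2 * (y ?d - y ?c))\<bar> \<le> M * (2 * \<tau>)\<^sup>2"
      unfolding dc by simp
    then have "2 * \<bar>y ?s - (y ?c + 1 / 2 * (y ?d - y ?c))\<bar> \<le> 8 * M * \<tau>\<^sup>2"
      by (simp add: power_mult_distrib)
    moreover have "fps_nth ((1 - fps_X)\<^sup>2 * Abs_fps (\<lambda>k. y (real k * \<tau>))) k =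
        - 2 * (y ?s - (y ?c + 1 / 2 * (y ?d - y ?c)))"
      unfolding 3 second_difference_nth by (simp add: add_ac field_simps)
    moreover have "\<bar>- 2 * x\<bar> = 2 * \<bar>x\<bar>" for x :: real by (simp add: abs_mult)
    ultimately show ?thesis by (simp only:)
  qed
qed

text \<open>The function is replaced by its linear interpolant, and then the kernels acting on
  the second differences D are compared.\<close>

theorem fractional_trapezoid_error:
  fixes g T :: real
  assumes g: "0 < g" "g < 1" and T: "0 < T"
  obtains C where "0 < C"
    "\<And>y y1 M nT n \<tau>. \<lbrakk>\<And>x. x \<in> {0..T} \<Longrightarrow> (y has_real_derivative y1 x) (at x within {0..T});
      \<And>x z. x \<in> {0..T} \<Longrightarrow> z \<in> {0..T} \<Longrightarrow> \<bar>y1 x - y1 z\<bar> \<le> M * \<bar>x - z\<bar>;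
      0 \<le> M; y 0 = 0; y1 0 = 0; 0 < nT; \<tau> = T / real nT; n \<le> nT\<rbrakk> \<Longrightarrow>
      \<bar>frac_integral g y (real n * \<tau>)
        - \<tau> powr g * 2 powr (- g) * fps_nth (trapez_fps g * Abs_fps (\<lambda>k. y (real k * \<tau>))) n\<bar> \<le> C * M * \<tau>\<^sup>2"
proof -
  obtain r where r: "fps_const (2 powr (- g)) * fps_binomial g =
       1 - fps_const (g / 2) * (1 - fps_X) + (1 - fps_X)\<^sup>2 * r"
    and rs: "\<And>n. (\<Sum>m\<le>n. \<bar>fps_nth r m\<bar>) \<le> 1"
    using half_one_plus_pow_remainder[OF g] by blast
  obtain A where A: "0 < A" "\<And>n. (\<Sum>m\<le>n. fps_nth (one_minus_pow (- g)) m) \<le> A * real (n + 1) powr g"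
    using one_minus_pow_neg_sum_bound[OF g(1)] by blast
  define H where "H = one_minus_pow (- (g + 2)) - fps_const (g / 2) * one_minus_pow (- (g + 1))"
  obtain B where B: "0 < B" "\<And>n. \<bar>fps_nth H n - real (n + 1) powr (g + 1) / Gamma (g + 2)\<bar> \<le> B * fps_nth (one_minus_pow (- g)) n"
    unfolding H_def using main_part_asymptotic[OF g] by metis
  have G1: "Gamma (g + 1) > 0" using g by (intro Gamma_real_pos) simp
  (* The first summand is the interpolation error, the second the difference of the kernels. *)
  define C where "C = T powr g / Gamma (g + 1) + 8 * (B + 1) * A * (2 * T) powr g"
  show thesis
  proof (rule that[of C])
    show "0 < C" unfolding C_def using A B G1 T by (intro add_pos_pos) auto
  next
    fix y y1 :: "real \<Rightarrow> real" and M \<tau> :: real and nT n :: nat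
    assume d: "\<And>x. x \<in> {0..T} \<Longrightarrow> (y has_real_derivative y1 x) (at x within {0..T})"
      and lip: "\<And>x z. x \<in> {0..T} \<Longrightarrow> z \<in> {0..T} \<Longrightarrow> \<bar>y1 x - y1 z\<bar> \<le> M * \<bar>x - z\<bar>"
      and M: "0 \<le> M" and y0: "y 0 = 0" "y1 0 = 0" and nT: "0 < nT" and \<tau>_def: "\<tau> = T / real nT" and n: "n \<le> nT"
    have \<tau>: "0 < \<tau>" using T nT by (simp add: \<tau>_def)
    have tn: "real k * \<tau> \<le> T" if "k \<le> nT" for k
      unfolding \<tau>_def using that nT T by (simp add: divide_le_eq mult.commute mult_right_mono)
    define Y where "Y = Abs_fps (\<lambda>k. y (real k * \<tau>))"
    define D where "D = (1 - fps_X)\<^sup>2 * Y"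
    have Db: "\<bar>fps_nth D k\<bar> \<le> 8 * M * \<tau>\<^sup>2" if "k \<le> nT" for k
      unfolding D_def Y_def by (rule smooth_second_difference_bound[OF d lip M y0 \<tau> tn[OF that]])
    have D0: "fps_nth D 0 = 0" unfolding D_def Y_def using y0 by (simp add: second_difference_nth)
    (* The piecewise linear interpolant of y as a sum of ramps. Index k belongs to the ramp that
       starts at node k - 1, since D k is the second difference centred there. *)
    define L where "L s = (\<Sum>k=1..n. fps_nth D k / \<tau> * max 0 (s - real (k - 1) * \<tau>))" for s
    have Lc: "continuous_on S L" for S unfolding L_def by (intro continuous_intros)
    have yc: "continuous_on {0..T} y" by (rule DERIV_continuous_on) (rule d)
    have tn0: "0 \<le> real n * \<tau>" using \<tau> by simp
    have yc': "continuous_on {0..real n * \<tau>} y"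
      by (rule continuous_on_subset[OF yc]) (use tn[OF n] in auto)
    have yL: "\<bar>y s - L s\<bar> \<le> M * \<tau>\<^sup>2" if s: "0 \<le> s" "s \<le> real n * \<tau>" for s
    proof (cases "n = 0")
      case True
      then show ?thesis using s y0 M by (simp add: L_def)
    next
      case False
      (* The cell that contains s; the right end of the last cell must not be assigned to the
         next one. *)
      define i where "i = (if s = real n * \<tau> then n - 1 else nat \<lfloor>s / \<tau>\<rfloor>)"
      have i: "i < n" "real i * \<tau> \<le> s" "s \<le> real (Suc i) * \<tau>"
      proof -
        have "i < n \<and> real i * \<tau> \<le> s \<and> s \<le> real (Suc i) * \<tau>"
        proof (cases "s = real n * \<tau>")
          case True
          then have "i = n - 1" by (simp add: i_def)
          moreover from this have "Suc i = n" using False by simp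
          ultimately show ?thesis using True \<tau> False by (auto intro: mult_right_mono)
        next
          case s': False
          then have ie: "i = nat \<lfloor>s / \<tau>\<rfloor>" by (simp add: i_def)
          have "0 \<le> s / \<tau>" using s \<tau> by simp
          then have fl: "real i \<le> s / \<tau>" "s / \<tau> < real i + 1" unfolding ie by linarith+
          then have "real i * \<tau> \<le> s" "s < (real i + 1) * \<tau>" using \<tau> by (simp_all add: pos_le_divide_eq pos_divide_less_eq)
          moreover have "real i < real n"
          proof -
            have "s < real n * \<tau>" using s s' by simp
            then have "s / \<tau> < real n" using \<tau> by (simp add: pos_divide_less_eq)
            then show ?thesis using fl by simp
          qed
          ultimately show ?thesis by (simp add: add.commute)
        qed
        then show "i < n" "real i * \<tau> \<le> s" "s \<le> real (Suc i) * \<tau>" by auto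
      qed
      define \<sigma> where "\<sigma> = (s - real i * \<tau>) / \<tau>"
      have s_eq: "s = (real i + \<sigma>) * \<tau>" using \<tau> by (simp add: \<sigma>_def field_simps)
      have sg: "0 \<le> \<sigma>" "\<sigma> \<le> 1" using i \<tau> by (simp_all add: \<sigma>_def field_simps)
      have "L s = (\<Sum>k=1..Suc i. fps_nth D k * (real i + \<sigma> + 1 - real k))"
      proof -
        have "L s = (\<Sum>k=1..Suc i. fps_nth D k / \<tau> * max 0 (s - real (k - 1) * \<tau>))"
          unfolding L_def
        proof (rule sum.mono_neutral_right)
          show "\<forall>k\<in>{1..n} - {1..Suc i}. fps_nth D k / \<tau> * max 0 (s - real (k - 1) * \<tau>) = 0"
          proof
            fix k assume "k \<in> {1..n} - {1..Suc i}"
            then have "real (Suc i) \<le> real (k - 1)" by auto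
            then have "real (Suc i) * \<tau> \<le> real (k - 1) * \<tau>" using \<tau> by (intro mult_right_mono) auto
            then have "s \<le> real (k - 1) * \<tau>" using i by linarith
            then show "fps_nth D k / \<tau> * max 0 (s - real (k - 1) * \<tau>) = 0" by simp
          qed
        qed (use i in auto)
        also have "\<dots> = (\<Sum>k=1..Suc i. fps_nth D k * (real i + \<sigma> + 1 - real k))"
        proof (rule sum.cong[OF refl])
          fix k assume k: "k \<in> {1..Suc i}"
          then have e: "s - real (k - 1) * \<tau> = (real i + \<sigma> + 1 - real k) * \<tau>"
            unfolding s_eq by (simp add: of_nat_diff algebra_simps)
          have "0 \<le> real i + \<sigma> + 1 - real k" using k sg by auto
          then have "max 0 (s - real (k - 1) * \<tau>) = (real i + \<sigma> + 1 - real k) * \<tau>" unfolding e using \<tau> by simp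
          then show "fps_nth D k / \<tau> * max 0 (s - real (k - 1) * \<tau>) = fps_nth D k * (real i + \<sigma> + 1 - real k)"
            using \<tau> by simp
        qed
        finally show ?thesis .
      qed
      also have "\<dots> = (\<Sum>k\<le>Suc i. fps_nth D k * (real i + \<sigma> + 1 - real k))"
        unfolding atMost_atLeast0 by (subst (2) sum.atLeast_Suc_atMost) (simp_all add: D0)
      also have "\<dots> = y (real i * \<tau>) + \<sigma> * (y (real (Suc i) * \<tau>) - y (real i * \<tau>))"
        unfolding D_def Y_def using ramp_sum_interpolates[of "\<lambda>k. y (real k * \<tau>)" i \<sigma>] y0 by simp
      also have "\<sigma> = (s - real i * \<tau>) / (real (Suc i) * \<tau> - real i * \<tau>)" by (simp add: \<sigma>_def algebra_simps)
      finally have Ls: "L s = y (real i * \<tau>) + (s - real i * \<tau>) / (real (Suc i) * \<tau> - real i * \<tau>) * (y (real (Suc i) * \<tau>) - y (real i * \<tau>))" .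
      have "\<bar>y s - L s\<bar> \<le> M * (real (Suc i) * \<tau> - real i * \<tau>)\<^sup>2"
        unfolding Ls using i \<tau> n tn[of "Suc i"] by (intro secant_error[OF d lip M]) auto
      also have "real (Suc i) * \<tau> - real i * \<tau> = \<tau>" by (simp add: algebra_simps)
      finally show ?thesis .
    qed
    have 1: "\<bar>frac_integral g y (real n * \<tau>) - frac_integral g L (real n * \<tau>)\<bar> \<le> M * \<tau>\<^sup>2 * (T powr g / Gamma (g + 1))"
    proof -
      have "\<bar>frac_integral g (\<lambda>s. y s - L s) (real n * \<tau>)\<bar> \<le> M * \<tau>\<^sup>2 * (real n * \<tau>) powr g / Gamma (g + 1)"
        by (rule frac_integral_bound[OF g(1) tn0 continuous_on_diff[OF yc' Lc] yL])
      also have "\<dots> = M * \<tau>\<^sup>2 * ((real n * \<tau>) powr g / Gamma (g + 1))" by simp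
      also have "\<dots> \<le> M * \<tau>\<^sup>2 * (T powr g / Gamma (g + 1))"
        using M g G1 tn[OF n] tn0 by (intro mult_left_mono divide_right_mono powr_mono2) auto
      finally show ?thesis using frac_integral_diff[OF g(1) tn0 yc' Lc] by simp
    qed
    have JL: "frac_integral g L (real n * \<tau>) = \<tau> powr g * fps_nth (Abs_fps (\<lambda>m. real (m + 1) powr (g + 1) / Gamma (g + 2)) * D) n"
    proof -
      have "frac_integral g L (real n * \<tau>) = (\<Sum>k=1..n. frac_integral g (\<lambda>s. fps_nth D k / \<tau> * max 0 (s - real (k - 1) * \<tau>)) (real n * \<tau>))"
        unfolding L_def[abs_def] by (intro frac_integral_sum g tn0 continuous_on_mult_left) (auto intro!: continuous_intros)
      also have "\<dots> = (\<Sum>k=1..n. \<tau> powr g * (fps_nth D k * (real (n - k + 1) powr (g + 1) / Gamma (g + 2))))"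
      proof (rule sum.cong[OF refl])
        fix k assume k: "k \<in> {1..n}"
        have c: "0 \<le> real (k - 1) * \<tau>" "real (k - 1) * \<tau> \<le> real n * \<tau>" using k \<tau> by (auto intro: mult_right_mono)
        have "real n * \<tau> - real (k - 1) * \<tau> = real (n - k + 1) * \<tau>" using k by (simp add: of_nat_diff algebra_simps)
        then have "frac_integral g (\<lambda>s. max 0 (s - real (k - 1) * \<tau>)) (real n * \<tau>) = (real (n - k + 1) * \<tau>) powr (g + 1) / Gamma (g + 2)"
          using frac_integral_ramp[OF g(1) c] by simp
        also have "(real (n - k + 1) * \<tau>) powr (g + 1) = real (n - k + 1) powr (g + 1) * (\<tau> powr g * \<tau>)"
          using \<tau> by (simp add: powr_mult powr_add)
        finally show "frac_integral g (\<lambda>s. fps_nth D k / \<tau> * max 0 (s - real (k - 1) * \<tau>)) (real n * \<tau>) =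
          \<tau> powr g * (fps_nth D k * (real (n - k + 1) powr (g + 1) / Gamma (g + 2)))"
          unfolding frac_integral_cmult using \<tau> by simp
      qed
      also have "\<dots> = (\<Sum>k=0..n. \<tau> powr g * (fps_nth D k * (real (n - k + 1) powr (g + 1) / Gamma (g + 2))))"
        by (subst (2) sum.atLeast_Suc_atMost) (simp_all add: D0)
      also have "\<dots> = \<tau> powr g * fps_nth (D * Abs_fps (\<lambda>m. real (m + 1) powr (g + 1) / Gamma (g + 2))) n"
        by (simp add: fps_mult_nth sum_distrib_left)
      finally show ?thesis by (simp only: mult.commute)
    qed
    define a where "a = (\<Sum>m\<le>n. fps_nth (one_minus_pow (- g)) m)"
    have apos: "0 \<le> fps_nth (one_minus_pow (- g)) m" for m using one_minus_pow_neg_pos[OF g(1), of m] by simp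
    have a0: "0 \<le> a" unfolding a_def by (intro sum_nonneg apos)
    have ab: "\<tau> powr g * a \<le> A * (2 * T) powr g"
    proof -
      have "\<tau> powr g * a \<le> \<tau> powr g * (A * real (n + 1) powr g)" unfolding a_def by (intro mult_left_mono A) auto
      also have "\<dots> = A * (real (n + 1) * \<tau>) powr g" using \<tau> by (simp add: powr_mult)
      also have "\<dots> \<le> A * (2 * T) powr g"
      proof (intro mult_left_mono powr_mono2)
        have "\<tau> \<le> T" using tn[of 1] nT by simp
        then show "real (n + 1) * \<tau> \<le> 2 * T" using tn[OF n] by (simp add: algebra_simps)
      qed (use g A \<tau> in auto)
      finally show ?thesis .
    qed
    have 2: "\<bar>frac_integral g L (real n * \<tau>) - \<tau> powr g * 2 powr (- g) * fps_nth (trapez_fps g * Y) n\<bar>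
        \<le> 8 * (B + 1) * A * (2 * T) powr g * (M * \<tau>\<^sup>2)"
    proof -
      (* The integral of L and the quadrature rule are both convolutions with D; E is the
         difference of the kernels. *)
      define E where "E = Abs_fps (\<lambda>m. real (m + 1) powr (g + 1) / Gamma (g + 2)) - (H + one_minus_pow (- g) * r)"
      have "2 powr (- g) * fps_nth (trapez_fps g * Y) n = fps_nth ((fps_const (2 powr (- g)) * trapez_fps g) * Y) n"
        by (simp add: mult.assoc)
      also have "(fps_const (2 powr (- g)) * trapez_fps g) * Y = (H + one_minus_pow (- g) * r) * D"
        unfolding trapez_fps_split[OF r] H_def D_def by (simp only: mult.assoc)
      finally have "frac_integral g L (real n * \<tau>) - \<tau> powr g * 2 powr (- g) * fps_nth (trapez_fps g * Y) n = \<tau> powr g * fps_nth (E * D) n"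
        unfolding JL E_def by (simp add: algebra_simps)
      also have "\<bar>\<dots>\<bar> = \<tau> powr g * \<bar>fps_nth (E * D) n\<bar>" by (simp add: abs_mult)
      also have "\<dots> \<le> \<tau> powr g * ((\<Sum>m\<le>n. \<bar>fps_nth E m\<bar>) * (8 * M * \<tau>\<^sup>2))"
        using Db n by (intro mult_left_mono fps_mult_nth_bound) auto
      also have "\<dots> \<le> \<tau> powr g * (((B + 1) * a) * (8 * M * \<tau>\<^sup>2))"
      proof (intro mult_left_mono mult_right_mono)
        have "(\<Sum>m\<le>n. \<bar>fps_nth E m\<bar>) \<le> (\<Sum>m\<le>n. B * fps_nth (one_minus_pow (- g)) m + \<bar>fps_nth (one_minus_pow (- g) * r) m\<bar>)"
        proof (rule sum_mono)
          fix m
          show "\<bar>fps_nth E m\<bar> \<le> B * fps_nth (one_minus_pow (- g)) m + \<bar>fps_nth (one_minus_pow (- g) * r) m\<bar>"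
            using B(2)[of m] by (simp add: E_def)
        qed
        also have "\<dots> = B * a + (\<Sum>m\<le>n. \<bar>fps_nth (one_minus_pow (- g) * r) m\<bar>)"
          by (simp add: sum.distrib a_def sum_distrib_left)
        also have "(\<Sum>m\<le>n. \<bar>fps_nth (one_minus_pow (- g) * r) m\<bar>) \<le> a * 1"
        proof -
          have "(\<Sum>m\<le>n. \<bar>fps_nth (one_minus_pow (- g)) m\<bar>) = a" unfolding a_def using apos by simp
          then have "(\<Sum>m\<le>n. \<bar>fps_nth (one_minus_pow (- g) * r) m\<bar>) \<le> a * (\<Sum>m\<le>n. \<bar>fps_nth r m\<bar>)"
            using fps_mult_abs_partial_sums[of "one_minus_pow (- g)" r n] by simp
          also have "\<dots> \<le> a * 1" by (intro mult_left_mono rs a0)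
          finally show ?thesis .
        qed
        finally show "(\<Sum>m\<le>n. \<bar>fps_nth E m\<bar>) \<le> (B + 1) * a" by (simp add: algebra_simps)
      qed (use M in auto)
      also have "\<dots> = 8 * (B + 1) * (M * \<tau>\<^sup>2) * (\<tau> powr g * a)" by (simp add: mult_ac)
      also have "\<dots> \<le> 8 * (B + 1) * (M * \<tau>\<^sup>2) * (A * (2 * T) powr g)"
        using B M by (intro mult_left_mono ab) auto
      finally show ?thesis by (simp add: mult_ac)
    qed
    have "\<bar>frac_integral g y (real n * \<tau>) - \<tau> powr g * 2 powr (- g) * fps_nth (trapez_fps g * Y) n\<bar>
       \<le> M * \<tau>\<^sup>2 * (T powr g / Gamma (g + 1)) + 8 * (B + 1) * A * (2 * T) powr g * (M * \<tau>\<^sup>2)"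
      using 1 2 by linarith
    also have "\<dots> = C * M * \<tau>\<^sup>2" unfolding C_def by (simp add: algebra_simps)
    finally show "\<bar>frac_integral g y (real n * \<tau>)
        - \<tau> powr g * 2 powr (- g) * fps_nth (trapez_fps g * Abs_fps (\<lambda>k. y (real k * \<tau>))) n\<bar> \<le> C * M * \<tau>\<^sup>2"
      unfolding Y_def .
  qed
qed

text \<open>Since J^(g+1) = J^1 J^g, the increment is the ordinary integral of F = J^g y over
  one step. The vanishing initial values give y = J^2 y2, hence F = J^2 (J^g y2), so F is as
  smooth as the ordinary trapezoidal rule requires. The factor 1 + X produces the two node
  values of that rule.\<close>

theorem fractional_trapezoid_increment_error:
  fixes g T :: real
  assumes g: "0 < g" "g < 1" and T: "0 < T"
  obtains C where "0 < C"
    "\<And>y y1 y2 M nT n \<tau>. \<lbrakk>\<And>x. x \<in> {0..T} \<Longrightarrow> (y has_real_derivative y1 x) (at x within {0..T});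
      \<And>x. x \<in> {0..T} \<Longrightarrow> (y1 has_real_derivative y2 x) (at x within {0..T});
      continuous_on {0..T} y2; \<And>x. x \<in> {0..T} \<Longrightarrow> \<bar>y2 x\<bar> \<le> M;
      y 0 = 0; y1 0 = 0; 0 < nT; \<tau> = T / real nT; 1 \<le> n; n \<le> nT\<rbrakk> \<Longrightarrow>
      \<bar>frac_integral (g + 1) y (real n * \<tau>) - frac_integral (g + 1) y (real (n - 1) * \<tau>)
        - \<tau> powr (g + 1) * 2 powr (- (g + 1)) *
          fps_nth ((1 + fps_X) * (trapez_fps g * Abs_fps (\<lambda>k. y (real k * \<tau>)))) n\<bar> \<le> C * M * \<tau> ^ 3"
proof (rule fractional_trapezoid_error[OF g T], goal_cases)
  case (1 C)
  note C = 1(2) and err = 1(3)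
  have G1: "Gamma (g + 1) > 0" using g by (intro Gamma_real_pos) simp
  define c where "c = T powr g / Gamma (g + 1)"
  have c: "c > 0" unfolding c_def using T G1 by simp
  show thesis
  proof (rule that[of "c + C"])
    show "0 < c + C" using c C by simp
  next
    fix y y1 y2 :: "real \<Rightarrow> real" and M \<tau> :: real and nT n :: nat
    assume d: "\<And>x. x \<in> {0..T} \<Longrightarrow> (y has_real_derivative y1 x) (at x within {0..T})"
      and d1: "\<And>x. x \<in> {0..T} \<Longrightarrow> (y1 has_real_derivative y2 x) (at x within {0..T})"
      and y2: "continuous_on {0..T} y2" and y2M: "\<And>x. x \<in> {0..T} \<Longrightarrow> \<bar>y2 x\<bar> \<le> M"
      and y0: "y 0 = 0" "y1 0 = 0" and nT: "0 < nT" and \<tau>_def: "\<tau> = T / real nT" and n: "1 \<le> n" "n \<le> nT"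
    have M: "0 \<le> M" using order_trans[OF abs_ge_zero y2M[of 0]] T by simp
    have \<tau>: "0 < \<tau>" using T nT by (simp add: \<tau>_def)
    have tn: "real k * \<tau> \<le> T" if "k \<le> nT" for k
      unfolding \<tau>_def using that nT T by (simp add: divide_le_eq mult.commute mult_right_mono)
    have lip: "\<bar>y1 x - y1 z\<bar> \<le> M * \<bar>x - z\<bar>" if "x \<in> {0..T}" "z \<in> {0..T}" for x z
      by (rule lipschitz_of_derivative_bound[OF d1 y2M that])
    have yc: "continuous_on {0..T} y" by (rule DERIV_continuous_on) (rule d)
    have sub: "continuous_on {0..t} f" if "continuous_on {0..T} f" "t \<le> T" for t and f :: "real \<Rightarrow> real"
      by (rule continuous_on_subset[OF that(1)]) (use that in auto)
    define F where "F = frac_integral g y"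
    define W where "W = frac_integral g y2"
    define F1 where "F1 t = integral {0..t} W" for t
    have Wc: "continuous_on {0..T} W" unfolding W_def using T by (intro continuous_on_frac_integral g y2) simp
    have W: "\<bar>W t\<bar> \<le> c * M" if t: "t \<in> {0..T}" for t
    proof -
      have "\<bar>W t\<bar> \<le> M * t powr g / Gamma (g + 1)"
        unfolding W_def using t y2M by (intro frac_integral_bound g sub[OF y2]) auto
      also have "\<dots> \<le> M * T powr g / Gamma (g + 1)"
        using t g M G1 by (intro divide_right_mono mult_left_mono powr_mono2) auto
      finally show ?thesis by (simp add: c_def mult_ac)
    qed
    have F1d: "(F1 has_real_derivative W t) (at t within {0..T})" if "t \<in> {0..T}" for t
      unfolding F1_def by (rule integral_has_real_derivative[OF Wc that])
    have F1c: "continuous_on {0..T} F1" by (rule DERIV_continuous_on) (rule F1d)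
    (* y = J^2 y2, and the order of integrations is exchanged by the semigroup law. *)
    have F_eq: "F t = integral {0..t} F1" if t: "t \<in> {0..T}" for t
    proof -
      have "F t = frac_integral g (frac_integral 2 y2) t"
        unfolding F_def
      proof (rule frac_integral_cong_open)
        fix s assume "0 < s" "s < t"
        then show "y s = frac_integral 2 y2 s"
          using frac_integral_2_taylor[OF _ _ d d1 y2, of s] y0 t by simp
      qed
      also have "\<dots> = frac_integral (g + 2) y2 t"
        using t g by (intro frac_integral_semigroup sub[OF y2]) auto
      also have "\<dots> = frac_integral 2 W t"
        unfolding W_def using t g frac_integral_semigroup[of 2 g t y2] sub[OF y2, of t] by (simp add: add.commute)
      also have "\<dots> = frac_integral 1 (frac_integral 1 W) t"
        using t frac_integral_semigroup[of 1 1 t W] sub[OF Wc, of t] by simp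
      also have "frac_integral 1 W = F1" by (rule ext) (simp add: frac_integral_1 F1_def)
      also have "frac_integral 1 F1 t = integral {0..t} F1" by (rule frac_integral_1)
      finally show ?thesis .
    qed
    have Fd: "(F has_real_derivative F1 t) (at t within {0..T})" if t: "t \<in> {0..T}" for t
    proof -
      have "((\<lambda>u. integral {0..u} F1) has_derivative (*) (F1 t)) (at t within {0..T})"
        using integral_has_real_derivative[OF F1c t] by (simp add: has_field_derivative_def)
      then have "(F has_derivative (*) (F1 t)) (at t within {0..T})"
        by (rule has_derivative_transform[OF t, rotated]) (rule F_eq)
      then show ?thesis by (simp add: has_field_derivative_def)
    qed
    have F1lip: "\<bar>F1 x - F1 z\<bar> \<le> (c * M) * \<bar>x - z\<bar>" if "x \<in> {0..T}" "z \<in> {0..T}" for x z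
      by (rule lipschitz_of_derivative_bound[OF F1d W that])
    let ?a = "real (n - 1) * \<tau>" and ?b = "real n * \<tau>"
    have ab: "0 \<le> ?a" "?a < ?b" "?b \<le> T" "?b - ?a = \<tau>"
    proof -
      have "real (n - 1) = real n - 1" using n by simp
      then show "0 \<le> ?a" "?a < ?b" "?b \<le> T" "?b - ?a = \<tau>"
        using \<tau> tn[OF n(2)] by (simp_all add: algebra_simps)
    qed
    have Fc: "continuous_on {0..T} F" by (rule DERIV_continuous_on) (rule Fd)
    have "frac_integral (g + 1) y t = integral {0..t} F" if t: "t \<in> {0..T}" for t
    proof -
      have "frac_integral (1 + g) y t = frac_integral 1 F t"
        unfolding F_def using t g frac_integral_semigroup[of 1 g t y] sub[OF yc, of t] by simp
      then show ?thesis by (simp add: frac_integral_1 add.commute)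
    qed
    then have "frac_integral (g + 1) y ?b - frac_integral (g + 1) y ?a = integral {0..?b} F - integral {0..?a} F"
      using ab by simp
    also have "\<dots> = integral {?a..?b} F"
    proof -
      have "F integrable_on {0..?b}" by (intro integrable_continuous_interval sub[OF Fc] ab)
      then show ?thesis
        using Henstock_Kurzweil_Integration.integral_combine[where a = 0 and c = ?a and b = ?b and f = F] ab by simp
    qed
    finally have J: "frac_integral (g + 1) y ?b - frac_integral (g + 1) y ?a = integral {?a..?b} F" .
    have trap: "\<bar>integral {?a..?b} F - \<tau> / 2 * (F ?a + F ?b)\<bar> \<le> c * M * \<tau> ^ 3"
      using trapezoid_error[OF Fd F1lip _ ab(1,2,3)] c M unfolding ab(4) by simp
    define Q where "Q = trapez_fps g * Abs_fps (\<lambda>k. y (real k * \<tau>))"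
    have Fb: "\<bar>F (real k * \<tau>) - \<tau> powr g * 2 powr (- g) * fps_nth Q k\<bar> \<le> C * M * \<tau>\<^sup>2" if "k \<le> nT" for k
      unfolding F_def Q_def by (rule err[OF d lip M y0 nT \<tau>_def that])
    have Qn: "fps_nth ((1 + fps_X) * Q) n = fps_nth Q n + fps_nth Q (n - 1)"
      using n by (simp add: distrib_right fps_X_mult_nth)
    have pw: "\<tau> powr (g + 1) * 2 powr (- (g + 1)) = \<tau> / 2 * (\<tau> powr g * 2 powr (- g))"
    proof -
      have "(2 :: real) powr (- (g + 1)) = 2 powr (- g) / 2"
        using powr_add[of "2 :: real" "- g" "- 1"] by (simp add: powr_neg_one)
      moreover have "\<tau> powr (g + 1) = \<tau> powr g * \<tau>" using \<tau> by (simp add: powr_add)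
      ultimately show ?thesis by simp
    qed
    have "\<bar>\<tau> / 2 * (F ?a + F ?b) - \<tau> powr (g + 1) * 2 powr (- (g + 1)) * fps_nth ((1 + fps_X) * Q) n\<bar>
       = \<tau> / 2 * \<bar>(F ?a - \<tau> powr g * 2 powr (- g) * fps_nth Q (n - 1)) + (F ?b - \<tau> powr g * 2 powr (- g) * fps_nth Q n)\<bar>"
    proof -
      have "\<tau> / 2 * (F ?a + F ?b) - \<tau> / 2 * (\<tau> powr g * 2 powr (- g)) * (fps_nth Q n + fps_nth Q (n - 1))
        = \<tau> / 2 * ((F ?a - \<tau> powr g * 2 powr (- g) * fps_nth Q (n - 1)) + (F ?b - \<tau> powr g * 2 powr (- g) * fps_nth Q n))"
        by (simp only: distrib_left distrib_right right_diff_distrib mult.assoc)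
      moreover have "\<bar>\<tau> / 2 * x\<bar> = \<tau> / 2 * \<bar>x\<bar>" for x using \<tau> by (simp add: abs_mult)
      ultimately show ?thesis unfolding pw Qn by (simp only:)
    qed
    also have "\<dots> \<le> \<tau> / 2 * (C * M * \<tau>\<^sup>2 + C * M * \<tau>\<^sup>2)"
      using \<tau> n by (intro mult_left_mono order_trans[OF abs_triangle_ineq] add_mono Fb) auto
    also have "\<dots> = C * M * \<tau> ^ 3" by (simp add: power2_eq_square power3_eq_cube)
    finally have quad: "\<bar>\<tau> / 2 * (F ?a + F ?b) - \<tau> powr (g + 1) * 2 powr (- (g + 1)) * fps_nth ((1 + fps_X) * Q) n\<bar>
       \<le> C * M * \<tau> ^ 3" .
    have "(c + C) * M * \<tau> ^ 3 = c * M * \<tau> ^ 3 + C * M * \<tau> ^ 3" by (simp add: distrib_right)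
    then have "\<bar>integral {?a..?b} F - \<tau> powr (g + 1) * 2 powr (- (g + 1)) * fps_nth ((1 + fps_X) * Q) n\<bar> \<le> (c + C) * M * \<tau> ^ 3"
      using trap quad by linarith
    then show "\<bar>frac_integral (g + 1) y (real n * \<tau>) - frac_integral (g + 1) y (real (n - 1) * \<tau>)
        - \<tau> powr (g + 1) * 2 powr (- (g + 1)) *
          fps_nth ((1 + fps_X) * (trapez_fps g * Abs_fps (\<lambda>k. y (real k * \<tau>)))) n\<bar> \<le> (c + C) * M * \<tau> ^ 3"
      unfolding J Q_def .
  qed
qed

section \<open>Spaces of continuously differentiable functions\<close>

lemma Cm_space_D:
  assumes "v \<in> Cm_space m a b"
  shows "continuous_on {a..b} v"
    and "\<And>i x. i < m \<Longrightarrow> x \<in> {a<..<b} \<Longrightarrow> (deriv ^^ i) v differentiable (at x)"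
    and "\<And>i. i \<le> m \<Longrightarrow> \<exists>w. continuous_on {a..b} w \<and> (\<forall>x\<in>{a<..<b}. w x = (deriv ^^ i) v x)"
  using assms by (simp_all add: Cm_space_def)

lemma Cm_space_deriv_bdd:
  assumes "v \<in> Cm_space m a b" "i \<le> m"
  shows "bdd_above ((\<lambda>x. \<bar>(deriv ^^ i) v x\<bar>) ` {a<..<b})"
proof -
  obtain w where w: "continuous_on {a..b} w" "\<And>x. x \<in> {a<..<b} \<Longrightarrow> w x = (deriv ^^ i) v x"
    using Cm_space_D(3)[OF assms] by auto
  have "bounded (w ` {a..b})"
    using compact_continuous_image[OF w(1)] compact_imp_bounded by blast
  then obtain B where B: "\<forall>x\<in>{a..b}. \<bar>w x\<bar> \<le> B" unfolding bounded_iff by auto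
  show ?thesis
  proof (rule bdd_aboveI2)
    fix x assume x: "x \<in> {a<..<b}"
    then show "\<bar>(deriv ^^ i) v x\<bar> \<le> B" using bspec[OF B, of x] w(2)[OF x] x by simp
  qed
qed

lemma abs_deriv_le_Cm_norm:
  assumes "v \<in> Cm_space m a b" "i \<le> m" "x \<in> {a<..<b}"
  shows "\<bar>(deriv ^^ i) v x\<bar> \<le> Cm_norm m a b v"
proof -
  have "\<bar>(deriv ^^ i) v x\<bar> \<le> (SUP x\<in>{a<..<b}. \<bar>(deriv ^^ i) v x\<bar>)"
    by (rule cSUP_upper[OF assms(3) Cm_space_deriv_bdd[OF assms(1,2)]])
  also have "\<dots> \<le> Cm_norm m a b v"
    unfolding Cm_norm_def using assms(2) by (intro Max_ge) auto
  finally show ?thesis .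
qed

lemma Cm_norm_le:
  assumes "a < b" "\<And>i x. i \<le> m \<Longrightarrow> x \<in> {a<..<b} \<Longrightarrow> \<bar>(deriv ^^ i) v x\<bar> \<le> B"
  shows "Cm_norm m a b v \<le> B"
proof -
  have "(SUP x\<in>{a<..<b}. \<bar>(deriv ^^ i) v x\<bar>) \<le> B" if "i \<le> m" for i
    by (rule cSUP_least) (use assms that in auto)
  then show ?thesis unfolding Cm_norm_def by simp
qed

lemma deriv_funpow_has_derivative:
  assumes "v \<in> Cm_space m a b" "i < m" "x \<in> {a<..<b}"
  shows "((deriv ^^ i) v has_real_derivative (deriv ^^ Suc i) v x) (at x)"
proof -
  have "(deriv ^^ i) v differentiable (at x)" using Cm_space_D(2)[OF assms(1)] assms(2,3) by simp
  then show ?thesis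
    by (simp add: DERIV_deriv_iff_real_differentiable)
qed

lemma Cm_space_lincomb:
  assumes v: "v \<in> Cm_space m a b" and w: "w \<in> Cm_space m a b"
  shows "(\<lambda>x. p * v x + q * w x) \<in> Cm_space m a b"
    and "\<And>i x. i \<le> m \<Longrightarrow> x \<in> {a<..<b} \<Longrightarrow>
      (deriv ^^ i) (\<lambda>x. p * v x + q * w x) x = p * (deriv ^^ i) v x + q * (deriv ^^ i) w x"
proof -
  let ?u = "\<lambda>x. p * v x + q * w x"
  have step: "((deriv ^^ i) ?u has_real_derivative p * (deriv ^^ Suc i) v x + q * (deriv ^^ Suc i) w x) (at x)"
    if eq: "\<And>x. x \<in> {a<..<b} \<Longrightarrow> (deriv ^^ i) ?u x = p * (deriv ^^ i) v x + q * (deriv ^^ i) w x"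
      and i: "i < m" and x: "x \<in> {a<..<b}" for i x
  proof -
    have "((\<lambda>x. p * (deriv ^^ i) v x + q * (deriv ^^ i) w x) has_real_derivative
        p * (deriv ^^ Suc i) v x + q * (deriv ^^ Suc i) w x) (at x)"
      by (intro DERIV_add DERIV_cmult deriv_funpow_has_derivative[OF v i x] deriv_funpow_has_derivative[OF w i x])
    then show ?thesis
      by (rule has_field_derivative_transform_within_open[OF _ open_greaterThanLessThan x]) (simp add: eq)
  qed
  have eq: "(deriv ^^ i) ?u x = p * (deriv ^^ i) v x + q * (deriv ^^ i) w x"
    if "i \<le> m" "x \<in> {a<..<b}" for i x
    using that
  proof (induction i arbitrary: x)
    case (Suc i)
    have "((deriv ^^ i) ?u has_real_derivative p * (deriv ^^ Suc i) v x + q * (deriv ^^ Suc i) w x) (at x)"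
      by (rule step[OF Suc.IH]) (use Suc.prems in auto)
    then show ?case by (simp add: DERIV_imp_deriv)
  qed simp
  then show "\<And>i x. i \<le> m \<Longrightarrow> x \<in> {a<..<b} \<Longrightarrow>
      (deriv ^^ i) ?u x = p * (deriv ^^ i) v x + q * (deriv ^^ i) w x" .
  show "?u \<in> Cm_space m a b"
    unfolding Cm_space_def mem_Collect_eq
  proof (intro conjI allI impI ballI)
    show "continuous_on {a..b} ?u" by (intro continuous_intros Cm_space_D(1)[OF v] Cm_space_D(1)[OF w])
    show "(deriv ^^ i) ?u differentiable (at x)" if "i < m" "x \<in> {a<..<b}" for i x
    proof -
      have "((deriv ^^ i) ?u has_real_derivative p * (deriv ^^ Suc i) v x + q * (deriv ^^ Suc i) w x) (at x)"
        by (rule step[OF eq that]) (use that in simp)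
      then show ?thesis by (auto simp: real_differentiable_def)
    qed
    show "\<exists>z. continuous_on {a..b} z \<and> (\<forall>x\<in>{a<..<b}. z x = (deriv ^^ i) ?u x)" if i: "i \<le> m" for i
    proof -
      obtain v' where v': "continuous_on {a..b} v'" "\<forall>x\<in>{a<..<b}. v' x = (deriv ^^ i) v x"
        using Cm_space_D(3)[OF v i] by auto
      obtain w' where w': "continuous_on {a..b} w'" "\<forall>x\<in>{a<..<b}. w' x = (deriv ^^ i) w x"
        using Cm_space_D(3)[OF w i] by auto
      show ?thesis
        by (rule exI[of _ "\<lambda>x. p * v' x + q * w' x"]) (use v' w' eq[OF i] in \<open>auto intro!: continuous_intros\<close>)
    qed
  qed
qed

lemma Cm_space_diff:
  assumes "v \<in> Cm_space m a b" "w \<in> Cm_space m a b"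
  shows "(\<lambda>x. v x - w x) \<in> Cm_space m a b"
    and "\<And>i x. i \<le> m \<Longrightarrow> x \<in> {a<..<b} \<Longrightarrow>
      (deriv ^^ i) (\<lambda>x. v x - w x) x = (deriv ^^ i) v x - (deriv ^^ i) w x"
  using Cm_space_lincomb(1)[OF assms, where p = 1 and q = "- 1"]
    Cm_space_lincomb(2)[OF assms, where p = 1 and q = "- 1"] by simp_all

text \<open>Taylor's formula is available only strictly inside the interval; the case in which a
  neighbour of x is an endpoint follows by letting the step tend to h.\<close>

lemma Cm_space_second_difference:
  assumes v: "v \<in> Cm_space 4 a b" and B: "\<And>y. y \<in> {a<..<b} \<Longrightarrow> \<bar>(deriv ^^ 4) v y\<bar> \<le> B"
    and h: "0 < h" "a \<le> x - h" "x + h \<le> b"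
  shows "\<bar>(deriv ^^ 2) v x - (v (x + h) - 2 * v x + v (x - h)) / h\<^sup>2\<bar> \<le> B * h\<^sup>2"
proof -
  have x: "x \<in> {a<..<b}" using h by auto
  (* Up to sign, q s is s^2 times the error with step s. *)
  define q where "q s = v (x + s) - 2 * v x + v (x - s) - s\<^sup>2 * (deriv ^^ 2) v x" for s
  have der: "\<forall>m t. m < 4 \<and> x - s \<le> t \<and> t \<le> x + s \<longrightarrow> DERIV ((deriv ^^ m) v) t :> (deriv ^^ Suc m) v t"
    if "0 < s" "s < h" for s
    using deriv_funpow_has_derivative[OF v] h that by auto
  have inner: "\<bar>q s\<bar> \<le> B * s ^ 4" if s: "0 < s" "s < h" for s
  proof -
    obtain y where y: "x < y" "y < x + s"
      "v (x + s) = (\<Sum>m<4. ((deriv ^^ m) v x / fact m) * (x + s - x) ^ m) + ((deriv ^^ 4) v y / fact 4) * (x + s - x) ^ 4"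
      using Taylor_up[of 4 "\<lambda>m. (deriv ^^ m) v" v "x - s" "x + s" x] der[OF s] s by auto
    obtain z where z: "x - s < z" "z < x"
      "v (x - s) = (\<Sum>m<4. ((deriv ^^ m) v x / fact m) * (x - s - x) ^ m) + ((deriv ^^ 4) v z / fact 4) * (x - s - x) ^ 4"
      using Taylor_down[of 4 "\<lambda>m. (deriv ^^ m) v" v "x - s" "x + s" x] der[OF s] s by auto
    have "q s = ((deriv ^^ 4) v y + (deriv ^^ 4) v z) * s ^ 4 / 24"
      unfolding q_def y(3) z(3) by (simp add: eval_nat_numeral fact_numeral field_simps)
    then have "\<bar>q s\<bar> = \<bar>((deriv ^^ 4) v y + (deriv ^^ 4) v z) * s ^ 4 / 24\<bar>" by (simp only:)
    also have "\<dots> = \<bar>(deriv ^^ 4) v y + (deriv ^^ 4) v z\<bar> * s ^ 4 / 24" using s by (simp add: abs_mult)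
    also have "\<dots> \<le> (B + B) * s ^ 4 / 24"
      using B[of y] B[of z] y z s h
      by (intro divide_right_mono mult_right_mono order_trans[OF abs_triangle_ineq] add_mono) auto
    also have "\<dots> \<le> B * s ^ 4"
    proof -
      have "0 \<le> B" using B[OF x] by linarith
      then have "0 \<le> B * s ^ 4" using s by simp
      then show ?thesis by simp
    qed
    finally show ?thesis .
  qed
  have vc: "continuous_on {a..b} v" by (rule Cm_space_D(1)[OF v])
  have cl: "closure {0<..<h} = {0..h}" using h by (simp add: closure_greaterThanLessThan)
  have cont: "continuous_on {0..h} (\<lambda>s. B * s ^ 4 - \<bar>q s\<bar>)"
    unfolding q_def using h
    by (intro continuous_intros continuous_on_compose2[OF vc]) auto
  have "0 \<le> B * h ^ 4 - \<bar>q h\<bar>"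
    by (rule continuous_ge_on_closure[of "{0<..<h}" "\<lambda>s. B * s ^ 4 - \<bar>q s\<bar>" h 0])
      (use cont inner h in \<open>auto simp: cl\<close>)
  then have "\<bar>q h\<bar> \<le> B * h ^ 4" by simp
  moreover have "(deriv ^^ 2) v x - (v (x + h) - 2 * v x + v (x - h)) / h\<^sup>2 = - q h / h\<^sup>2"
    using h by (simp add: q_def field_simps)
  moreover have "B * h ^ 4 / h\<^sup>2 = B * h\<^sup>2" using h by (simp add: power2_eq_square eval_nat_numeral)
  moreover have "\<bar>- q h / h\<^sup>2\<bar> = \<bar>q h\<bar> / h\<^sup>2" by (simp add: abs_divide)
  ultimately show ?thesis using divide_right_mono[of "\<bar>q h\<bar>" "B * h ^ 4" "h\<^sup>2"] by simp
qed

text \<open>The norm dominates each spatial derivative at each point, so limits in the norm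
  become pointwise limits of these derivatives. The uniform bound comes from continuity of the
  norm along the compact time interval.\<close>

lemma Cl_Cm_space_derivatives:
  assumes U: "U \<in> Cl_Cm_space l m a b T" and ab: "a < b" and T: "0 < T"
  obtains V B where "V 0 = (\<lambda>t x. U x t)"
    "\<And>k t. k \<le> l \<Longrightarrow> t \<in> {0..T} \<Longrightarrow> V k t \<in> Cm_space m a b"
    "\<And>k i x t. k < l \<Longrightarrow> i \<le> m \<Longrightarrow> x \<in> {a<..<b} \<Longrightarrow> t \<in> {0..T} \<Longrightarrow>
      ((\<lambda>s. (deriv ^^ i) (V k s) x) has_real_derivative (deriv ^^ i) (V (Suc k) t) x) (at t within {0..T})"
    "\<And>k i x. k \<le> l \<Longrightarrow> i \<le> m \<Longrightarrow> x \<in> {a<..<b} \<Longrightarrow> continuous_on {0..T} (\<lambda>t. (deriv ^^ i) (V k t) x)"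
    "\<And>k i x t. k \<le> l \<Longrightarrow> i \<le> m \<Longrightarrow> x \<in> {a<..<b} \<Longrightarrow> t \<in> {0..T} \<Longrightarrow> \<bar>(deriv ^^ i) (V k t) x\<bar> \<le> B"
proof -
  obtain V where V0: "V 0 = (\<lambda>t x. U x t)"
    and V_all: "\<forall>k\<le>l. \<forall>t\<in>{0..T}. V k t \<in> Cm_space m a b"
    and Vd_all: "\<forall>k<l. \<forall>t\<in>{0..T}.
      ((\<lambda>s. Cm_norm m a b (\<lambda>x. (V k s x - V k t x) / (s - t) - V (Suc k) t x)) \<longlongrightarrow> 0) (at t within {0..T})"
    and Vc_all: "\<forall>k\<le>l. \<forall>t\<in>{0..T}.
      ((\<lambda>s. Cm_norm m a b (\<lambda>x. V k s x - V k t x)) \<longlongrightarrow> 0) (at t within {0..T})"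
    using U unfolding Cl_Cm_space_def mem_Collect_eq by (elim exE conjE)
  note V = V_all[rule_format] and Vd = Vd_all[rule_format] and Vc = Vc_all[rule_format]
  have der: "((\<lambda>s. (deriv ^^ i) (V k s) x) has_real_derivative (deriv ^^ i) (V (Suc k) t) x) (at t within {0..T})"
    if k: "k < l" and i: "i \<le> m" and x: "x \<in> {a<..<b}" and t: "t \<in> {0..T}" for k i x t
    unfolding has_field_derivative_iff
  proof (rule LIM_zero_cancel, rule Lim_null_comparison[OF _ Vd[OF k t]])
    show "\<forall>\<^sub>F s in at t within {0..T}. norm (((deriv ^^ i) (V k s) x - (deriv ^^ i) (V k t) x) / (s - t) - (deriv ^^ i) (V (Suc k) t) x)
        \<le> Cm_norm m a b (\<lambda>x. (V k s x - V k t x) / (s - t) - V (Suc k) t x)"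
      unfolding eventually_at_filter
    proof (rule always_eventually, intro allI impI)
      fix s assume s: "s \<noteq> t" "s \<in> {0..T}"
      have kl: "k \<le> l" "Suc k \<le> l" using k by auto
      note L = Cm_space_lincomb[OF V[OF kl(1) s(2)] V[OF kl(1) t], where p = "1 / (s - t)" and q = "- (1 / (s - t))"]
      have e: "(\<lambda>x. (V k s x - V k t x) / (s - t) - V (Suc k) t x) =
          (\<lambda>x. (1 / (s - t) * V k s x + - (1 / (s - t)) * V k t x) - V (Suc k) t x)"
        by (simp add: diff_divide_distrib)
      note D = Cm_space_diff[OF L(1) V[OF kl(2) t]]
      have "(deriv ^^ i) (\<lambda>x. (V k s x - V k t x) / (s - t) - V (Suc k) t x) x =
          ((deriv ^^ i) (V k s) x - (deriv ^^ i) (V k t) x) / (s - t) - (deriv ^^ i) (V (Suc k) t) x"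
        unfolding e D(2)[OF i x] L(2)[OF i x] by (simp add: diff_divide_distrib)
      then show "norm (((deriv ^^ i) (V k s) x - (deriv ^^ i) (V k t) x) / (s - t) - (deriv ^^ i) (V (Suc k) t) x)
        \<le> Cm_norm m a b (\<lambda>x. (V k s x - V k t x) / (s - t) - V (Suc k) t x)"
        using abs_deriv_le_Cm_norm[OF D(1) i x] unfolding e by simp
    qed
  qed
  have cont: "continuous_on {0..T} (\<lambda>t. (deriv ^^ i) (V k t) x)"
    if k: "k \<le> l" and i: "i \<le> m" and x: "x \<in> {a<..<b}" for k i x
    unfolding continuous_on_def
  proof
    fix t assume t: "t \<in> {0..T}"
    show "((\<lambda>t. (deriv ^^ i) (V k t) x) \<longlongrightarrow> (deriv ^^ i) (V k t) x) (at t within {0..T})"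
    proof (rule LIM_zero_cancel, rule Lim_null_comparison[OF _ Vc[OF k t]])
      show "\<forall>\<^sub>F s in at t within {0..T}. norm ((deriv ^^ i) (V k s) x - (deriv ^^ i) (V k t) x) \<le> Cm_norm m a b (\<lambda>x. V k s x - V k t x)"
        unfolding eventually_at_filter
      proof (rule always_eventually, intro allI impI)
        fix s assume s: "s \<in> {0..T}"
        note D = Cm_space_diff[OF V[OF k s] V[OF k t]]
        show "norm ((deriv ^^ i) (V k s) x - (deriv ^^ i) (V k t) x) \<le> Cm_norm m a b (\<lambda>x. V k s x - V k t x)"
          using abs_deriv_le_Cm_norm[OF D(1) i x] D(2)[OF i x] by simp
      qed
    qed
  qed
  have normc: "continuous_on {0..T} (\<lambda>t. Cm_norm m a b (V k t))" if k: "k \<le> l" for k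
    unfolding continuous_on_def
  proof
    fix t assume t: "t \<in> {0..T}"
    show "((\<lambda>t. Cm_norm m a b (V k t)) \<longlongrightarrow> Cm_norm m a b (V k t)) (at t within {0..T})"
    proof (rule LIM_zero_cancel, rule Lim_null_comparison[OF _ Vc[OF k t]])
      show "\<forall>\<^sub>F s in at t within {0..T}. norm (Cm_norm m a b (V k s) - Cm_norm m a b (V k t)) \<le> Cm_norm m a b (\<lambda>x. V k s x - V k t x)"
        unfolding eventually_at_filter
      proof (rule always_eventually, intro allI impI)
        fix s assume s: "s \<in> {0..T}"
        note D = Cm_space_diff[OF V[OF k s] V[OF k t]]
        let ?N = "Cm_norm m a b (\<lambda>x. V k s x - V k t x)"
        have "Cm_norm m a b (V k s) \<le> Cm_norm m a b (V k t) + ?N"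
        proof (rule Cm_norm_le[OF ab])
          fix i x assume ix: "i \<le> m" "x \<in> {a<..<b}"
          show "\<bar>(deriv ^^ i) (V k s) x\<bar> \<le> Cm_norm m a b (V k t) + ?N"
            using abs_deriv_le_Cm_norm[OF D(1) ix] abs_deriv_le_Cm_norm[OF V[OF k t] ix]
            unfolding D(2)[OF ix] by linarith
        qed
        moreover have "Cm_norm m a b (V k t) \<le> Cm_norm m a b (V k s) + ?N"
        proof (rule Cm_norm_le[OF ab])
          fix i x assume ix: "i \<le> m" "x \<in> {a<..<b}"
          show "\<bar>(deriv ^^ i) (V k t) x\<bar> \<le> Cm_norm m a b (V k s) + ?N"
            using abs_deriv_le_Cm_norm[OF D(1) ix] abs_deriv_le_Cm_norm[OF V[OF k s] ix]
            unfolding D(2)[OF ix] by linarith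
        qed
        ultimately show "norm (Cm_norm m a b (V k s) - Cm_norm m a b (V k t)) \<le> ?N" by simp
      qed
    qed
  qed
  define B0 where "B0 k = (SUP t\<in>{0..T}. Cm_norm m a b (V k t))" for k
  have B0: "Cm_norm m a b (V k t) \<le> B0 k" if k: "k \<le> l" and t: "t \<in> {0..T}" for k t
    unfolding B0_def
    by (rule cSUP_upper[OF t]) (intro bounded_imp_bdd_above compact_imp_bounded compact_continuous_image normc k compact_Icc)
  define B where "B = Max (B0 ` {..l})"
  have bnd: "\<bar>(deriv ^^ i) (V k t) x\<bar> \<le> B" if "k \<le> l" "i \<le> m" "x \<in> {a<..<b}" "t \<in> {0..T}" for k i x t
  proof -
    have "\<bar>(deriv ^^ i) (V k t) x\<bar> \<le> Cm_norm m a b (V k t)" by (rule abs_deriv_le_Cm_norm[OF V that(2,3)]) (use that in auto)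
    also have "\<dots> \<le> B0 k" by (rule B0) (use that in auto)
    also have "\<dots> \<le> B" unfolding B_def using that by (intro Max_ge) auto
    finally show ?thesis .
  qed
  show thesis by (rule that[OF V0 V der cont bnd])
qed

lemma continuous_eq_on_closed_interval:
  fixes v w :: "real \<Rightarrow> real"
  assumes "a < b" "continuous_on {a..b} v" "continuous_on {a..b} w"
    and "\<And>x. x \<in> {a<..<b} \<Longrightarrow> v x = w x" and x: "x \<in> {a..b}"
  shows "v x = w x"
proof -
  have cl: "closure {a<..<b} = {a..b}" using assms(1) by (rule closure_greaterThanLessThan)
  have "v x - w x = 0"
    by (rule continuous_constant_on_closure[of "{a<..<b}" "\<lambda>x. v x - w x"])
      (use assms in \<open>auto simp: cl intro!: continuous_intros\<close>)
  then show ?thesis by simp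
qed

section \<open>The error of the difference scheme\<close>

text \<open>Inside the interval the two-sided derivatives in the definition agree with the
  one-sided ones.\<close>

lemma caputo_eq_frac_integral:
  assumes g: "\<And>s. s \<in> {0..T} \<Longrightarrow> (g has_real_derivative g1 s) (at s within {0..T})"
    and g1: "\<And>s. s \<in> {0..T} \<Longrightarrow> (g1 has_real_derivative g2 s) (at s within {0..T})"
    and t: "t \<le> T"
  shows "caputo \<beta> g t = frac_integral (2 - \<beta>) g2 t"
proof -
  have d: "(deriv ^^ 2) g s = g2 s" if s: "0 < s" "s < T" for s
  proof -
    have g': "(g has_real_derivative g1 r) (at r)" if "r \<in> {0<..<T}" for r
      using g[of r] that by (simp add: at_within_Icc_at)
    have "(g1 has_real_derivative g2 s) (at s)"
      using g1[of s] s by (simp add: at_within_Icc_at)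
    then have "(deriv g has_real_derivative g2 s) (at s)"
      by (rule has_field_derivative_transform_within_open[of _ _ _ "{0<..<T}"])
        (use s in \<open>auto simp: DERIV_imp_deriv[OF g']\<close>)
    then show ?thesis by (simp add: numeral_2_eq_2 DERIV_imp_deriv)
  qed
  have "caputo \<beta> g t = frac_integral (2 - \<beta>) ((deriv ^^ 2) g) t"
    by (simp add: caputo_def frac_integral_def)
  also have "\<dots> = frac_integral (2 - \<beta>) g2 t"
    by (rule frac_integral_cong_open) (use d t in auto)
  finally show ?thesis .
qed

text \<open>Apply J^\<beta>: by the semigroup law it turns J^(2-\<beta>) g2 into J^2 g2, which
  is the Taylor remainder of g.\<close>

lemma fractional_ode_integral_form:
  assumes \<beta>: "1 < \<beta>" "\<beta> < 2" and t: "0 \<le> t" "t \<le> T"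
    and g: "\<And>s. s \<in> {0..T} \<Longrightarrow> (g has_real_derivative g1 s) (at s within {0..T})"
    and g1: "\<And>s. s \<in> {0..T} \<Longrightarrow> (g1 has_real_derivative g2 s) (at s within {0..T})"
    and g2: "continuous_on {0..T} g2" and w: "continuous_on {0..T} w"
    and eq: "\<And>s. s \<in> {0<..T} \<Longrightarrow> caputo \<beta> g s = \<mu> * w s + F s"
  shows "g t - (g 0 + g1 0 * t) = \<mu> * frac_integral \<beta> w t + frac_integral \<beta> F t"
proof -
  have sub: "continuous_on {0..t} f" if "continuous_on {0..T} f" for f :: "real \<Rightarrow> real"
    by (rule continuous_on_subset[OF that]) (use t in auto)
  have c: "continuous_on {0..t} (frac_integral (2 - \<beta>) g2)"
    using \<beta> t by (intro continuous_on_frac_integral sub[OF g2]) auto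
  have w': "continuous_on {0..t} (\<lambda>s. \<mu> * w s)" by (intro continuous_intros sub[OF w])
  have "frac_integral \<beta> F t = frac_integral \<beta> (\<lambda>s. frac_integral (2 - \<beta>) g2 s - \<mu> * w s) t"
  proof (rule frac_integral_cong_open)
    fix s assume "0 < s" "s < t"
    then have s: "s \<in> {0<..T}" "s \<le> T" using t by auto
    show "F s = frac_integral (2 - \<beta>) g2 s - \<mu> * w s"
      using eq[OF s(1)] caputo_eq_frac_integral[OF g g1 s(2)] by simp
  qed
  also have "\<dots> = frac_integral \<beta> (frac_integral (2 - \<beta>) g2) t - \<mu> * frac_integral \<beta> w t"
    using frac_integral_diff[OF _ t(1) c w', of \<beta>] \<beta> by (simp add: frac_integral_cmult)
  also have "frac_integral \<beta> (frac_integral (2 - \<beta>) g2) t = frac_integral 2 g2 t"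
    using frac_integral_semigroup[OF _ _ t(1) sub[OF g2], of \<beta> "2 - \<beta>"] \<beta> by simp
  also have "\<dots> = g t - g 0 - g1 0 * t" by (rule frac_integral_2_taylor[OF t g g1 g2])
  finally show ?thesis by simp
qed

lemma alpha_coeff_nth: "alpha_coeff \<beta> k = fps_nth (one_minus_pow \<beta>) k"
  by (simp add: alpha_coeff_def one_minus_pow_nth)

lemma theta_coeff_nth: "theta_coeff \<beta> k = 2 powr (- \<beta>) * fps_nth (fps_binomial \<beta>) k"
proof -
  have "(- 1) ^ k * ((- 1) ^ k * x) = x" for x :: real
    by (simp add: mult.assoc[symmetric] power_mult_distrib[symmetric])
  then show ?thesis by (simp add: theta_coeff_def alpha_coeff_def mult.assoc)
qed

lemma fps_mult_nth_rev:
  fixes f g :: "real fps"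
  shows "fps_nth (f * g) m = (\<Sum>k\<le>m. fps_nth f (m - k) * fps_nth g k)"
proof -
  have "fps_nth (f * g) m = fps_nth (g * f) m" by (simp only: mult.commute)
  then show ?thesis unfolding fps_mult_nth atLeast0AtMost by (simp only: mult.commute)
qed

lemma fps_mult_nth_eq_0:
  fixes f g :: "real fps"
  assumes "\<And>k. k \<le> n \<Longrightarrow> fps_nth f k = 0"
  shows "fps_nth (f * g) n = 0"
  unfolding fps_mult_nth by (intro sum.neutral) (simp add: assms)

text \<open>The hypothesis is the scheme for the error, that is (1 - X)^\<beta> (E - R) = - kap
  (1 + X)^\<beta> (Y - P - D). Multiplying by (1 - X)^(1-\<beta>) leaves increments on the left
  and, on the right, G (1 + X). Identities that hold up to index M survive multiplication by a
  series.\<close>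

lemma scheme_incremental_form:
  fixes e r y ep de :: "nat \<Rightarrow> real"
  assumes eq: "\<And>n. n \<le> M \<Longrightarrow> (\<Sum>k=0..n. alpha_coeff \<beta> (n - k) * (e k - r k)) =
      - c * (\<Sum>k=0..n. theta_coeff \<beta> (n - k) * (y k - ep k - de k))"
    and n: "1 \<le> n" "n \<le> M"
  defines "G \<equiv> trapez_fps (\<beta> - 1)" and "kap \<equiv> c * 2 powr (- \<beta>)"
  shows "e n - e (n - 1) = kap * fps_nth (G * ((1 + fps_X) * Abs_fps de)) n
      + (r n - r (n - 1) - kap * fps_nth ((1 + fps_X) * (G * Abs_fps y)) n)
      + kap * fps_nth (((1 + fps_X) * G) * Abs_fps ep) n"
proof -
  let ?E = "Abs_fps e" and ?R = "Abs_fps r" and ?Y = "Abs_fps y" and ?P = "Abs_fps ep" and ?D = "Abs_fps de"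
  (* The defect of the scheme, zero up to index M. *)
  define Z where "Z = (?E - ?R) * one_minus_pow \<beta> + fps_const kap * ((?Y - ?P - ?D) * fps_binomial \<beta>)"
  have Z: "fps_nth Z k = 0" if "k \<le> M" for k
  proof -
    have "fps_nth ((?E - ?R) * one_minus_pow \<beta>) k = (\<Sum>i=0..k. alpha_coeff \<beta> (k - i) * (e i - r i))"
      unfolding fps_mult_nth alpha_coeff_nth by (simp add: mult.commute)
    also have "\<dots> = - c * (\<Sum>i=0..k. theta_coeff \<beta> (k - i) * (y i - ep i - de i))" by (rule eq[OF that])
    also have "\<dots> = - kap * (\<Sum>i=0..k. (y i - ep i - de i) * fps_nth (fps_binomial \<beta>) (k - i))"
      by (simp add: theta_coeff_nth kap_def sum_distrib_left mult_ac)
    also have "\<dots> = - kap * fps_nth ((?Y - ?P - ?D) * fps_binomial \<beta>) k"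
      by (simp add: fps_mult_nth)
    finally show ?thesis unfolding Z_def by simp
  qed
  have om: "one_minus_pow \<beta> * one_minus_pow (1 - \<beta>) = 1 - fps_X"
    using one_minus_pow_add[of \<beta> "1 - \<beta>"] by (simp add: one_minus_pow_1)
  have tr: "fps_binomial \<beta> * one_minus_pow (1 - \<beta>) = G * (1 + fps_X)"
  proof -
    have "fps_binomial \<beta> = fps_binomial (\<beta> - 1) * (1 + fps_X)"
      using fps_binomial_add_mult[of "\<beta> - 1" 1] by (simp add: fps_binomial_1)
    then show ?thesis unfolding G_def trapez_fps_def by (simp add: mult_ac)
  qed
  have "Z * one_minus_pow (1 - \<beta>) = (?E - ?R) * (one_minus_pow \<beta> * one_minus_pow (1 - \<beta>))
      + fps_const kap * ((?Y - ?P - ?D) * (fps_binomial \<beta> * one_minus_pow (1 - \<beta>)))"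
    unfolding Z_def by (simp only: distrib_right mult.assoc)
  also have "\<dots> = (?E - ?R) * (1 - fps_X) + fps_const kap * ((?Y - ?P - ?D) * (G * (1 + fps_X)))"
    unfolding om tr ..
  also have "\<dots> = (?E - fps_X * ?E) - (?R - fps_X * ?R) + fps_const kap * ((1 + fps_X) * (G * ?Y))
      - fps_const kap * (((1 + fps_X) * G) * ?P) - fps_const kap * (G * ((1 + fps_X) * ?D))"
    by (simp add: algebra_simps)
  finally have "fps_nth ((?E - fps_X * ?E) - (?R - fps_X * ?R) + fps_const kap * ((1 + fps_X) * (G * ?Y))
      - fps_const kap * (((1 + fps_X) * G) * ?P) - fps_const kap * (G * ((1 + fps_X) * ?D))) n = 0"
    using fps_mult_nth_eq_0[of n Z "one_minus_pow (1 - \<beta>)"] Z n by simp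
  moreover have "fps_nth (?E - fps_X * ?E) n = e n - e (n - 1)" "fps_nth (?R - fps_X * ?R) n = r n - r (n - 1)"
    using n by (auto simp: fps_X_mult_nth)
  ultimately show ?thesis by (simp only: fps_sub_nth fps_add_nth fps_mult_left_const_nth)
qed

lemma powr_increment_bound:
  fixes p T s t :: real
  assumes "1 \<le> p" "0 \<le> s" "s < t" "t \<le> T"
  shows "\<bar>t powr p - s powr p\<bar> \<le> p * T powr (p - 1) * (t - s)"
proof -
  have "\<exists>\<xi>\<in>{s<..<t}. t powr p - s powr p = (p * \<xi> powr (p - 1)) * (t - s)"
  proof (rule mvt[OF assms(3)])
    show "continuous_on {s..t} (\<lambda>x. x powr p)"
      using assms by (intro continuous_on_powr_pos_exponent) auto
    show "((\<lambda>x. x powr p) has_derivative (*) (p * x powr (p - 1))) (at x)" if "s < x" "x < t" for x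
      using has_real_derivative_powr[of x p] that assms by (simp add: has_field_derivative_def)
  qed force
  then obtain \<xi> where \<xi>: "\<xi> \<in> {s<..<t}" "t powr p - s powr p = (p * \<xi> powr (p - 1)) * (t - s)" by blast
  have "\<bar>(p * \<xi> powr (p - 1)) * (t - s)\<bar> = (p * \<xi> powr (p - 1)) * (t - s)" using assms by simp
  also have "\<dots> \<le> p * T powr (p - 1) * (t - s)"
    using assms \<xi>(1) by (intro mult_right_mono mult_left_mono powr_mono2) auto
  finally show ?thesis unfolding \<xi>(2) .
qed

theorem theorem3:
  fixes \<beta> \<mu> T a b :: real
    and U f :: "real \<Rightarrow> real \<Rightarrow> real"
    and \<phi>0 \<psi>0 Ua Ub :: "real \<Rightarrow> real"
  assumes "1 < \<beta>" and "\<beta> < 2" and "0 < \<mu>" and "0 < T" and "a < b"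
    and pde: "\<And>x t. x \<in> {a<..<b} \<Longrightarrow> t \<in> {0<..T} \<Longrightarrow>
      caputo \<beta> (U x) t = \<mu> * (deriv ^^ 2) (\<lambda>y. U y t) x + f x t"
    and init: "\<And>x. x \<in> {a<..<b} \<Longrightarrow> U x 0 = \<phi>0 x"
    and init_deriv: "\<And>x. x \<in> {a<..<b} \<Longrightarrow>
      (U x has_real_derivative \<psi>0 x) (at 0 within {0..T})"
    and init_ext: "continuous_on {a..b} \<phi>0" "continuous_on {a..b} \<psi>0"
    and bdry: "\<And>t. t \<in> {0<..T} \<Longrightarrow> U a t = Ua t" "\<And>t. t \<in> {0<..T} \<Longrightarrow> U b t = Ub t"
    and reg: "U \<in> Cl_Cm_space 2 4 a b T"
  shows "\<exists>C>0. \<forall>(nT::nat) (N::nat) (\<tau>::real) (h::real) (u :: nat \<Rightarrow> nat \<Rightarrow> real).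
    0 < nT \<longrightarrow> 0 < N \<longrightarrow> \<tau> = T / real nT \<longrightarrow> h = (b - a) / real N \<longrightarrow>
    fd_scheme \<beta> \<mu> a \<phi>0 \<psi>0 Ua Ub f nT N \<tau> h u \<longrightarrow>
    (\<forall>n\<le>nT. grid_norm h N (\<lambda>j. U (a + real j * h) (real n * \<tau>) - u j n) \<le> C * (\<tau>\<^sup>2 + h\<^sup>2))"
proof -
  note \<beta> = assms(1,2) and \<mu> = assms(3) and T = assms(4) and ab = assms(5)
  define g where "g = \<beta> - 1"
  have g: "0 < g" "g < 1" "g + 1 = \<beta>" using \<beta> by (auto simp: g_def)
  obtain V B where V0: "V 0 = (\<lambda>t x. U x t)"
    and V: "\<And>k t. k \<le> 2 \<Longrightarrow> t \<in> {0..T} \<Longrightarrow> V k t \<in> Cm_space 4 a b"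
    and Vd: "\<And>k i x t. k < 2 \<Longrightarrow> i \<le> 4 \<Longrightarrow> x \<in> {a<..<b} \<Longrightarrow> t \<in> {0..T} \<Longrightarrow>
      ((\<lambda>s. (deriv ^^ i) (V k s) x) has_real_derivative (deriv ^^ i) (V (Suc k) t) x) (at t within {0..T})"
    and Vc: "\<And>k i x. k \<le> 2 \<Longrightarrow> i \<le> 4 \<Longrightarrow> x \<in> {a<..<b} \<Longrightarrow> continuous_on {0..T} (\<lambda>t. (deriv ^^ i) (V k t) x)"
    and VB: "\<And>k i x t. k \<le> 2 \<Longrightarrow> i \<le> 4 \<Longrightarrow> x \<in> {a<..<b} \<Longrightarrow> t \<in> {0..T} \<Longrightarrow> \<bar>(deriv ^^ i) (V k t) x\<bar> \<le> B"
    by (rule Cl_Cm_space_derivatives[OF reg ab T]) blast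
  have B: "0 \<le> B"
    using VB[of 0 0 "(a + b) / 2" 0] ab T by (simp add: order_trans[OF abs_ge_zero])
  have T0: "0 \<in> {0..T}" using T by simp
  (* The initial data are given by U on the open interval only; the scheme also uses them at the
     endpoints. *)
  have V00: "V 0 0 x = \<phi>0 x" and V10: "V 1 0 x = \<psi>0 x" if x: "x \<in> {a..b}" for x
  proof -
    show "V 0 0 x = \<phi>0 x"
      by (rule continuous_eq_on_closed_interval[OF ab Cm_space_D(1)[OF V] init_ext(1) _ x])
        (use T init in \<open>auto simp: V0\<close>)
    have "V 1 0 y = \<psi>0 y" if y: "y \<in> {a<..<b}" for y
    proof (rule has_field_derivative_unique)
      show "(U y has_real_derivative V 1 0 y) (at 0 within {0..T})"
        using Vd[of 0 0 y 0] y T0 by (simp add: V0)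
      show "(U y has_real_derivative \<psi>0 y) (at 0 within {0..T})" by (rule init_deriv[OF y])
      show "at 0 within {0..T} \<noteq> bot" using T by (simp add: trivial_limit_within)
    qed
    then show "V 1 0 x = \<psi>0 x"
      by (intro continuous_eq_on_closed_interval[OF ab Cm_space_D(1)[OF V] init_ext(2) _ x]) (use T in auto)
  qed
  (* p is U - \<phi>, and y is its second derivative in space; y and y1 vanish at time 0. *)
  define p where "p t x = V 0 t x - (V 0 0 x + t * V 1 0 x)" for t x
  have p_sp: "p t \<in> Cm_space 4 a b"
    and p_der: "\<And>i x. i \<le> 4 \<Longrightarrow> x \<in> {a<..<b} \<Longrightarrow> (deriv ^^ i) (p t) x =
      (deriv ^^ i) (V 0 t) x - ((deriv ^^ i) (V 0 0) x + t * (deriv ^^ i) (V 1 0) x)" if t: "t \<in> {0..T}" for t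
  proof -
    have L: "(\<lambda>x. V 0 0 x + t * V 1 0 x) \<in> Cm_space 4 a b"
      using Cm_space_lincomb(1)[OF V[of 0 0] V[of 1 0], where p = 1 and q = t] T0 by simp
    have L': "(deriv ^^ i) (\<lambda>x. V 0 0 x + t * V 1 0 x) x = (deriv ^^ i) (V 0 0) x + t * (deriv ^^ i) (V 1 0) x"
      if "i \<le> 4" "x \<in> {a<..<b}" for i x
      using Cm_space_lincomb(2)[OF V[of 0 0] V[of 1 0] that, where p = 1 and q = t] T0 by simp
    have V0t: "V 0 t \<in> Cm_space 4 a b" using V[of 0 t] t by simp
    show "p t \<in> Cm_space 4 a b" unfolding p_def[abs_def] by (rule Cm_space_diff(1)[OF V0t L])
    show "\<And>i x. i \<le> 4 \<Longrightarrow> x \<in> {a<..<b} \<Longrightarrow> (deriv ^^ i) (p t) x =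
      (deriv ^^ i) (V 0 t) x - ((deriv ^^ i) (V 0 0) x + t * (deriv ^^ i) (V 1 0) x)"
      unfolding p_def[abs_def] by (simp only: Cm_space_diff(2)[OF V0t L] L')
  qed
  define y where "y x t = (deriv ^^ 2) (V 0 t) x - ((deriv ^^ 2) (V 0 0) x + t * (deriv ^^ 2) (V 1 0) x)" for x t
  define y1 where "y1 x t = (deriv ^^ 2) (V 1 t) x - (deriv ^^ 2) (V 1 0) x" for x t
  define y2 where "y2 x t = (deriv ^^ 2) (V 2 t) x" for x t
  have yd: "(y x has_real_derivative y1 x t) (at t within {0..T})"
    and y1d: "(y1 x has_real_derivative y2 x t) (at t within {0..T})"
    if x: "x \<in> {a<..<b}" and t: "t \<in> {0..T}" for x t
  proof -
    have 0: "((\<lambda>s. (deriv ^^ 2) (V 0 s) x) has_real_derivative (deriv ^^ 2) (V 1 t) x) (at t within {0..T})"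
      using Vd[of 0 2 x t] x t by simp
    have 1: "((\<lambda>s. (deriv ^^ 2) (V 1 s) x) has_real_derivative (deriv ^^ 2) (V 2 t) x) (at t within {0..T})"
      using Vd[of 1 2 x t] x t by (simp add: numeral_2_eq_2)
    show "(y x has_real_derivative y1 x t) (at t within {0..T})"
      unfolding y_def[abs_def] y1_def by (auto intro!: derivative_eq_intros 0)
    show "(y1 x has_real_derivative y2 x t) (at t within {0..T})"
      unfolding y1_def[abs_def] y2_def by (rule DERIV_cong[OF DERIV_diff[OF 1 DERIV_const]]) simp
  qed
  have y2c: "continuous_on {0..T} (y2 x)" if "x \<in> {a<..<b}" for x
    unfolding y2_def[abs_def] using Vc[of 2 2 x] that by simp
  have y2B: "\<bar>y2 x t\<bar> \<le> B" if "x \<in> {a<..<b}" "t \<in> {0..T}" for x t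
    unfolding y2_def using VB[of 2 2 x t] that by simp
  have y00: "y x 0 = 0" "y1 x 0 = 0" for x by (simp_all add: y_def y1_def)
  have G: "Gamma (\<beta> + 1) > 0" "Gamma (\<beta> + 2) > 0" using \<beta> by (auto intro: Gamma_real_pos)
  (* The second space derivative of \<Phi>, which is J^\<beta> of that of \<phi>. *)
  define \<Phi>xx where "\<Phi>xx x t = (deriv ^^ 2) (V 0 0) x * (t powr \<beta> / Gamma (\<beta> + 1)) + (deriv ^^ 2) (V 1 0) x * (t powr (\<beta> + 1) / Gamma (\<beta> + 2))" for x t
  have exact: "p t x = \<mu> * (frac_integral \<beta> (y x) t + \<Phi>xx x t) + frac_integral \<beta> (f x) t"
    if x: "x \<in> {a<..<b}" and t: "t \<in> {0..T}" for x t
  proof -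
    have Ud: "(U x has_real_derivative V 1 s x) (at s within {0..T})" if "s \<in> {0..T}" for s
      using Vd[of 0 0 x s] x that by (simp add: V0)
    have V1d: "((\<lambda>s. V 1 s x) has_real_derivative V 2 s x) (at s within {0..T})" if "s \<in> {0..T}" for s
      using Vd[of 1 0 x s] x that by (simp add: numeral_2_eq_2)
    have V2c: "continuous_on {0..T} (\<lambda>s. V 2 s x)" using Vc[of 2 0 x] x by simp
    have wc: "continuous_on {0..T} (\<lambda>s. (deriv ^^ 2) (V 0 s) x)" using Vc[of 0 2 x] x by simp
    have t': "0 \<le> t" "t \<le> T" using t by auto
    have \<beta>0: "0 < \<beta>" using \<beta> by simp
    have "U x t - (U x 0 + V 1 0 x * t) = \<mu> * frac_integral \<beta> (\<lambda>s. (deriv ^^ 2) (V 0 s) x) t + frac_integral \<beta> (f x) t"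
      by (rule fractional_ode_integral_form[OF \<beta> t' Ud V1d V2c wc]) (use pde[OF x] in \<open>auto simp: V0\<close>)
    moreover have "frac_integral \<beta> (\<lambda>s. (deriv ^^ 2) (V 0 s) x) t = frac_integral \<beta> (y x) t + \<Phi>xx x t"
    proof -
      have yc: "continuous_on {0..t} (y x)"
        by (rule continuous_on_subset[OF DERIV_continuous_on[OF yd[OF x]]]) (use t in auto)
      let ?A = "(deriv ^^ 2) (V 0 0) x" and ?B = "(deriv ^^ 2) (V 1 0) x"
      have "frac_integral \<beta> (\<lambda>s. (deriv ^^ 2) (V 0 s) x) t = frac_integral \<beta> (\<lambda>s. y x s + (\<Sum>i\<le>1. (if i = 0 then ?A else ?B) * s ^ i)) t"
        by (simp add: y_def algebra_simps)
      also have "\<dots> = frac_integral \<beta> (y x) t + frac_integral \<beta> (\<lambda>s. \<Sum>i\<le>1. (if i = 0 then ?A else ?B) * s ^ i) t"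
        by (rule frac_integral_add[OF \<beta>0 t'(1) yc]) (intro continuous_intros)
      also have "frac_integral \<beta> (\<lambda>s. \<Sum>i\<le>1. (if i = 0 then ?A else ?B) * s ^ i) t = \<Phi>xx x t"
        unfolding frac_integral_poly[OF \<beta>0 t'(1)] by (simp add: \<Phi>xx_def add_ac)
      finally show ?thesis .
    qed
    ultimately show ?thesis by (simp add: p_def V0 mult.commute)
  qed
  show ?thesis
  proof (rule fractional_trapezoid_increment_error[OF g(1,2) T], goal_cases)
    case (1 C1)
    note C1 = 1(1) and quad = 1(2)
    obtain C2 where C2: "0 < C2" "\<And>n. (\<Sum>m\<le>n. \<bar>fps_nth (trapez_fps g) m\<bar>) \<le> C2 * real (n + 1) powr g"
      using trapez_abs_sum_bound[OF g(1,2)] by blast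
    (* K1 bounds the quadrature error in time; K2 and K3 bound the errors of the space
       differences of p and of \<Phi>. *)
    define K1 where "K1 = \<mu> * (C1 * B)"
    define K2 where "K2 = \<mu> * 2 powr (- \<beta>) * (2 * (C2 * (2 * T) powr g)) * ((2 + T) * B)"
    define K3 where "K3 = \<mu> * B * (\<beta> * T powr (\<beta> - 1) / Gamma (\<beta> + 1) + (\<beta> + 1) * T powr \<beta> / Gamma (\<beta> + 2))"
    have K: "0 \<le> K1" "0 \<le> K2" "0 \<le> K3"
      unfolding K1_def K2_def K3_def using \<mu> C1 C2 B T G \<beta> by (auto intro!: mult_nonneg_nonneg add_nonneg_nonneg divide_nonneg_pos)
    define C where "C = 2 * T * sqrt (b - a) * (K1 + K2 + K3) + 1"
    have C: "0 < C" unfolding C_def using K T ab by (intro add_nonneg_pos mult_nonneg_nonneg) auto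
    have "grid_norm h N (\<lambda>j. U (a + real j * h) (real n * \<tau>) - u j n) \<le> C * (\<tau>\<^sup>2 + h\<^sup>2)"
      if nT: "0 < nT" and N: "0 < N" and \<tau>_def: "\<tau> = T / real nT" and h_def: "h = (b - a) / real N"
        and scheme: "fd_scheme \<beta> \<mu> a \<phi>0 \<psi>0 Ua Ub f nT N \<tau> h u" and n: "n \<le> nT"
      for nT N n :: nat and \<tau> h :: real and u
    proof -
      define x where "x j = a + real j * h" for j
      define t where "t k = real k * \<tau>" for k
      have \<tau>: "0 < \<tau>" using T nT by (simp add: \<tau>_def)
      have h: "0 < h" using ab N by (simp add: h_def)
      have hN: "h * real N = b - a" using N by (simp add: h_def)
      have tn: "t k \<in> {0..T}" if "k \<le> nT" for k
        unfolding t_def \<tau>_def using that nT T by (simp add: divide_le_eq mult.commute mult_right_mono)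
      have xb: "x j \<in> {a..b}" if "j \<le> N" for j
      proof -
        have "real j * h \<le> real N * h" using that h by (intro mult_right_mono) auto
        then show ?thesis using h hN by (simp add: x_def mult.commute)
      qed
      have xi: "x j \<in> {a<..<b}" if "1 \<le> j" "j < N" for j
      proof -
        have "real j * h < real N * h" using that h by simp
        moreover have "0 < real j * h" using that h by simp
        ultimately show ?thesis using hN by (simp add: x_def mult.commute)
      qed
      have x_pred: "x (j - 1) = x j - h" if "1 \<le> j" for j using that by (simp add: x_def of_nat_diff algebra_simps)
      have x_succ: "x (j + 1) = x j + h" for j by (simp add: x_def algebra_simps)
      define e where "e j k = U (x j) (t k) - u j k" for j k
      define \<phi> where "\<phi> j k = varphi_val \<phi>0 \<psi>0 (x j) (t k)" for j k
      define \<Phi> where "\<Phi> j k = Phi_val \<beta> \<phi>0 \<psi>0 (x j) (t k)" for j k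
      define F where "F j k = frac_integral \<beta> (f (x j)) (t k)" for j k
      have sch: "(\<Sum>k=0..m. alpha_coeff \<beta> (m - k) * (u j k - \<phi> j k)) =
                \<mu> * \<tau> powr \<beta> * (\<Sum>k=0..m. theta_coeff \<beta> (m - k) *
                   (second_diff h (\<lambda>i. u i k) j - second_diff h (\<lambda>i. \<phi> i k) j))
                + \<mu> * (\<Sum>k=0..m. alpha_coeff \<beta> (m - k) * second_diff h (\<lambda>i. \<Phi> i k) j)
                + (\<Sum>k=0..m. alpha_coeff \<beta> (m - k) * F j k)"
        if "1 \<le> j" "j \<le> N - 1" "1 \<le> m" "m \<le> nT" for j m
        using scheme that unfolding fd_scheme_def Let_def \<phi>_def \<Phi>_def F_def x_def t_def by blast
      have sch_b: "u 0 k = Ua (t k)" "u N k = Ub (t k)" if "k \<le> nT" for k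
        using scheme that unfolding fd_scheme_def Let_def t_def by blast+
      have sch_i: "u j 0 = \<phi>0 (x j)" if "j \<le> N" for j
        using scheme that unfolding fd_scheme_def Let_def x_def by blast
      have e0: "e j 0 = 0" if "j \<le> N" for j
        using sch_i[OF that] V00[OF xb[OF that]] by (simp add: e_def t_def V0)
      have eb: "e 0 k = 0 \<and> e N k = 0" if k: "k \<le> nT" for k
      proof (cases "k = 0")
        case True
        then show ?thesis using e0 by simp
      next
        case False
        then have "t k \<in> {0<..T}" using tn[OF k] \<tau> by (simp add: t_def)
        moreover have "x 0 = a" "x N = b" using hN by (simp_all add: x_def mult.commute)
        ultimately show ?thesis using sch_b[OF k] bdry by (simp add: e_def)
      qed
      have pU: "p (t k) (x j) = U (x j) (t k) - \<phi> j k" if "j \<le> N" for j k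
        using V00[OF xb[OF that]] V10[OF xb[OF that]]
        by (simp add: p_def V0[THEN fun_cong, THEN fun_cong] \<phi>_def varphi_val_def mult.commute)
      (* ep and dl are the errors of the space differences of p and of \<Phi>. *)
      define ep where "ep j k = y (x j) (t k) - second_diff h (\<lambda>i. p (t k) (x i)) j" for j k
      define dl where "dl j k = \<Phi>xx (x j) (t k) - second_diff h (\<lambda>i. \<Phi> i k) j" for j k
      define r where "r j k = \<mu> * (frac_integral \<beta> (y (x j)) (t k) + dl j k)" for j k
      have sd: "(\<bar>(deriv ^^ 2) v (x j) - second_diff h (\<lambda>i. v (x i)) j\<bar> \<le> D * h\<^sup>2)"
        if v: "v \<in> Cm_space 4 a b" "\<And>z. z \<in> {a<..<b} \<Longrightarrow> \<bar>(deriv ^^ 4) v z\<bar> \<le> D" and j: "1 \<le> j" "j < N" for v D j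
      proof -
        have "j - 1 \<le> N" "j + 1 \<le> N" using j by auto
        then have "a \<le> x j - h" "x j + h \<le> b"
          using xb[of "j - 1"] xb[of "j + 1"] x_pred[OF j(1)] x_succ[of j] by auto
        then show ?thesis
          using Cm_space_second_difference[OF v h] unfolding second_diff_def x_pred[OF j(1)] x_succ by blast
      qed
      have recursion: "e j m - e j (m - 1) = \<mu> * \<tau> powr \<beta> * 2 powr (- \<beta>) *
            fps_nth (trapez_fps g * ((1 + fps_X) * Abs_fps (\<lambda>k. second_diff h (\<lambda>i. e i k) j))) m
          + (r j m - r j (m - 1) - \<mu> * \<tau> powr \<beta> * 2 powr (- \<beta>) * fps_nth ((1 + fps_X) * (trapez_fps g * Abs_fps (\<lambda>k. y (x j) (t k)))) m)
          + \<mu> * \<tau> powr \<beta> * 2 powr (- \<beta>) * fps_nth (((1 + fps_X) * trapez_fps g) * Abs_fps (ep j)) m"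
        if j: "1 \<le> j" "j < N" and m: "1 \<le> m" "m \<le> nT" for j m
        unfolding g_def
      proof (rule scheme_incremental_form[OF _ m])
        fix m assume m: "m \<le> nT"
        have ex: "e j k - r j k = F j k - (u j k - \<phi> j k) + \<mu> * second_diff h (\<lambda>i. \<Phi> i k) j" if k: "k \<le> nT" for k
        proof -
          have "U (x j) (t k) - \<phi> j k = \<mu> * (frac_integral \<beta> (y (x j)) (t k) + \<Phi>xx (x j) (t k)) + F j k"
            using exact[OF xi[OF j] tn[OF k]] pU[of j k] j by (simp add: F_def)
          then show ?thesis by (simp add: e_def r_def dl_def algebra_simps)
        qed
        have de: "y (x j) (t k) - ep j k - second_diff h (\<lambda>i. e i k) j = second_diff h (\<lambda>i. u i k) j - second_diff h (\<lambda>i. \<phi> i k) j" for k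
        proof -
          have "j + 1 \<le> N" "j \<le> N" "j - 1 \<le> N" using j by auto
          from this[THEN pU, of k] show ?thesis
            by (simp add: ep_def second_diff_def e_def diff_divide_distrib[symmetric] algebra_simps)
        qed
        have "(\<Sum>k=0..m. alpha_coeff \<beta> (m - k) * (e j k - r j k)) =
            (\<Sum>k=0..m. alpha_coeff \<beta> (m - k) * F j k) - (\<Sum>k=0..m. alpha_coeff \<beta> (m - k) * (u j k - \<phi> j k))
            + \<mu> * (\<Sum>k=0..m. alpha_coeff \<beta> (m - k) * second_diff h (\<lambda>i. \<Phi> i k) j)"
        proof -
          have "(\<Sum>k=0..m. alpha_coeff \<beta> (m - k) * (e j k - r j k)) =
              (\<Sum>k=0..m. alpha_coeff \<beta> (m - k) * F j k - alpha_coeff \<beta> (m - k) * (u j k - \<phi> j k)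
                + \<mu> * (alpha_coeff \<beta> (m - k) * second_diff h (\<lambda>i. \<Phi> i k) j))"
          proof (rule sum.cong[OF refl])
            fix k assume "k \<in> {0..m}"
            then have k: "k \<le> nT" using m by simp
            show "alpha_coeff \<beta> (m - k) * (e j k - r j k) = alpha_coeff \<beta> (m - k) * F j k - alpha_coeff \<beta> (m - k) * (u j k - \<phi> j k)
                + \<mu> * (alpha_coeff \<beta> (m - k) * second_diff h (\<lambda>i. \<Phi> i k) j)"
              unfolding ex[OF k] by (simp add: algebra_simps)
          qed
          then show ?thesis by (simp add: sum.distrib sum_subtractf sum_distrib_left)
        qed
        also have "\<dots> = - (\<mu> * \<tau> powr \<beta>) * (\<Sum>k=0..m. theta_coeff \<beta> (m - k) *
                   (second_diff h (\<lambda>i. u i k) j - second_diff h (\<lambda>i. \<phi> i k) j))"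
        (* The scheme is only imposed for m at least 1; at m = 0 both sides vanish by the
           initial condition. *)
        proof (cases "m = 0")
          case True
          have "u j 0 = \<phi> j 0" "\<And>i. i \<le> N \<Longrightarrow> u i 0 = \<phi> i 0" "\<Phi> i 0 = 0" "F j 0 = 0" for i
            using sch_i j by (auto simp: \<phi>_def \<Phi>_def F_def varphi_val_def Phi_val_def t_def)
          then show ?thesis using True j by (simp add: second_diff_def)
        next
          case False
          then show ?thesis using sch[of j m] j m by simp
        qed
        finally show "(\<Sum>k=0..m. alpha_coeff \<beta> (m - k) * (e j k - r j k)) =
          - (\<mu> * \<tau> powr \<beta>) * (\<Sum>k=0..m. theta_coeff \<beta> (m - k) * (y (x j) (t k) - ep j k - second_diff h (\<lambda>i. e i k) j))"
          unfolding de .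
      qed
      define kap where "kap = \<mu> * \<tau> powr \<beta> * 2 powr (- \<beta>)"
      define s where "s j m = (r j m - r j (m - 1) - kap * fps_nth ((1 + fps_X) * (trapez_fps g * Abs_fps (\<lambda>k. y (x j) (t k)))) m)
          + kap * fps_nth (((1 + fps_X) * trapez_fps g) * Abs_fps (ep j)) m" for j m
      define sig where "sig = (K1 + K2 + K3) * \<tau> * (\<tau>\<^sup>2 + h\<^sup>2)"
      have s_bound: "\<bar>s j m\<bar> \<le> sig" if j: "1 \<le> j" "j < N" and m: "1 \<le> m" "m \<le> nT" for j m
      proof -
        note xj = xi[OF j]
        have q: "\<bar>frac_integral \<beta> (y (x j)) (t m) - frac_integral \<beta> (y (x j)) (t (m - 1))
            - \<tau> powr \<beta> * 2 powr (- \<beta>) * fps_nth ((1 + fps_X) * (trapez_fps g * Abs_fps (\<lambda>k. y (x j) (t k)))) m\<bar> \<le> C1 * B * \<tau> ^ 3"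
          using quad[OF yd[OF xj] y1d[OF xj] y2c[OF xj] y2B[OF xj] y00 nT \<tau>_def m] unfolding g(3) t_def .
        have epb: "\<bar>ep j k\<bar> \<le> (2 + T) * B * h\<^sup>2" if k: "k \<le> nT" for k
        proof -
          have "\<bar>(deriv ^^ 4) (p (t k)) z\<bar> \<le> (2 + T) * B" if z: "z \<in> {a<..<b}" for z
          proof -
            have "\<bar>(deriv ^^ 4) (V 0 (t k)) z\<bar> \<le> B" "\<bar>(deriv ^^ 4) (V 0 0) z\<bar> \<le> B"
              using VB z tn[OF k] T0 by auto
            moreover have "\<bar>t k * (deriv ^^ 4) (V 1 0) z\<bar> \<le> T * B"
              unfolding abs_mult using VB[of 1 4 z 0] z tn[OF k] T by (intro mult_mono) auto
            ultimately show ?thesis unfolding p_der[OF tn[OF k] order_refl z] by (simp add: algebra_simps)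
          qed
          from sd[OF p_sp[OF tn[OF k]] this j]
          show ?thesis unfolding ep_def y_def using p_der[OF tn[OF k] _ xj, of 2] by simp
        qed
        have space_part: "\<bar>kap * fps_nth (((1 + fps_X) * trapez_fps g) * Abs_fps (ep j)) m\<bar> \<le> K2 * \<tau> * h\<^sup>2"
        proof -
          have "(\<Sum>i\<le>m. \<bar>fps_nth (1 + fps_X :: real fps) i\<bar>) \<le> 2"
          proof -
            have "(\<Sum>i\<le>m. \<bar>fps_nth (1 + fps_X :: real fps) i\<bar>) \<le> (\<Sum>i\<le>m. (if i = 0 then 1 else 0) + (if i = 1 then 1 else 0))"
              by (intro sum_mono) (simp add: fps_X_nth)
            also have "\<dots> \<le> 2" by (simp add: sum.distrib)
            finally show ?thesis .
          qed
          then have "(\<Sum>i\<le>m. \<bar>fps_nth ((1 + fps_X) * trapez_fps g) i\<bar>) \<le> 2 * (C2 * real (m + 1) powr g)"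
            by (intro order_trans[OF fps_mult_abs_partial_sums] mult_mono C2(2)) (auto intro: sum_nonneg)
          moreover have "\<bar>fps_nth (((1 + fps_X) * trapez_fps g) * Abs_fps (ep j)) m\<bar>
              \<le> (\<Sum>i\<le>m. \<bar>fps_nth ((1 + fps_X) * trapez_fps g) i\<bar>) * ((2 + T) * B * h\<^sup>2)"
            using epb m by (intro fps_mult_nth_bound) auto
          ultimately have "\<bar>fps_nth (((1 + fps_X) * trapez_fps g) * Abs_fps (ep j)) m\<bar> \<le> 2 * (C2 * real (m + 1) powr g) * ((2 + T) * B * h\<^sup>2)"
            using T B by (elim order_trans) (intro mult_right_mono, auto)
          then have "\<bar>kap * fps_nth (((1 + fps_X) * trapez_fps g) * Abs_fps (ep j)) m\<bar> \<le> kap * (2 * (C2 * real (m + 1) powr g) * ((2 + T) * B * h\<^sup>2))"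
            unfolding abs_mult kap_def using \<mu> by (simp add: mult_left_mono)
          (* \<tau>^\<beta> = \<tau> \<tau>^g, and \<tau>^g absorbs the growth of the sum of the
             weights. *)
          also have "\<dots> = \<mu> * 2 powr (- \<beta>) * \<tau> * (2 * (C2 * (real (m + 1) * \<tau>) powr g)) * ((2 + T) * B * h\<^sup>2)"
            unfolding kap_def g(3)[symmetric] using \<tau> by (simp add: powr_mult powr_add)
          also have "\<dots> \<le> \<mu> * 2 powr (- \<beta>) * \<tau> * (2 * (C2 * (2 * T) powr g)) * ((2 + T) * B * h\<^sup>2)"
          proof -
            have "real (m + 1) * \<tau> \<le> 2 * T"
              using tn[OF m(2)] tn[of 1] nT by (simp add: t_def algebra_simps)
            then show ?thesis
              using \<mu> \<tau> C2 T B g by (intro mult_right_mono mult_left_mono powr_mono2) auto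
          qed
          also have "\<dots> = K2 * \<tau> * h\<^sup>2" by (simp add: K2_def mult_ac)
          finally show ?thesis .
        qed
        have initial_part: "\<bar>\<mu> * (dl j m - dl j (m - 1))\<bar> \<le> K3 * \<tau> * h\<^sup>2"
        proof -
          (* \<Phi> is a product of functions of x and of t: its time factors have increments of
             size \<tau>. *)
          define d0 where "d0 = (deriv ^^ 2) (V 0 0) (x j) - second_diff h (\<lambda>i. V 0 0 (x i)) j"
          define d1 where "d1 = (deriv ^^ 2) (V 1 0) (x j) - second_diff h (\<lambda>i. V 1 0 (x i)) j"
          have d: "\<bar>d0\<bar> \<le> B * h\<^sup>2" "\<bar>d1\<bar> \<le> B * h\<^sup>2"
            unfolding d0_def d1_def using V T0 VB j by (auto intro!: sd)
          have dl: "dl j k = d0 * (t k powr \<beta> / Gamma (\<beta> + 1)) + d1 * (t k powr (\<beta> + 1) / Gamma (\<beta> + 2))" for k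
          proof -
            have "\<Phi> i k = V 0 0 (x i) * (t k powr \<beta> / Gamma (\<beta> + 1)) + V 1 0 (x i) * (t k powr (\<beta> + 1) / Gamma (\<beta> + 2))" if "i \<le> N" for i
              using V00[OF xb[OF that]] V10[OF xb[OF that]] by (simp add: \<Phi>_def Phi_val_def)
            then have "second_diff h (\<lambda>i. \<Phi> i k) j = second_diff h (\<lambda>i. V 0 0 (x i)) j * (t k powr \<beta> / Gamma (\<beta> + 1))
                + second_diff h (\<lambda>i. V 1 0 (x i)) j * (t k powr (\<beta> + 1) / Gamma (\<beta> + 2))"
              using j by (simp add: second_diff_def algebra_simps add_divide_distrib diff_divide_distrib)
            then show ?thesis by (simp add: dl_def \<Phi>xx_def d0_def d1_def algebra_simps)
          qed
          have tm: "0 \<le> t (m - 1)" "t (m - 1) < t m" "t m \<le> T" "t m - t (m - 1) = \<tau>"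
          proof -
            have "real (m - 1) = real m - 1" using m by simp
            then show "t (m - 1) < t m" "t m - t (m - 1) = \<tau>" using \<tau> by (simp_all add: t_def algebra_simps)
            show "0 \<le> t (m - 1)" "t m \<le> T" using tn[of "m - 1"] tn[of m] m by auto
          qed
          have P0: "\<bar>t m powr \<beta> - t (m - 1) powr \<beta>\<bar> \<le> \<beta> * T powr (\<beta> - 1) * \<tau>"
            using powr_increment_bound[OF _ tm(1,2,3), of \<beta>] \<beta> unfolding tm(4) by simp
          have P1: "\<bar>t m powr (\<beta> + 1) - t (m - 1) powr (\<beta> + 1)\<bar> \<le> (\<beta> + 1) * T powr \<beta> * \<tau>"
            using powr_increment_bound[OF _ tm(1,2,3), of "\<beta> + 1"] \<beta> unfolding tm(4) by simp
          have "dl j m - dl j (m - 1) = d0 * ((t m powr \<beta> - t (m - 1) powr \<beta>) / Gamma (\<beta> + 1))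
              + d1 * ((t m powr (\<beta> + 1) - t (m - 1) powr (\<beta> + 1)) / Gamma (\<beta> + 2))"
            unfolding dl by (simp add: algebra_simps diff_divide_distrib)
          also have "\<bar>\<dots>\<bar> \<le> B * h\<^sup>2 * (\<beta> * T powr (\<beta> - 1) * \<tau> / Gamma (\<beta> + 1)) + B * h\<^sup>2 * ((\<beta> + 1) * T powr \<beta> * \<tau> / Gamma (\<beta> + 2))"
          proof (intro order_trans[OF abs_triangle_ineq] add_mono)
            show "\<bar>d0 * ((t m powr \<beta> - t (m - 1) powr \<beta>) / Gamma (\<beta> + 1))\<bar> \<le> B * h\<^sup>2 * (\<beta> * T powr (\<beta> - 1) * \<tau> / Gamma (\<beta> + 1))"
              unfolding abs_mult abs_divide using d P0 G B by (intro mult_mono frac_le) auto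
            show "\<bar>d1 * ((t m powr (\<beta> + 1) - t (m - 1) powr (\<beta> + 1)) / Gamma (\<beta> + 2))\<bar> \<le> B * h\<^sup>2 * ((\<beta> + 1) * T powr \<beta> * \<tau> / Gamma (\<beta> + 2))"
              unfolding abs_mult abs_divide using d P1 G B by (intro mult_mono frac_le) auto
          qed
          finally have "\<mu> * \<bar>dl j m - dl j (m - 1)\<bar> \<le> \<mu> * (B * h\<^sup>2 * (\<beta> * T powr (\<beta> - 1) * \<tau> / Gamma (\<beta> + 1)) + B * h\<^sup>2 * ((\<beta> + 1) * T powr \<beta> * \<tau> / Gamma (\<beta> + 2)))"
            using \<mu> by (intro mult_left_mono) auto
          also have "\<dots> = K3 * \<tau> * h\<^sup>2" by (simp add: K3_def algebra_simps)
          finally show ?thesis using \<mu> by (simp add: abs_mult)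
        qed
        have "s j m = \<mu> * (frac_integral \<beta> (y (x j)) (t m) - frac_integral \<beta> (y (x j)) (t (m - 1))
            - \<tau> powr \<beta> * 2 powr (- \<beta>) * fps_nth ((1 + fps_X) * (trapez_fps g * Abs_fps (\<lambda>k. y (x j) (t k)))) m)
            + \<mu> * (dl j m - dl j (m - 1)) + kap * fps_nth (((1 + fps_X) * trapez_fps g) * Abs_fps (ep j)) m"
          unfolding s_def r_def kap_def by (simp only: distrib_left right_diff_distrib mult.assoc)
        moreover have "\<bar>\<mu> * (frac_integral \<beta> (y (x j)) (t m) - frac_integral \<beta> (y (x j)) (t (m - 1))
            - \<tau> powr \<beta> * 2 powr (- \<beta>) * fps_nth ((1 + fps_X) * (trapez_fps g * Abs_fps (\<lambda>k. y (x j) (t k)))) m)\<bar> \<le> K1 * \<tau> * \<tau>\<^sup>2"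
        proof -
          have "\<mu> * (C1 * B * \<tau> ^ 3) = K1 * \<tau> * \<tau>\<^sup>2" by (simp add: K1_def power2_eq_square power3_eq_cube)
          then show ?thesis using mult_left_mono[OF q less_imp_le[OF \<mu>]] \<mu> by (simp add: abs_mult)
        qed
        ultimately have "\<bar>s j m\<bar> \<le> K1 * \<tau> * \<tau>\<^sup>2 + K3 * \<tau> * h\<^sup>2 + K2 * \<tau> * h\<^sup>2"
          using space_part initial_part by linarith
        also have "\<dots> \<le> sig"
        proof -
          have "0 \<le> (K2 + K3) * \<tau> * \<tau>\<^sup>2" "0 \<le> K1 * \<tau> * h\<^sup>2" using K \<tau> by auto
          then show ?thesis unfolding sig_def by (simp add: algebra_simps)
        qed
        finally show ?thesis .
      qed
      have "grid_norm h N (\<lambda>j. e j n) \<le> 2 * real nT * sqrt (h * real N) * sig"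
      proof (rule energy_stability[where M = nT and g = "fps_nth (trapez_fps g)" and kap = kap and s = s])
        show "0 \<le> kap" using \<mu> by (simp add: kap_def)
        show "0 \<le> sig" unfolding sig_def using K \<tau> by simp
        show "0 \<le> (\<Sum>l\<le>m. w l * (\<Sum>k\<le>l. fps_nth (trapez_fps g) (l - k) * w k))" for w m
          using g by (intro trapez_positive_type) auto
        show "e j m - e j (m - 1) = kap * (\<Sum>k\<le>m. fps_nth (trapez_fps g) (m - k) *
            second_diff h (\<lambda>i. e i k + (if k = 0 then 0 else e i (k - 1))) j) + s j m"
          if "1 \<le> j" "j < N" "1 \<le> m" "m \<le> nT" for j m
        proof -
          have "fps_nth ((1 + fps_X) * Abs_fps (\<lambda>k. second_diff h (\<lambda>i. e i k) j)) k =
              second_diff h (\<lambda>i. e i k + (if k = 0 then 0 else e i (k - 1))) j" for k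
            by (simp add: distrib_right fps_X_mult_nth second_diff_def add_divide_distrib diff_divide_distrib algebra_simps)
          then have "fps_nth (trapez_fps g * ((1 + fps_X) * Abs_fps (\<lambda>k. second_diff h (\<lambda>i. e i k) j))) m =
              (\<Sum>k\<le>m. fps_nth (trapez_fps g) (m - k) * second_diff h (\<lambda>i. e i k + (if k = 0 then 0 else e i (k - 1))) j)"
            by (simp only: fps_mult_nth_rev)
          then show ?thesis using recursion[OF that] unfolding s_def kap_def by simp
        qed
      qed (use N h e0 eb s_bound n in auto)
      also have "\<dots> = 2 * (real nT * \<tau>) * sqrt (b - a) * (K1 + K2 + K3) * (\<tau>\<^sup>2 + h\<^sup>2)"
        unfolding hN sig_def by (simp add: mult_ac)
      also have "real nT * \<tau> = T" using nT by (simp add: \<tau>_def)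
      also have "2 * T * sqrt (b - a) * (K1 + K2 + K3) * (\<tau>\<^sup>2 + h\<^sup>2) \<le> C * (\<tau>\<^sup>2 + h\<^sup>2)"
        unfolding C_def by (intro mult_right_mono) auto
      finally show ?thesis by (simp add: e_def x_def t_def)
    qed
    then show ?case using C by blast
  qed
qed

end
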